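(* Let $M$ be an orientable surface (with a fixed orientation) equipped with a complete euclidean or hyperbolic structure, and let $\gamma:S^1\to M$ be a non-null-homotopic generic regular closed curve. Then $$W(\gamma)=\sum_{d\in D(\gamma)}\operatorname{sgn}(\gamma,d)=\sum_{d\in D_\pm(\gamma)}\operatorname{sgn}(\gamma,d),$$ where $W(\gamma)\in\mathbb Z$ is the winding number of $\gamma$, $D(\gamma)$ is the set of double points of $\gamma$, and $D_\pm(\gamma)\subset D(\gamma)$ and $\operatorname{sgn}(\gamma,d)\in\{-1,0,+1\}$ are as defined in the context.
   Context: A regular closed curve is a $C^1$ immersion $\gamma:S^1\to M$; it is generic if all its self-intersection points are transversal double points. Let $p_M:\widetilde M\to M$ be the universal covering, where $\widetilde M$ is the euclidean plane $\mathbb E^2$ or the hyperbolic plane $\mathbb H^2$, with the lifted orientation, and let $p_{S^1}:\mathbb R\to S^1$, $p_{S^1}(t)=(\cos 2\pi t,\sin 2\pi t)$. A cover of $\gamma$ is a lift $\widetilde\gamma:\mathbb R\to\widetilde M$ of $\gamma\circ p_{S^1}$ to $\widetilde M$. Any two covers differ by composition with a deck transformation of $\widetilde M$. Let $T_0$ be the deck transformation with $T_0\circ\widetilde\gamma(t)=\widetilde\gamma(t+1)$. Double points. $D(\gamma)$ is the set of double points of $\gamma$. At $d\in D(\gamma)$ the curve splits into two loops based at $d$; $D_\pm(\gamma)$ is the set of those $d$ for which one of these two loops is null-homotopic, equivalently for which some (equivalently every) cover $\widetilde\gamma$ has a double point $\widetilde d$ with $p_M(\widetilde d)=d$. Put $D_0(\gamma)=D(\gamma)\setminus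 D_\pm(\gamma)$. Signs. For a double point $\widetilde d=\widetilde\gamma(t_1)=\widetilde\gamma(t_2)$, $t_1<t_2$, of a cover $\widetilde\gamma$, and small $\delta>0$, $\operatorname{sgn}(\widetilde\gamma,\widetilde d)=+1$ (resp. $-1$) if the arc $\widetilde\gamma((t_2-\delta,t_2+\delta))$ crosses the arc $\widetilde\gamma((t_1-\delta,t_1+\delta))$ from left to right (resp. from right to left). For $d\in D_0(\gamma)$ set $\operatorname{sgn}(\gamma,d)=0$. For $d\in D_\pm(\gamma)$ set $\operatorname{sgn}(\gamma,d)=\operatorname{sgn}(\widetilde\gamma,\widetilde d)$ for any cover $\widetilde\gamma$ and any double point $\widetilde d$ of $\widetilde\gamma$ over $d$; this is independent of the choices. Winding number. $T_0$ is a nontrivial orientation-preserving fixed-point-free isometry of $\widetilde M$: a translation of $\mathbb E^2$, or a hyperbolic or parabolic isometry of $\mathbb H^2$. Let $(\varphi_s)_{s\in\mathbb R}$ be the one-parameter group of isometries (of translations, in the euclidean case) with $\varphi_1=T_0$, and let $X$ be the nowhere vanishing, $T_0$-invariant vector field on $\widetilde M$ generating it. Let $\theta:\mathbb R\to\mathbb R$ be a continuous choice of the oriented (counterclockwise positive) angle from $X(\widetilde\gamma(t))$ to $\widetilde\gamma'(t)$. Then $W(\gamma)=\frac{1}{2\pi}(\theta(1)-\theta(0))\in\mathbb Z$, which is independent of the choices. *)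

theory Defs
  imports "HOL-Analysis.Analysis"
begin

section \<open>The two model planes\<close>

datatype geometry = Euclidean | Hyperbolic

text \<open>
  The hyperbolic plane is the upper half-plane model. It is conformal, so oriented hyperbolic
  angles are oriented angles of the underlying complex numbers. Both planes carry the standard
  orientation of the complex numbers.
\<close>

fun plane :: "geometry \<Rightarrow> complex set" where
  "plane Euclidean = UNIV"
| "plane Hyperbolic = {z. 0 < Im z}"

fun plane_dist :: "geometry \<Rightarrow> complex \<Rightarrow> complex \<Rightarrow> real" where
  "plane_dist Euclidean z w = dist z w"
| "plane_dist Hyperbolic z w = arcosh (1 + (dist z w)\<^sup>2 / (2 * Im z * Im w))"

text \<open>Positive iff \<open>(u, v)\<close> is a positive basis, i.e. iff \<open>v\<close> points to the left of \<open>u\<close>.\<close>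

definition oriented_area :: "complex \<Rightarrow> complex \<Rightarrow> real" where
  "oriented_area u v = Re u * Im v - Im u * Re v"

definition plane_isometry :: "geometry \<Rightarrow> (complex \<Rightarrow> complex) \<Rightarrow> bool" where
  "plane_isometry G f \<longleftrightarrow>
     bij_betw f (plane G) (plane G) \<and>
     (\<forall>z\<in>plane G. \<forall>w\<in>plane G. plane_dist G (f z) (f w) = plane_dist G z w)"

definition oriented_isometry :: "geometry \<Rightarrow> (complex \<Rightarrow> complex) \<Rightarrow> bool" where
  "oriented_isometry G f \<longleftrightarrow>
     plane_isometry G f \<and>
     (\<forall>z\<in>plane G. \<exists>D. (f has_derivative D) (at z) \<and> 0 < oriented_area (D 1) (D \<i>))"


section \<open>Oriented surfaces with a complete euclidean or hyperbolic structure\<close>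

text \<open>
  A chart is a pair \<open>(U, c)\<close> of an open subset of the surface and a homeomorphism from \<open>U\<close> onto
  an open subset of the model plane. The fixed orientation is the one for which all charts are
  orientation preserving, whence the orientation-preserving coordinate changes. The Hausdorff
  property comes from the type class.
\<close>

definition geometric_surface ::
  "geometry \<Rightarrow> 'm::t2_space set \<Rightarrow> ('m set \<times> ('m \<Rightarrow> complex)) set \<Rightarrow> bool" where
  "geometric_surface G M A \<longleftrightarrow>
     connected M \<and> second_countable (top_of_set M) \<and>
     (\<Union>(U, c)\<in>A. U) = M \<and>
     (\<forall>(U, c)\<in>A. openin (top_of_set M) U \<and> open (c ` U) \<and> c ` U \<subseteq> plane G \<and>
                  (\<exists>c'. homeomorphism U (c ` U) c c')) \<and>
     (\<forall>(U, c)\<in>A. \<forall>(V, d)\<in>A. \<forall>x\<in>U \<inter> V. \<exists>g W.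
        oriented_isometry G g \<and> openin (top_of_set M) W \<and> x \<in> W \<and> W \<subseteq> U \<inter> V \<and>
        (\<forall>y\<in>W. d y = g (c y)))"

text \<open>Unit-speed local geodesics, and completeness in the sense of Hopf--Rinow.\<close>

definition local_geodesic ::
  "geometry \<Rightarrow> ('m set \<times> ('m \<Rightarrow> complex)) set \<Rightarrow> real set \<Rightarrow> (real \<Rightarrow> 'm) \<Rightarrow> bool" where
  "local_geodesic G A I q \<longleftrightarrow>
     (\<forall>t\<in>I. \<exists>(U, c)\<in>A. \<exists>e>0. \<forall>r\<in>I \<inter> ball t e. \<forall>s\<in>I \<inter> ball t e.
        q r \<in> U \<and> q s \<in> U \<and> plane_dist G (c (q r)) (c (q s)) = \<bar>r - s\<bar>)"

definition geodesically_complete ::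
  "geometry \<Rightarrow> ('m set \<times> ('m \<Rightarrow> complex)) set \<Rightarrow> bool" where
  "geodesically_complete G A \<longleftrightarrow>
     (\<forall>a b q. a < b \<longrightarrow> local_geodesic G A {a<..<b} q \<longrightarrow>
        (\<exists>q'. local_geodesic G A UNIV q' \<and> (\<forall>t\<in>{a<..<b}. q' t = q t)))"

text \<open>
  The model plane is simply connected, so a covering by it is universal. The second condition says
  that \<open>p\<close> is a local isometry preserving orientation, that is, the metric and the orientation
  of the model plane are the lifted ones.
\<close>

definition universal_covering ::
  "geometry \<Rightarrow> 'm::t2_space set \<Rightarrow> ('m set \<times> ('m \<Rightarrow> complex)) set \<Rightarrow> (complex \<Rightarrow> 'm) \<Rightarrow> bool" where
  "universal_covering G M A p \<longleftrightarrow>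
     covering_space (plane G) p M \<and>
     (\<forall>z\<in>plane G. \<forall>(U, c)\<in>A. p z \<in> U \<longrightarrow>
        (\<exists>g. oriented_isometry G g \<and> (\<forall>\<^sub>F w in nhds z. c (p w) = g w)))"

definition deck_transformation ::
  "geometry \<Rightarrow> (complex \<Rightarrow> 'm) \<Rightarrow> (complex \<Rightarrow> complex) \<Rightarrow> bool" where
  "deck_transformation G p T \<longleftrightarrow>
     (\<exists>S. homeomorphism (plane G) (plane G) T S) \<and> (\<forall>z\<in>plane G. p (T z) = p z)"


section \<open>Generic regular closed curves\<close>

text \<open>A closed curve is a map on \<open>sphere 0 1\<close>, the unit circle in the complex plane.\<close>

definition circle_cover :: "real \<Rightarrow> complex" where
  "circle_cover t = cis (2 * pi * t)"

definition velocity :: "('m \<Rightarrow> complex) \<Rightarrow> (complex \<Rightarrow> 'm) \<Rightarrow> real \<Rightarrow> complex" where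
  "velocity c \<gamma> t = vector_derivative (\<lambda>t. c (\<gamma> (circle_cover t))) (at t)"

definition regular_closed_curve ::
  "'m::topological_space set \<Rightarrow> ('m set \<times> ('m \<Rightarrow> complex)) set \<Rightarrow> (complex \<Rightarrow> 'm) \<Rightarrow> bool" where
  "regular_closed_curve M A \<gamma> \<longleftrightarrow>
     continuous_on (sphere 0 1) \<gamma> \<and> \<gamma> ` sphere 0 1 \<subseteq> M \<and>
     (\<forall>(U, c)\<in>A.
        (\<lambda>t. c (\<gamma> (circle_cover t))) C1_differentiable_on {t. \<gamma> (circle_cover t) \<in> U} \<and>
        (\<forall>t. \<gamma> (circle_cover t) \<in> U \<longrightarrow> velocity c \<gamma> t \<noteq> 0))"

definition double_points :: "(complex \<Rightarrow> 'm) \<Rightarrow> 'm set" where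
  "double_points \<gamma> = {d. \<exists>z\<in>sphere 0 1. \<exists>w\<in>sphere 0 1. z \<noteq> w \<and> \<gamma> z = d \<and> \<gamma> w = d}"

definition generic_regular_curve ::
  "'m::topological_space set \<Rightarrow> ('m set \<times> ('m \<Rightarrow> complex)) set \<Rightarrow> (complex \<Rightarrow> 'm) \<Rightarrow> bool" where
  "generic_regular_curve M A \<gamma> \<longleftrightarrow>
     regular_closed_curve M A \<gamma> \<and>
     (\<forall>d\<in>double_points \<gamma>. card {z \<in> sphere 0 1. \<gamma> z = d} = 2) \<and>
     (\<forall>s t. circle_cover s \<noteq> circle_cover t \<longrightarrow> \<gamma> (circle_cover s) = \<gamma> (circle_cover t) \<longrightarrow>
        (\<forall>(U, c)\<in>A. \<gamma> (circle_cover s) \<in> U \<longrightarrow>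
           oriented_area (velocity c \<gamma> s) (velocity c \<gamma> t) \<noteq> 0))"

definition null_homotopic_curve :: "'m::topological_space set \<Rightarrow> (complex \<Rightarrow> 'm) \<Rightarrow> bool" where
  "null_homotopic_curve M \<gamma> \<longleftrightarrow>
     (\<exists>x. homotopic_with_canon (\<lambda>_. True) (sphere 0 1) M \<gamma> (\<lambda>_. x))"

text \<open>
  The loop that \<open>\<gamma>\<close> describes on the parameter interval from \<open>a\<close> to \<open>b\<close>. At a double point
  with parameters \<open>a < b < a + 1\<close> the two loops are those on \<open>[a, b]\<close> and on \<open>[b, a + 1]\<close>.
\<close>

definition sub_loop :: "(complex \<Rightarrow> 'm) \<Rightarrow> real \<Rightarrow> real \<Rightarrow> real \<Rightarrow> 'm" where
  "sub_loop \<gamma> a b u = \<gamma> (circle_cover ((1 - u) * a + u * b))"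

definition null_double_points :: "'m::topological_space set \<Rightarrow> (complex \<Rightarrow> 'm) \<Rightarrow> 'm set" where
  "null_double_points M \<gamma> =
     {d \<in> double_points \<gamma>. \<exists>a b. a < b \<and> b < a + 1 \<and>
        \<gamma> (circle_cover a) = d \<and> \<gamma> (circle_cover b) = d \<and>
        (homotopic_paths M (sub_loop \<gamma> a b) (\<lambda>_. d) \<or>
         homotopic_paths M (sub_loop \<gamma> b (a + 1)) (\<lambda>_. d))}"


section \<open>Covers, signs of double points and the winding number\<close>

definition is_cover ::
  "geometry \<Rightarrow> (complex \<Rightarrow> 'm) \<Rightarrow> (complex \<Rightarrow> 'm) \<Rightarrow> (real \<Rightarrow> complex) \<Rightarrow> bool" where
  "is_cover G p \<gamma> h \<longleftrightarrow>
     continuous_on UNIV h \<and> (\<forall>t. h t \<in> plane G \<and> p (h t) = \<gamma> (circle_cover t))"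

text \<open>
  For transversal arcs with velocities \<open>u\<close> and \<open>v\<close>, the second arc crosses the first one from left
  to right iff \<open>v\<close> points to the right of \<open>u\<close>.
\<close>

definition crossing_sign :: "complex \<Rightarrow> complex \<Rightarrow> int" where
  "crossing_sign u v =
     (if oriented_area u v < 0 then 1 else if oriented_area u v > 0 then -1 else 0)"

definition cover_sign :: "(real \<Rightarrow> complex) \<Rightarrow> real \<Rightarrow> real \<Rightarrow> int" where
  "cover_sign h t\<^sub>1 t\<^sub>2 =
     crossing_sign (vector_derivative h (at t\<^sub>1)) (vector_derivative h (at t\<^sub>2))"

definition double_point_sign ::
  "geometry \<Rightarrow> 'm::topological_space set \<Rightarrow> (complex \<Rightarrow> 'm) \<Rightarrow> (complex \<Rightarrow> 'm) \<Rightarrow> 'm \<Rightarrow> int" where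
  "double_point_sign G M p \<gamma> d =
     (if d \<in> null_double_points M \<gamma>
      then THE s. \<exists>h t\<^sub>1 t\<^sub>2. is_cover G p \<gamma> h \<and> t\<^sub>1 < t\<^sub>2 \<and> h t\<^sub>1 = h t\<^sub>2 \<and> p (h t\<^sub>1) = d \<and>
                         s = cover_sign h t\<^sub>1 t\<^sub>2
      else 0)"

definition one_parameter_isometry_group :: "geometry \<Rightarrow> (real \<Rightarrow> complex \<Rightarrow> complex) \<Rightarrow> bool" where
  "one_parameter_isometry_group G \<phi> \<longleftrightarrow>
     (\<forall>s. plane_isometry G (\<phi> s)) \<and>
     (\<forall>z\<in>plane G. \<phi> 0 z = z) \<and>
     (\<forall>s t. \<forall>z\<in>plane G. \<phi> (s + t) z = \<phi> s (\<phi> t z)) \<and>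
     (G = Euclidean \<longrightarrow> (\<forall>s. \<exists>b. \<forall>z. \<phi> s z = z + b))"

definition generating_field ::
  "geometry \<Rightarrow> (real \<Rightarrow> complex \<Rightarrow> complex) \<Rightarrow> (complex \<Rightarrow> complex) \<Rightarrow> bool" where
  "generating_field G \<phi> X \<longleftrightarrow>
     (\<forall>z\<in>plane G. \<forall>s. ((\<lambda>s. \<phi> s z) has_vector_derivative X (\<phi> s z)) (at s))"

text \<open>A continuous choice of the oriented angle from \<open>X (h t)\<close> to the velocity of \<open>h\<close> at \<open>t\<close>.\<close>

definition angle_function ::
  "(complex \<Rightarrow> complex) \<Rightarrow> (real \<Rightarrow> complex) \<Rightarrow> (real \<Rightarrow> real) \<Rightarrow> bool" where
  "angle_function X h \<theta> \<longleftrightarrow>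
     continuous_on UNIV \<theta> \<and>
     (\<forall>t. X (h t) \<noteq> 0 \<and>
        (\<exists>r>0. vector_derivative h (at t) = of_real r * cis (\<theta> t) * X (h t)))"

definition curve_winding :: "geometry \<Rightarrow> (complex \<Rightarrow> 'm) \<Rightarrow> (complex \<Rightarrow> 'm) \<Rightarrow> int" where
  "curve_winding G p \<gamma> =
     (THE w. \<exists>h T \<phi> X \<theta>.
        is_cover G p \<gamma> h \<and>
        deck_transformation G p T \<and> (\<forall>t. T (h t) = h (t + 1)) \<and>
        one_parameter_isometry_group G \<phi> \<and> (\<forall>z\<in>plane G. \<phi> 1 z = T z) \<and>
        generating_field G \<phi> X \<and>
        angle_function X h \<theta> \<and>
        of_int w = (\<theta> 1 - \<theta> 0) / (2 * pi))"

end

theory Submission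
  imports Defs "HOL-Complex_Analysis.Complex_Analysis"
begin

text \<open>
  The deck transformation \<open>T\<close> with \<open>T (h t) = h (t + 1)\<close> has no fixed point. There is a holomorphic
  coordinate \<open>\<psi>\<close>, injective on the plane, in which \<open>T\<close> and every one-parameter group through \<open>T\<close> act by
  translations, so that \<open>k = \<psi> \<circ> h\<close> satisfies \<open>k (t + 1) = k t + 1\<close> and the winding number is the
  rotation number of \<open>k'\<close>. On the strip \<open>0 \<le> u \<le> 1\<close> the function \<open>(k (t + u) - k t) / u\<close> is
  1-periodic in \<open>t\<close>, equals \<open>k'\<close> for \<open>u = 0\<close> and \<open>1\<close> for \<open>u = 1\<close>, and vanishes exactly at the pairs of
  parameters bounding a null-homotopic loop; its index there is the sign of the double point. Comparing
  the rotation numbers along the two boundary lines gives the formula.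
\<close>

text \<open>The difference quotient is merely continuous on the closed strip and not holomorphic, so
  its zeros are divided out one by one, by \<open>uexp z - \<zeta>\<close> or its conjugate
  according to the index. What remains has no zeros and therefore a logarithm on the convex strip.
  This logarithm gains the same constant under z -> z + 1 on both boundary lines, which is what
  links the two rotation numbers. A second difficulty is that \<open>curve_winding\<close> is a
  definite description over all covers, groups, fields and angles, so one coordinate
  \<open>\<psi>\<close> has to serve every admissible group. In the hyperbolic plane the members of
  a group are only known to be isometries, possibly reversing the orientation. Writing
  \<open>\<phi> s\<close> as the square of \<open>\<phi> (s / 2)\<close> removes reflections, and
  commuting with T then forces a translation in \<open>\<psi>\<close>. The coordinate is z / b in
  the euclidean case; after an isometry of the half-plane it is z / b for parabolic T and Ln z / ln
  \<alpha> for hyperbolic T.\<close>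

lemma integer_valued_constant:
  fixes f :: "'a::topological_space \<Rightarrow> real"
  assumes "connected S" and "continuous_on S f" and "\<And>x. x \<in> S \<Longrightarrow> f x \<in> \<int>"
  shows "f constant_on S"
proof (rule continuous_discrete_range_constant [OF assms(1,2)])
  fix x assume x: "x \<in> S"
  have "1 \<le> norm (f y - f x)" if "y \<in> S" "f y \<noteq> f x" for y
  proof -
    have "f y - f x \<in> \<int>" "f y - f x \<noteq> 0" using assms(3) x that by auto
    then show ?thesis using Ints_nonzero_abs_ge1[of "f y - f x"] by simp
  qed
  then show "\<exists>e>0. \<forall>y. y \<in> S \<and> f y \<noteq> f x \<longrightarrow> e \<le> norm (f y - f x)"
    by (intro exI[of _ 1]) auto
qed

text \<open>\<open>Im (L t)\<close> and \<open>\<theta> t\<close> are continuous arguments of the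
  same nowhere zero function, so they differ by a constant multiple of 2 pi. Rotation numbers can
  thus be read off from any continuous logarithm.\<close>

lemma angle_eq_Im_log:
  fixes \<theta> :: "real \<Rightarrow> real" and L :: "real \<Rightarrow> complex"
  assumes "continuous_on UNIV \<theta>" and "continuous_on UNIV L"
    and "\<And>t. \<exists>r>0. exp (L t) = of_real r * cis (\<theta> t)"
  shows "Im (L b) - Im (L a) = \<theta> b - \<theta> a"
proof -
  define n where "n t = (Im (L t) - \<theta> t) / (2 * pi)" for t
  have "n constant_on UNIV"
  proof (rule integer_valued_constant)
    show "continuous_on UNIV n"
      unfolding n_def by (intro continuous_intros assms) auto
    fix t
    obtain r where r: "r > 0" "exp (L t) = of_real r * cis (\<theta> t)" using assms(3) by blast
    have "exp (L t) = exp (Complex (ln r) (\<theta> t))"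
      using r by (simp add: exp_eq_polar exp_of_real)
    then obtain m :: int where "L t = Complex (ln r) (\<theta> t) + of_int (2 * m) * pi * \<i>"
      using exp_eq by blast
    then have "Im (L t) = \<theta> t + 2 * m * pi" by simp
    then have "n t = of_int m" by (simp add: n_def)
    then show "n t \<in> \<int>" by simp
  qed simp
  then obtain c where "n b = c" "n a = c" by (auto simp: constant_on_def)
  then show ?thesis by (auto simp: n_def field_simps)
qed

section \<open>Counting zeros of a periodic function on a strip\<close>

abbreviation strip :: "complex set" where
  "strip \<equiv> {z. 0 \<le> Im z \<and> Im z \<le> 1}"

text \<open>The quotient map by z -> z + 1. It takes the strip onto the closed annulus from radius
  exp (-2 pi) to 1, the bottom line to the outer circle. Zeros of a periodic function are recorded
  by their images, so that there can be finitely many.\<close>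

abbreviation uexp :: "complex \<Rightarrow> complex" where
  "uexp z \<equiv> exp (2 * of_real pi * \<i> * z)"

text \<open>The model of a zero of index e, for e in {1, -1}: w itself for index 1, its conjugate
  for index -1.\<close>

definition signed_cnj :: "int \<Rightarrow> complex \<Rightarrow> complex" where
  "signed_cnj e w = (if e = 1 then w else cnj w)"

lemma signed_cnj_simps [simp]:
  "cmod (signed_cnj e w) = cmod w" "signed_cnj e w = 0 \<longleftrightarrow> w = 0"
  "signed_cnj e (v * w) = signed_cnj e v * signed_cnj e w"
  by (auto simp: signed_cnj_def)

lemma signed_cnj_exp: "signed_cnj e (exp w) = exp (signed_cnj e w)"
  by (simp add: signed_cnj_def exp_cnj)

lemma continuous_on_signed_cnj [continuous_intros]:
  "continuous_on S f \<Longrightarrow> continuous_on S (\<lambda>x. signed_cnj e (f x))"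
  by (cases "e = 1") (auto simp: signed_cnj_def intro: continuous_intros)

text \<open>A zero of index e in a form that survives division by other factors. For a real
  derivative the quotient by the model usually has no limit, since it depends on the direction of
  approach. It is only asked to stay in a closed disc around \<alpha> that avoids 0.\<close>

definition simple_zero :: "(complex \<Rightarrow> complex) \<Rightarrow> complex \<Rightarrow> int \<Rightarrow> bool" where
  "simple_zero F \<zeta> e \<longleftrightarrow>
     (\<exists>\<alpha> \<rho> \<delta>. 0 < \<delta> \<and> 0 \<le> \<rho> \<and> \<rho> < cmod \<alpha> \<and>
        (\<forall>z\<in>strip. 0 < cmod (uexp z - \<zeta>) \<longrightarrow> cmod (uexp z - \<zeta>) < \<delta> \<longrightarrow>
           cmod (F z / signed_cnj e (uexp z - \<zeta>) - \<alpha>) \<le> \<rho>))"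

lemma uexp_add_1: "uexp (z + 1) = uexp z"
  using exp_plus_2pin[of "2 * of_real pi * \<i> * z" 1] by (simp add: algebra_simps)

lemma norm_uexp: "cmod (uexp z) = exp (- 2 * pi * Im z)"
  by simp

text \<open>Dividing by \<open>uexp z - \<zeta>\<close> or its conjugate leaves a function that stays near the nonzero
  number \<open>\<alpha>\<close> around the removed zero. The cutoff \<open>\<kappa>\<close> makes it continuous there.\<close>

lemma remove_zero:
  assumes F: "continuous_on strip F" "\<And>z. z \<in> strip \<Longrightarrow> F (z + 1) = F z"
    and zero: "\<And>z. z \<in> strip \<Longrightarrow> F z = 0 \<longleftrightarrow> uexp z \<in> insert \<zeta> Z"
    and fin: "finite Z" "\<zeta> \<notin> Z"
    and sz: "simple_zero F \<zeta> e" "\<And>\<xi>. \<xi> \<in> Z \<Longrightarrow> simple_zero F \<xi> (s \<xi>)"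
    and Z: "insert \<zeta> Z \<subseteq> {w. exp (- 2 * pi) < cmod w \<and> cmod w < 1}"
  obtains F' where "continuous_on strip F'" "\<And>z. z \<in> strip \<Longrightarrow> F' (z + 1) = F' z"
    and "\<And>z. z \<in> strip \<Longrightarrow> F' z = 0 \<longleftrightarrow> uexp z \<in> Z"
    and "\<And>\<xi>. \<xi> \<in> Z \<Longrightarrow> simple_zero F' \<xi> (s \<xi>)"
    and "\<And>z. Im z \<in> {0, 1} \<Longrightarrow> F z = F' z * signed_cnj e (uexp z - \<zeta>)"
proof -
  define E where "E z = uexp z - \<zeta>" for z
  obtain \<alpha> \<rho> \<delta>0 where \<delta>0: "0 < \<delta>0" and \<rho>: "0 \<le> \<rho>" "\<rho> < cmod \<alpha>"
    and near: "\<And>z. z \<in> strip \<Longrightarrow> 0 < cmod (E z) \<Longrightarrow> cmod (E z) < \<delta>0 \<Longrightarrow>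
                cmod (F z / signed_cnj e (E z) - \<alpha>) \<le> \<rho>"
    using sz(1) unfolding simple_zero_def E_def by meson
  \<comment> \<open>Half the minimum of these distances makes the disc of radius 2 \<delta> around
    \<zeta> avoid the two boundary circles and all other zeros, and keeps the estimate
    \<open>near\<close> valid on it.\<close>
  define B where "B = {\<delta>0, cmod \<zeta> - exp (- 2 * pi), 1 - cmod \<zeta>} \<union> (\<lambda>\<xi>. cmod (\<xi> - \<zeta>)) ` Z"
  define \<delta> where "\<delta> = Min B / 2"
  have B: "finite B" "B \<noteq> {}" using fin by (auto simp: B_def)
  have "\<forall>x\<in>B. 0 < x" using fin Z \<delta>0 by (auto simp: B_def)
  then have \<delta>: "0 < \<delta>" unfolding \<delta>_def using B by simp
  have "2 * \<delta> \<le> x" if "x \<in> B" for x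
    unfolding \<delta>_def using Min_le[OF B(1) that] by simp
  then have \<delta>le: "2 * \<delta> \<le> \<delta>0" "2 * \<delta> \<le> cmod \<zeta> - exp (- 2 * pi)" "2 * \<delta> \<le> 1 - cmod \<zeta>"
    "\<And>\<xi>. \<xi> \<in> Z \<Longrightarrow> 2 * \<delta> \<le> cmod (\<xi> - \<zeta>)" by (auto simp: B_def)
  define \<kappa> where "\<kappa> z = min 1 (cmod (E z) / \<delta>)" for z
  define Q where "Q z = F z / signed_cnj e (E z)" for z
  \<comment> \<open>A mixture of \<alpha> and the quotient \<open>Q\<close>, with weight \<kappa> on
    \<open>Q\<close>. Where \<open>E z = 0\<close>, division by zero gives \<open>Q z = 0\<close>,
    but \<kappa> is 0 there too and the value is \<alpha>.\<close>
  define F' where "F' z = \<alpha> + of_real (\<kappa> z) * (Q z - \<alpha>)" for z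
  have \<kappa>: "0 \<le> \<kappa> z" "\<kappa> z \<le> 1" for z using \<delta> by (auto simp: \<kappa>_def)
  have contE: "continuous_on S E" for S unfolding E_def by (intro continuous_intros)
  have cont\<kappa>: "continuous_on S \<kappa>" for S
    unfolding \<kappa>_def by (intro continuous_intros contE) (use \<delta> in auto)
  have far: "F' z = Q z" if "cmod (E z) \<ge> \<delta>" for z
    using that \<delta> by (simp add: F'_def \<kappa>_def)
  have close: "cmod (F' z - \<alpha>) \<le> \<kappa> z * \<rho>" if "z \<in> strip" "cmod (E z) < \<delta>" for z
  proof (cases "E z = 0")
    case True
    then show ?thesis by (simp add: F'_def \<kappa>_def)
  next
    case False
    then have "cmod (Q z - \<alpha>) \<le> \<rho>" using near that \<delta>le(1) \<delta> unfolding Q_def by simp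
    then show ?thesis using \<kappa>[of z] by (simp add: F'_def norm_mult mult_left_mono)
  qed
  have cont: "continuous_on strip F'"
  proof -
    have 1: "continuous_on (strip \<inter> {z. E z \<noteq> 0}) F'"
      unfolding F'_def Q_def
      by (intro continuous_intros cont\<kappa> contE continuous_on_subset[OF F(1)]) auto
    have "continuous (at z within strip) F'" if z: "z \<in> strip" for z
    proof (cases "E z = 0")
      case False
      have "open {z. E z \<noteq> 0}"
        using open_Collect_neq[OF contE continuous_on_const, of 0] by simp
      then have "at z within strip = at z within (strip \<inter> {z. E z \<noteq> 0})"
        using False by (intro at_within_nhd[of z "{z. E z \<noteq> 0}"]) auto
      then show ?thesis using 1 z False by (simp add: continuous_on_eq_continuous_within)
    next
      case True
      have "((\<lambda>w. \<kappa> w * \<rho>) \<longlongrightarrow> \<kappa> z * \<rho>) (at z within strip)"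
        using cont\<kappa>[of strip] z by (intro tendsto_intros) (auto simp: continuous_on_def)
      then have lim: "((\<lambda>w. \<kappa> w * \<rho>) \<longlongrightarrow> 0) (at z within strip)"
        using True by (simp add: \<kappa>_def)
      have "isCont (\<lambda>w. cmod (E w)) z"
        using contE[of UNIV] by (auto simp: continuous_on_eq_continuous_at intro!: continuous_intros)
      then have "eventually (\<lambda>w. cmod (E w) < \<delta>) (at z)"
        using True \<delta> unfolding isCont_def by (auto dest: order_tendstoD(2))
      then have "eventually (\<lambda>w. cmod (E w) < \<delta> \<and> w \<in> strip) (at z within strip)"
        by (auto simp: eventually_at_filter elim: eventually_mono)
      then have "eventually (\<lambda>w. norm (F' w - \<alpha>) \<le> \<kappa> w * \<rho>) (at z within strip)"
        by (rule eventually_mono) (use close in auto)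
      then have "((\<lambda>w. F' w - \<alpha>) \<longlongrightarrow> 0) (at z within strip)"
        by (rule Lim_null_comparison[OF _ lim])
      moreover have "F' z = \<alpha>" using True by (simp add: F'_def \<kappa>_def)
      ultimately show ?thesis by (simp add: continuous_within Lim_null[of F'])
    qed
    then show ?thesis by (simp add: continuous_on_eq_continuous_within)
  qed
  have per: "F' (z + 1) = F' z" if "z \<in> strip" for z
    using F(2)[OF that] uexp_add_1[of z] by (simp add: F'_def \<kappa>_def Q_def E_def)
  have Znear: "cmod (E z) \<ge> 2 * \<delta>" if "uexp z \<in> Z" for z
    using \<delta>le(4)[OF that] by (simp add: E_def)
  have zero': "F' z = 0 \<longleftrightarrow> uexp z \<in> Z" if z: "z \<in> strip" for z
  proof (cases "cmod (E z) \<ge> \<delta>")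
    case True
    then show ?thesis using zero[OF z] far \<delta> by (auto simp: Q_def E_def)
  next
    case False
    have "\<kappa> z * \<rho> < cmod \<alpha>"
      using mult_right_mono[OF \<kappa>(2) \<rho>(1), of z] \<rho>(2) by simp
    then have "F' z \<noteq> 0" using close[OF z] False by auto
    then show ?thesis using Znear[of z] False \<delta> by fastforce
  qed
  have sz': "simple_zero F' \<xi> (s \<xi>)" if \<xi>: "\<xi> \<in> Z" for \<xi>
  proof -
    obtain \<alpha>1 \<rho>1 \<delta>1 where 1: "0 < \<delta>1" "\<rho>1 < cmod \<alpha>1" "0 \<le> \<rho>1"
      "\<And>z. z \<in> strip \<Longrightarrow> 0 < cmod (uexp z - \<xi>) \<Longrightarrow> cmod (uexp z - \<xi>) < \<delta>1 \<Longrightarrow>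
           cmod (F z / signed_cnj (s \<xi>) (uexp z - \<xi>) - \<alpha>1) \<le> \<rho>1"
      using sz(2)[OF \<xi>] unfolding simple_zero_def by meson
    define \<beta> where "\<beta> = signed_cnj e (\<xi> - \<zeta>)"
    have \<beta>: "cmod \<beta> \<ge> 2 * \<delta>" using \<delta>le(4)[OF \<xi>] by (simp add: \<beta>_def)
    then have \<beta>0: "\<beta> \<noteq> 0" using \<delta> by auto
    \<comment> \<open>Near \<xi> the removed factor is close to \<beta>, so the disc around
      \<alpha>1 of radius \<rho>1 is roughly divided by \<beta>. \<epsilon> is half of the gap
      between \<rho>1 / |\<beta>| and |\<alpha>1 / \<beta>|, the room left for the variation of the
      factor.\<close>
    define \<epsilon> where "\<epsilon> = (cmod \<alpha>1 - \<rho>1) / 2 / cmod \<beta>"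
    have \<epsilon>: "\<epsilon> > 0" using 1 \<beta>0 by (simp add: \<epsilon>_def)
    have "continuous (at \<xi>) (\<lambda>w. \<rho>1 * cmod (1 / signed_cnj e (w - \<zeta>)) +
            cmod \<alpha>1 * cmod (1 / signed_cnj e (w - \<zeta>) - 1 / \<beta>))"
      using \<beta>0 unfolding \<beta>_def signed_cnj_def
      by (cases "e = 1") (auto intro!: continuous_intros)
    then have "eventually (\<lambda>w. \<rho>1 * cmod (1 / signed_cnj e (w - \<zeta>)) +
            cmod \<alpha>1 * cmod (1 / signed_cnj e (w - \<zeta>) - 1 / \<beta>) < \<rho>1 / cmod \<beta> + \<epsilon>) (nhds \<xi>)"
      using \<epsilon> unfolding isCont_def eventually_nhds_conv_at
      by (auto simp: norm_divide \<beta>_def dest!: order_tendstoD(2)[where a = "\<rho>1 / cmod \<beta> + \<epsilon>"])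
    then obtain \<delta>2 where \<delta>2: "\<delta>2 > 0" "\<And>w. dist w \<xi> < \<delta>2 \<Longrightarrow> \<rho>1 * cmod (1 / signed_cnj e (w - \<zeta>)) +
            cmod \<alpha>1 * cmod (1 / signed_cnj e (w - \<zeta>) - 1 / \<beta>) < \<rho>1 / cmod \<beta> + \<epsilon>"
      unfolding eventually_nhds_metric by blast
    have "cmod (F' z / signed_cnj (s \<xi>) (uexp z - \<xi>) - \<alpha>1 / \<beta>) \<le> \<rho>1 / cmod \<beta> + \<epsilon>"
      if z: "z \<in> strip" "0 < cmod (uexp z - \<xi>)" "cmod (uexp z - \<xi>) < min (min \<delta>1 \<delta>2) \<delta>" for z
    proof -
      define m where "m = 1 / signed_cnj e (uexp z - \<zeta>)"
      define q where "q = F z / signed_cnj (s \<xi>) (uexp z - \<xi>)"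
      have "cmod (\<xi> - \<zeta>) \<le> cmod (uexp z - \<xi>) + cmod (E z)"
        unfolding E_def using norm_triangle_ineq4[of "uexp z - \<zeta>" "uexp z - \<xi>"] by simp
      then have "cmod (E z) \<ge> \<delta>" using z(3) \<delta>le(4)[OF \<xi>] by simp
      then have "F' z = F z * m" using far by (simp add: Q_def E_def m_def)
      then have "F' z / signed_cnj (s \<xi>) (uexp z - \<xi>) - \<alpha>1 / \<beta> = (q - \<alpha>1) * m + \<alpha>1 * (m - 1 / \<beta>)"
        by (simp add: q_def algebra_simps)
      then have "cmod (F' z / signed_cnj (s \<xi>) (uexp z - \<xi>) - \<alpha>1 / \<beta>) \<le>
                   cmod (q - \<alpha>1) * cmod m + cmod \<alpha>1 * cmod (m - 1 / \<beta>)"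
        by (metis norm_mult norm_triangle_ineq)
      also have "\<dots> \<le> \<rho>1 * cmod m + cmod \<alpha>1 * cmod (m - 1 / \<beta>)"
        using 1(4)[OF z(1,2)] z(3) by (auto simp: q_def intro!: mult_right_mono)
      also have "\<dots> \<le> \<rho>1 / cmod \<beta> + \<epsilon>"
        unfolding m_def using \<delta>2(2)[of "uexp z"] z(3) by (simp add: dist_norm less_imp_le)
      finally show ?thesis .
    qed
    moreover have "\<rho>1 / cmod \<beta> + \<epsilon> < cmod (\<alpha>1 / \<beta>)"
      using 1(2) \<beta>0 by (simp add: \<epsilon>_def norm_divide field_simps)
    ultimately show ?thesis unfolding simple_zero_def using 1(1,3) \<delta>2(1) \<delta> \<epsilon>
      by (intro exI[of _ "\<alpha>1 / \<beta>"] exI[of _ "\<rho>1 / cmod \<beta> + \<epsilon>"] exI[of _ "min (min \<delta>1 \<delta>2) \<delta>"]) auto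
  qed
  have bd: "F z = F' z * signed_cnj e (uexp z - \<zeta>)" if "Im z \<in> {0, 1}" for z
  proof -
    have "cmod (uexp z) = 1 \<or> cmod (uexp z) = exp (- 2 * pi)"
      unfolding norm_uexp using that by auto
    moreover have "\<bar>cmod (uexp z) - cmod \<zeta>\<bar> \<le> cmod (E z)"
      unfolding E_def by (rule norm_triangle_ineq3)
    ultimately have "\<delta> \<le> cmod (E z)" using \<delta>le(2,3) \<delta> by linarith
    then show ?thesis using far[of z] \<delta> by (auto simp: Q_def E_def)
  qed
  show thesis by (rule that[OF cont per zero' sz' bd])
qed

text \<open>Induction on the zeros with \<open>remove_zero\<close>, down to a zero-free function,
  which has a logarithm on the convex strip. The periods of this logarithm lie in 2 pi i Z and
  depend continuously on z, so a single c serves the whole strip. The product formula is claimed on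
  the boundary lines only, because the cutoffs alter the function inside.\<close>

lemma strip_factorization:
  assumes "finite Z" and "continuous_on strip F" and "\<And>z. z \<in> strip \<Longrightarrow> F (z + 1) = F z"
    and "\<And>z. z \<in> strip \<Longrightarrow> F z = 0 \<longleftrightarrow> uexp z \<in> Z"
    and "\<And>\<zeta>. \<zeta> \<in> Z \<Longrightarrow> simple_zero F \<zeta> (s \<zeta>)"
    and "Z \<subseteq> {w. exp (- 2 * pi) < cmod w \<and> cmod w < 1}"
  shows "\<exists>g c. continuous_on strip g \<and> (\<forall>z\<in>strip. g (z + 1) = g z + c) \<and>
           (\<forall>z. Im z \<in> {0, 1} \<longrightarrow> F z = exp (g z) * (\<Prod>\<zeta>\<in>Z. signed_cnj (s \<zeta>) (uexp z - \<zeta>)))"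
  using assms
proof (induction Z arbitrary: F rule: finite_induct)
  case empty
  have "strip = {z. 0 \<le> Im z} \<inter> {z. Im z \<le> 1}" by auto
  then have conv: "convex strip"
    using convex_Int[OF convex_halfspace_Im_ge[of 0] convex_halfspace_Im_le[of 1]] by simp
  obtain g where g: "continuous_on strip g" "\<And>z. z \<in> strip \<Longrightarrow> F z = exp (g z)"
    using continuous_logarithm_on_contractible[OF empty(1) convex_imp_contractible[OF conv]]
      empty(3) by auto
  define n where "n z = Im (g (z + 1) - g z) / (2 * pi)" for z
  have diff: "g (z + 1) - g z = of_real (2 * pi * n z) * \<i> \<and> n z \<in> \<int>" if z: "z \<in> strip" for z
  proof -
    have "exp (g (z + 1)) = exp (g z)" using g(2) z empty(2)[OF z] by auto
    then obtain m :: int where m: "g (z + 1) = g z + of_int (2 * m) * pi * \<i>"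
      using exp_eq by blast
    then have "n z = of_int m" by (simp add: n_def)
    then show ?thesis using m by simp
  qed
  have "n constant_on strip"
  proof (rule integer_valued_constant[OF convex_connected[OF conv]])
    have "continuous_on strip (\<lambda>z. g (z + 1))"
      by (rule continuous_on_compose2[OF g(1)]) (auto intro!: continuous_intros)
    then show "continuous_on strip n"
      unfolding n_def by (intro continuous_intros g(1)) auto
  qed (use diff in blast)
  then obtain c where "\<And>z. z \<in> strip \<Longrightarrow> n z = c" by (auto simp: constant_on_def)
  then have "g (z + 1) = g z + of_real (2 * pi * c) * \<i>" if "z \<in> strip" for z
    using diff[OF that] that by (simp add: algebra_simps)
  then show ?case using g by (intro exI[of _ g] exI[of _ "of_real (2 * pi * c) * \<i>"]) auto
next
  case (insert \<zeta> Z)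
  obtain F' where F': "continuous_on strip F'" "\<And>z. z \<in> strip \<Longrightarrow> F' (z + 1) = F' z"
    "\<And>z. z \<in> strip \<Longrightarrow> F' z = 0 \<longleftrightarrow> uexp z \<in> Z"
    "\<And>\<xi>. \<xi> \<in> Z \<Longrightarrow> simple_zero F' \<xi> (s \<xi>)"
    "\<And>z. Im z \<in> {0, 1} \<Longrightarrow> F z = F' z * signed_cnj (s \<zeta>) (uexp z - \<zeta>)"
    using remove_zero[OF insert.prems(1,2,3) insert.hyps(1,2), of "s \<zeta>" s] insert.prems(4,5) by auto
  have "\<exists>g c. continuous_on strip g \<and> (\<forall>z\<in>strip. g (z + 1) = g z + c) \<and>
           (\<forall>z. Im z \<in> {0, 1} \<longrightarrow> F' z = exp (g z) * (\<Prod>\<zeta>\<in>Z. signed_cnj (s \<zeta>) (uexp z - \<zeta>)))"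
    using insert.IH[OF F'(1-4)] insert.prems(5) by auto
  then show ?case using F'(5) insert.hyps by (auto simp: mult_ac)
qed

text \<open>A periodic logarithm of \<open>1 - w / \<zeta>\<close> exists on each circle, so \<open>uexp z - \<zeta>\<close> turns once along
  the bottom of the strip and not at all along the top.\<close>

theorem strip_index:
  assumes fin: "finite Z" and F: "continuous_on strip F" "\<And>z. z \<in> strip \<Longrightarrow> F (z + 1) = F z"
    and zero: "\<And>z. z \<in> strip \<Longrightarrow> F z = 0 \<longleftrightarrow> uexp z \<in> Z"
    and sz: "\<And>\<zeta>. \<zeta> \<in> Z \<Longrightarrow> simple_zero F \<zeta> (s \<zeta>)" "\<And>\<zeta>. \<zeta> \<in> Z \<Longrightarrow> s \<zeta> \<in> {1, -1}"
    and Z: "Z \<subseteq> {w. exp (- 2 * pi) < cmod w \<and> cmod w < 1}"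
    and top: "\<And>t. F (of_real t + \<i>) = 1"
    and \<theta>: "continuous_on UNIV \<theta>" "\<And>t. \<exists>r>0. F (of_real t) = of_real r * cis (\<theta> t)"
  shows "\<theta> 1 - \<theta> 0 = 2 * pi * of_int (\<Sum>\<zeta>\<in>Z. s \<zeta>)"
proof -
  obtain g c where g: "continuous_on strip g" "\<And>z. z \<in> strip \<Longrightarrow> g (z + 1) = g z + c"
    and Fg: "\<And>z. Im z \<in> {0, 1} \<Longrightarrow>
              F z = exp (g z) * (\<Prod>\<zeta>\<in>Z. signed_cnj (s \<zeta>) (uexp z - \<zeta>))"
    using strip_factorization[OF fin F zero sz(1) Z] by blast
  have ln_ok: "1 - w \<notin> \<real>\<^sub>\<le>\<^sub>0" "1 - w \<noteq> 0" if "cmod w < 1" for w :: complex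
    using that abs_Re_le_cmod[of w] by (auto simp: complex_nonpos_Reals_iff)
  have small_b: "cmod (\<zeta> * uexp (- of_real t)) < 1" if "\<zeta> \<in> Z" for \<zeta> and t :: real
    using that Z by (auto simp: norm_mult)
  have small_t: "cmod (uexp (of_real t + \<i>) / \<zeta>) < 1" "\<zeta> \<noteq> 0" if "\<zeta> \<in> Z" for \<zeta> and t :: real
  proof -
    have "exp (- 2 * pi) < cmod \<zeta>" using that Z by auto
    moreover have "cmod \<zeta> > 0" using calculation order_le_less_trans[OF less_imp_le[OF exp_gt_zero]] by blast
    ultimately show "cmod (uexp (of_real t + \<i>) / \<zeta>) < 1" "\<zeta> \<noteq> 0" by (auto simp: norm_divide)
  qed
  \<comment> \<open>On the bottom |\<zeta>| < 1 = |uexp t|, so uexp t is split off and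
    \<open>lb\<close> gains 2 pi i per period. On the top |uexp (t + i)| = exp (-2 pi) < |\<zeta>|,
    so -\<zeta> is split off and \<open>lt\<close> is periodic. Either way the argument of the
    second \<open>Ln\<close> has positive real part.\<close>
  define lb where "lb \<zeta> t = 2 * of_real pi * \<i> * of_real t + Ln (1 - \<zeta> * uexp (- of_real t))"
    for \<zeta> and t :: real
  define lt where "lt \<zeta> t = Ln (- \<zeta>) + Ln (1 - uexp (of_real t + \<i>) / \<zeta>)" for \<zeta> and t :: real
  have lb: "exp (lb \<zeta> t) = uexp (of_real t) - \<zeta>" if "\<zeta> \<in> Z" for \<zeta> t
  proof -
    have "exp (lb \<zeta> t) = uexp (of_real t) * (1 - \<zeta> * uexp (- of_real t))"
      using ln_ok[OF small_b[OF that]] by (simp add: lb_def exp_add)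
    then show ?thesis by (simp add: algebra_simps flip: exp_add)
  qed
  have lt: "exp (lt \<zeta> t) = uexp (of_real t + \<i>) - \<zeta>" if "\<zeta> \<in> Z" for \<zeta> t
  proof -
    have "exp (lt \<zeta> t) = - \<zeta> * (1 - uexp (of_real t + \<i>) / \<zeta>)"
      unfolding lt_def exp_add using ln_ok(2)[OF small_t(1)[OF that]] small_t(2)[OF that]
      by (simp only: exp_Ln neg_equal_0_iff_equal not_False_eq_True)
    then show ?thesis using small_t(2)[OF that] by (simp add: right_diff_distrib)
  qed
  have cb: "continuous_on UNIV (lb \<zeta>)" if "\<zeta> \<in> Z" for \<zeta>
    unfolding lb_def using ln_ok(1)[OF small_b[OF that]] by (auto intro!: continuous_intros)
  have ct: "continuous_on UNIV (lt \<zeta>)" if "\<zeta> \<in> Z" for \<zeta>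
    unfolding lt_def using ln_ok(1)[OF small_t(1)[OF that]] small_t(2)[OF that]
    by (auto intro!: continuous_intros)
  have u1: "uexp (- of_real 1) = uexp (- of_real 0)" "uexp (of_real 1 + \<i>) = uexp (of_real 0 + \<i>)"
    using uexp_add_1[of "-1"] uexp_add_1[of \<i>] by (auto simp: add.commute)
  define Lb where "Lb t = g (of_real t) + (\<Sum>\<zeta>\<in>Z. signed_cnj (s \<zeta>) (lb \<zeta> t))" for t :: real
  define Lt where "Lt t = g (of_real t + \<i>) + (\<Sum>\<zeta>\<in>Z. signed_cnj (s \<zeta>) (lt \<zeta> t))" for t :: real
  \<comment> \<open>F is 1 on the top, where the argument 0 may be chosen throughout, and every
    \<open>lt\<close> is periodic. Hence Im c = 0, and the same c applies on the bottom.\<close>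
  have "Im (Lt 1) - Im (Lt 0) = 0 - 0"
  proof (rule angle_eq_Im_log)
    show "continuous_on UNIV Lt" unfolding Lt_def
      by (intro continuous_intros ct continuous_on_compose2[OF g(1)]) auto
    fix t
    have "exp (Lt t) = F (of_real t + \<i>)"
      using Fg[of "of_real t + \<i>"] lt fin
      by (simp add: Lt_def exp_add exp_sum flip: signed_cnj_exp)
    then show "\<exists>r>0. exp (Lt t) = of_real r * cis 0" using top by (auto intro: exI[of _ 1])
  qed auto
  moreover have "Lt 1 - Lt 0 = c" using g(2)[of \<i>] u1(2) by (simp add: Lt_def lt_def add.commute)
  ultimately have c: "Im c = 0" by auto
  have "Im (Lb 1) - Im (Lb 0) = \<theta> 1 - \<theta> 0"
  proof (rule angle_eq_Im_log[OF \<theta>(1)])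
    show "continuous_on UNIV Lb" unfolding Lb_def
      by (intro continuous_intros cb continuous_on_compose2[OF g(1)]) auto
    fix t
    have "exp (Lb t) = F (of_real t)"
      using Fg[of "of_real t"] lb fin
      by (simp add: Lb_def exp_add exp_sum flip: signed_cnj_exp)
    then show "\<exists>r>0. exp (Lb t) = of_real r * cis (\<theta> t)" using \<theta>(2) by auto
  qed
  \<comment> \<open>Conjugation turns the gain 2 pi of a factor into -2 pi; this is how zeros of
    index -1 are counted.\<close>
  moreover have "Im (Lb 1) - Im (Lb 0) = Im c + (\<Sum>\<zeta>\<in>Z. 2 * pi * of_int (s \<zeta>))"
  proof -
    have "Im (signed_cnj (s \<zeta>) (lb \<zeta> 1)) = Im (signed_cnj (s \<zeta>) (lb \<zeta> 0)) + 2 * pi * of_int (s \<zeta>)"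
      if "\<zeta> \<in> Z" for \<zeta>
      using sz(2)[OF that] u1(1) by (auto simp: lb_def signed_cnj_def)
    then show ?thesis using g(2)[of 0] by (simp add: Lb_def sum.distrib)
  qed
  ultimately show ?thesis using c by (simp add: sum_distrib_left)
qed

section \<open>The rotation number of a curve with translational symmetry\<close>

lemma uexp_eq_iff: "uexp z = uexp w \<longleftrightarrow> (\<exists>n::int. z = w + of_int n)"
proof -
  have "uexp z = uexp w \<longleftrightarrow> (\<exists>n::int. 2 * of_real pi * \<i> * z = 2 * of_real pi * \<i> * w + of_real (of_int (2 * n) * pi) * \<i>)"
    by (rule exp_eq)
  also have "\<dots> \<longleftrightarrow> (\<exists>n::int. 2 * of_real pi * \<i> * z = 2 * of_real pi * \<i> * (w + of_int n))"
    by (simp add: algebra_simps)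
  also have "\<dots> \<longleftrightarrow> (\<exists>n::int. z = w + of_int n)" by (simp del: distrib_left)
  finally show ?thesis .
qed

text \<open>\<open>Ln\<close> of the quotient of the two values is small because \<open>Ln\<close>
  is continuous at 1, and divided by 2 pi i it is the difference of the points up to an integer.
  That integer cannot be avoided, as \<open>uexp\<close> is periodic.\<close>

lemma uexp_close:
  assumes "\<epsilon> > 0"
  obtains \<delta> where "\<delta> > 0" "\<And>z. cmod (uexp z - uexp z0) < \<delta> \<Longrightarrow> \<exists>n::int. cmod (z - of_int n - z0) < \<epsilon>"
proof -
  have "isCont Ln 1" by (intro continuous_at_Ln) auto
  then obtain d where d: "d > 0" "\<And>w. cmod (w - 1) < d \<Longrightarrow> cmod (Ln w) < 2 * pi * \<epsilon>"
    using assms unfolding continuous_at_eps_delta dist_norm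
    by (metis Ln_1 diff_zero mult_pos_pos pi_gt_zero zero_less_numeral)
  define \<delta> where "\<delta> = min d 1 * cmod (uexp z0)"
  show thesis
  proof (rule that[of \<delta>])
    show "\<delta> > 0" using d(1) by (simp add: \<delta>_def)
    fix z assume z: "cmod (uexp z - uexp z0) < \<delta>"
    define w where "w = uexp z / uexp z0"
    have "w - 1 = (uexp z - uexp z0) / uexp z0" by (simp add: w_def diff_divide_distrib)
    then have "cmod (w - 1) = cmod (uexp z - uexp z0) / cmod (uexp z0)" by (simp only: norm_divide)
    also have "\<dots> < min d 1" using z pos_divide_less_eq[of "cmod (uexp z0)" "cmod (uexp z - uexp z0)" "min d 1"]
      unfolding \<delta>_def by simp
    finally have "cmod (Ln w) < 2 * pi * \<epsilon>" using d(2) by simp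
    define v where "v = Ln w / (2 * of_real pi * \<i>)"
    have v: "cmod v < \<epsilon>" using \<open>cmod (Ln w) < _\<close> by (simp add: v_def norm_divide norm_mult field_simps)
    have "uexp (z0 + v) = uexp z0 * exp (Ln w)"
      by (simp add: v_def distrib_left exp_add)
    also have "\<dots> = uexp z" by (simp add: w_def)
    finally obtain n :: int where "z = (z0 + v) + of_int n" using uexp_eq_iff[of z "z0 + v"] by metis
    then show "\<exists>n::int. cmod (z - of_int n - z0) < \<epsilon>" using v by (intro exI[of _ n]) simp
  qed
qed

text \<open>The Wirtinger coefficients of D. Their squared moduli differ by the Jacobian
  determinant, so its sign tells whether the linear or the conjugate-linear term dominates.\<close>

lemma real_linear_complex_decompose:
  fixes D :: "complex \<Rightarrow> complex"
  assumes "linear D"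
  shows "D w = (D 1 - \<i> * D \<i>) / 2 * w + (D 1 + \<i> * D \<i>) / 2 * cnj w"
    and "(cmod ((D 1 - \<i> * D \<i>) / 2))\<^sup>2 - (cmod ((D 1 + \<i> * D \<i>) / 2))\<^sup>2 = oriented_area (D 1) (D \<i>)"
proof -
  have "w = Re w *\<^sub>R 1 + Im w *\<^sub>R \<i>" by (simp add: complex_eq_iff)
  then have "D w = Re w *\<^sub>R D 1 + Im w *\<^sub>R D \<i>"
    using linear_add[OF assms] linear_cmul[OF assms] by metis
  then show "D w = (D 1 - \<i> * D \<i>) / 2 * w + (D 1 + \<i> * D \<i>) / 2 * cnj w"
    by (simp add: complex_eq_iff field_simps)
  show "(cmod ((D 1 - \<i> * D \<i>) / 2))\<^sup>2 - (cmod ((D 1 + \<i> * D \<i>) / 2))\<^sup>2 = oriented_area (D 1) (D \<i>)"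
    unfolding cmod_power2 oriented_area_def
    by (simp add: power2_eq_square field_simps)
qed

text \<open>N is close to A v + B v' and E to C v with |v'| = |v|, so N / E misses A / C by about
  |B| / |C|, which is less than |A / C|. Small relative errors \<eta> do not destroy the strict
  inequality.\<close>

lemma linear_ratio_bound:
  fixes A B C :: complex
  assumes A: "A \<noteq> 0" "cmod B < cmod A" and C: "C \<noteq> 0"
  obtains \<eta> \<rho> where "\<eta> > 0" "0 \<le> \<rho>" "\<rho> < cmod (A / C)"
    "\<And>N E v v'. v \<noteq> 0 \<Longrightarrow> cmod v' = cmod v \<Longrightarrow> cmod (N - (A * v + B * v')) \<le> \<eta> * cmod v \<Longrightarrow>
       cmod (E - C * v) \<le> \<eta> * cmod v \<Longrightarrow> cmod (N / E - A / C) \<le> \<rho>"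
proof -
  \<comment> \<open>The error bound obtained by dividing the estimate of N - (A / C) E by the lower
    bound (|C| - \<eta>) |v| of |E|. At \<eta> = 0 it is |B| / |C|, and continuity leaves room for a
    positive \<eta>.\<close>
  define r where "r \<eta> = (cmod B + (1 + cmod (A / C)) * \<eta>) / (cmod C - \<eta>)" for \<eta> :: real
  have "isCont r 0" unfolding r_def using C by (auto intro!: continuous_intros)
  then have "(r \<longlongrightarrow> r 0) (at_right 0)" by (simp add: isCont_def filterlim_at_split)
  moreover have "r 0 < cmod (A / C)" using A C by (simp add: r_def norm_divide divide_strict_right_mono)
  ultimately have "\<forall>\<^sub>F \<eta> in at_right 0. r \<eta> < cmod (A / C)" by (rule order_tendstoD(2))
  moreover have "\<forall>\<^sub>F \<eta> in at_right 0. \<eta> \<in> {0<..<cmod C}"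
    using C by (intro eventually_at_right_real) simp
  ultimately have "\<forall>\<^sub>F \<eta> in at_right 0. r \<eta> < cmod (A / C) \<and> \<eta> \<in> {0<..<cmod C}"
    by eventually_elim auto
  then obtain \<eta> where \<eta>: "r \<eta> < cmod (A / C)" "0 < \<eta>" "\<eta> < cmod C"
    using eventually_happens'[OF trivial_limit_at_right_real] by fastforce
  show thesis
  proof (rule that[of \<eta> "r \<eta>"])
    show "0 \<le> r \<eta>" using \<eta> by (simp add: r_def)
    fix N E v v' :: complex
    assume v: "v \<noteq> 0" "cmod v' = cmod v" and N: "cmod (N - (A * v + B * v')) \<le> \<eta> * cmod v"
      and E: "cmod (E - C * v) \<le> \<eta> * cmod v"
    have "cmod (C * v) \<le> cmod E + cmod (E - C * v)"
      by (metis add.commute norm_minus_commute norm_triangle_sub)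
    then have E': "(cmod C - \<eta>) * cmod v \<le> cmod E"
      using E by (simp add: norm_mult left_diff_distrib)
    have pos: "0 < (cmod C - \<eta>) * cmod v" using v \<eta> by simp
    then have "E \<noteq> 0" using E' by auto
    have "N - A / C * E = (N - (A * v + B * v')) + B * v' - A / C * (E - C * v)"
      using C by (simp add: field_simps)
    then have "cmod (N - A / C * E) \<le> cmod (N - (A * v + B * v')) + cmod (B * v') + cmod (A / C * (E - C * v))"
      by (metis norm_triangle_ineq4 norm_triangle_ineq order_trans add_right_mono)
    also have "\<dots> \<le> \<eta> * cmod v + cmod B * cmod v + cmod (A / C) * (\<eta> * cmod v)"
    proof (intro add_mono N)
      show "cmod (B * v') \<le> cmod B * cmod v" using v(2) by (simp add: norm_mult)
      show "cmod (A / C * (E - C * v)) \<le> cmod (A / C) * (\<eta> * cmod v)"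
        unfolding norm_mult[of "A / C"] by (rule mult_left_mono[OF E norm_ge_zero])
    qed
    also have "\<dots> = r \<eta> * ((cmod C - \<eta>) * cmod v)"
    proof -
      have "r \<eta> * (cmod C - \<eta>) = cmod B + (1 + cmod (A / C)) * \<eta>" using \<eta>(3) by (simp add: r_def)
      then show ?thesis by (simp only: mult.assoc[symmetric]) (simp only: algebra_simps)
    qed
    also have "\<dots> \<le> r \<eta> * cmod E" by (rule mult_left_mono[OF E' \<open>0 \<le> r \<eta>\<close>])
    finally have "cmod (N - A / C * E) \<le> r \<eta> * cmod E" .
    moreover have "N / E - A / C = (N - A / C * E) / E" using \<open>E \<noteq> 0\<close> by (simp add: diff_divide_distrib)
    ultimately show "cmod (N / E - A / C) \<le> r \<eta>"
      using \<open>E \<noteq> 0\<close> by (simp only: norm_divide) (simp add: divide_le_eq)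
  qed (use \<eta> in auto)
qed

lemma has_derivative_eventually_bound:
  assumes "(f has_derivative D) (at x)" and "e > 0"
  shows "\<forall>\<^sub>F y in nhds x. norm (f y - f x - D (y - x)) \<le> e * norm (y - x)"
proof -
  obtain d where "d > 0" "\<And>y. norm (y - x) < d \<Longrightarrow> norm (f y - f x - D (y - x)) \<le> e * norm (y - x)"
    using assms unfolding has_derivative_at_alt by blast
  then show ?thesis unfolding eventually_nhds_metric dist_norm by blast
qed

text \<open>The sign of the Jacobian selects the dominant Wirtinger term A, and
  \<open>uexp z - uexp z0\<close> is C (z - z0) to first order with C nonzero, so
  \<open>linear_ratio_bound\<close> applies. A point z with uexp z near uexp z0 is first shifted by
  an integer to lie near z0, which changes neither F nor \<open>uexp\<close>.\<close>

lemma simple_zero_of_derivative: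
  assumes per: "\<And>z (n::int). F (z + of_int n) = F z"
    and D: "(F has_derivative D) (at z0)" "F z0 = 0"
    and e: "oriented_area (D 1) (D \<i>) > 0 \<and> e = 1 \<or> oriented_area (D 1) (D \<i>) < 0 \<and> e = -1"
  shows "simple_zero F (uexp z0) e"
proof -
  define a b where "a = (D 1 - \<i> * D \<i>) / 2" and "b = (D 1 + \<i> * D \<i>) / 2"
  have lin: "linear D" using D(1) has_derivative_linear by blast
  note dec = real_linear_complex_decompose[OF lin, folded a_def b_def]
  define A B where "A = (if e = 1 then a else b)" and "B = (if e = 1 then b else a)"
  have "(cmod B)\<^sup>2 < (cmod A)\<^sup>2" using e dec(2) by (auto simp: A_def B_def)
  then have AB: "cmod B < cmod A" by (simp add: power2_less_imp_less)
  then have A: "A \<noteq> 0" by (metis norm_eq_zero norm_not_less_zero)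
  define C where "C = 2 * of_real pi * \<i> * uexp z0"
  define C' where "C' = signed_cnj e C"
  have "C' \<noteq> 0" by (simp add: C'_def C_def)
  have Dw: "D w = A * signed_cnj e w + B * signed_cnj (- e) w" for w
    using dec(1)[of w] e by (auto simp: A_def B_def signed_cnj_def)
  obtain \<eta> \<rho> where \<eta>: "\<eta> > 0" "0 \<le> \<rho>" "\<rho> < cmod (A / C')"
    and bound: "\<And>N E v v'. v \<noteq> 0 \<Longrightarrow> cmod v' = cmod v \<Longrightarrow> cmod (N - (A * v + B * v')) \<le> \<eta> * cmod v \<Longrightarrow>
       cmod (E - C' * v) \<le> \<eta> * cmod v \<Longrightarrow> cmod (N / E - A / C') \<le> \<rho>"
    using linear_ratio_bound[OF A AB \<open>C' \<noteq> 0\<close>] by metis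
  have dE: "(uexp has_field_derivative C) (at z0)"
    unfolding C_def by (auto intro!: derivative_eq_intros)
  then have dE': "(uexp has_derivative (\<lambda>w. C * w)) (at z0)"
    by (simp add: has_field_derivative_def)
  have "\<forall>\<^sub>F z in nhds z0. cmod (F z - D (z - z0)) \<le> \<eta> * cmod (z - z0)"
    using has_derivative_eventually_bound[OF D(1) \<eta>(1)] by (simp add: D(2))
  moreover have "\<forall>\<^sub>F z in nhds z0. cmod (uexp z - uexp z0 - C * (z - z0)) \<le> \<eta> * cmod (z - z0)"
    by (rule has_derivative_eventually_bound[OF dE' \<eta>(1)])
  ultimately have "\<forall>\<^sub>F z in nhds z0. cmod (F z - D (z - z0)) \<le> \<eta> * cmod (z - z0) \<and>
      cmod (uexp z - uexp z0 - C * (z - z0)) \<le> \<eta> * cmod (z - z0)"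
    by eventually_elim simp
  then obtain \<epsilon> where \<epsilon>: "\<epsilon> > 0" "\<And>z. dist z z0 < \<epsilon> \<Longrightarrow> cmod (F z - D (z - z0)) \<le> \<eta> * cmod (z - z0) \<and>
      cmod (uexp z - uexp z0 - C * (z - z0)) \<le> \<eta> * cmod (z - z0)"
    unfolding eventually_nhds_metric by metis
  obtain \<delta> where \<delta>: "\<delta> > 0" "\<And>z. cmod (uexp z - uexp z0) < \<delta> \<Longrightarrow> \<exists>n::int. cmod (z - of_int n - z0) < \<epsilon>"
    using uexp_close[OF \<epsilon>(1)] by metis
  have "cmod (F z / signed_cnj e (uexp z - uexp z0) - A / C') \<le> \<rho>"
    if z: "0 < cmod (uexp z - uexp z0)" "cmod (uexp z - uexp z0) < \<delta>" for z
  proof -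
    obtain n :: int where n: "cmod (z - of_int n - z0) < \<epsilon>" using \<delta>(2)[OF z(2)] by blast
    define y where "y = z - of_int n"
    have zy: "z = y + of_int n" by (simp add: y_def)
    have Fy: "F z = F y" unfolding zy by (rule per)
    have uy: "uexp z = uexp y" using uexp_eq_iff[of z y] zy by blast
    have y: "dist y z0 < \<epsilon>" using n by (simp add: y_def dist_norm)
    have ne: "y - z0 \<noteq> 0" using z(1) uy by auto
    define w where "w = y - z0"
    show ?thesis
    proof (rule bound[of "signed_cnj e w" "signed_cnj (- e) w"])
      show "signed_cnj e w \<noteq> 0" using ne by (simp add: w_def)
      show "cmod (F z - (A * signed_cnj e w + B * signed_cnj (- e) w)) \<le> \<eta> * cmod (signed_cnj e w)"
        using \<epsilon>(2)[OF y] unfolding Fy Dw[symmetric] by (simp add: w_def)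
      have "signed_cnj e (uexp z - uexp z0) - C' * signed_cnj e w = signed_cnj e (uexp y - uexp z0 - C * w)"
        unfolding uy by (simp add: C'_def signed_cnj_def)
      then show "cmod (signed_cnj e (uexp z - uexp z0) - C' * signed_cnj e w) \<le> \<eta> * cmod (signed_cnj e w)"
        using \<epsilon>(2)[OF y] by (simp only: signed_cnj_simps) (simp add: w_def)
    qed simp
  qed
  then show ?thesis unfolding simple_zero_def using \<eta>(2,3) \<delta>(1) by blast
qed

section \<open>The difference quotient of a curve with translational symmetry\<close>

lemma has_vector_derivative_affine:
  fixes k :: "real \<Rightarrow> 'a::real_normed_vector"
  assumes "(k has_vector_derivative D) (at (c + r * m))"
  shows "((\<lambda>r. k (c + r * m)) has_vector_derivative m *\<^sub>R D) (at r)"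
proof -
  have "((\<lambda>r. c + r * m) has_vector_derivative m) (at r)"
    unfolding has_real_derivative_iff_has_vector_derivative[symmetric]
    by (auto intro!: derivative_eq_intros)
  from vector_diff_chain_at[OF this assms] show ?thesis by (simp add: o_def)
qed

lemma translation_by_int:
  fixes k :: "real \<Rightarrow> complex"
  assumes per: "\<And>t. k (t + 1) = k t + 1"
  shows "k (t + of_int n) = k t + of_int n"
proof (induction n rule: int_induct[where k = 0])
  case (step1 i)
  then show ?case using per[of "t + of_int i"] by (simp add: add.assoc)
next
  case (step2 i)
  then show ?case using per[of "t + of_int (i - 1)"] by (simp add: algebra_simps)
qed simp

text \<open>The quotient \<open>F (t + \<i> u) = (k (t + u) - k t) / u\<close> extends to the whole strip. It is \<open>k'\<close> on the
  bottom and \<open>1\<close> on the top, and it vanishes at the double points of \<open>k\<close> with \<open>0 < u < 1\<close>.\<close>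

theorem translational_curve_rotation:
  fixes k k' :: "real \<Rightarrow> complex" and \<theta> :: "real \<Rightarrow> real"
  assumes k: "\<And>t. (k has_vector_derivative k' t) (at t)" and cont: "continuous_on UNIV k'"
    and nz: "\<And>t. k' t \<noteq> 0" and per: "\<And>t. k (t + 1) = k t + 1"
    and Q: "Q = {(a, b). 0 \<le> a \<and> a < 1 \<and> a < b \<and> b < a + 1 \<and> k a = k b}" and fin: "finite Q"
    and trans: "\<And>a b. (a, b) \<in> Q \<Longrightarrow> oriented_area (k' a) (k' b) \<noteq> 0"
    and \<theta>: "continuous_on UNIV \<theta>" "\<And>t. \<exists>r>0. k' t = of_real r * cis (\<theta> t)"
  shows "\<theta> 1 - \<theta> 0 = 2 * pi * of_int (\<Sum>(a, b)\<in>Q. crossing_sign (k' a) (k' b))"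
proof -
  note kn = translation_by_int[of k, OF per]
  have k'n: "k' (t + of_int n) = k' t" for t n
  proof -
    have "((\<lambda>t. k (t + of_int n)) has_vector_derivative k' (t + of_int n)) (at t)"
      using has_vector_derivative_affine[where c = "of_int n" and m = 1 and r = t, OF k]
      by (simp add: add.commute)
    moreover have "((\<lambda>t. k (t + of_int n)) has_vector_derivative k' t) (at t)"
      unfolding kn by (auto intro!: derivative_eq_intros k)
    ultimately show ?thesis by (rule vector_derivative_unique_at)
  qed
  \<comment> \<open>The difference quotient written as the mean of \<open>k'\<close> over the
    parameters from \<open>Re z\<close> to \<open>Re z + Im z\<close>. In this form it is continuous
    down to Im z = 0, where it is \<open>k'\<close>.\<close>
  define F where "F z = integral {0..1} (\<lambda>r. k' (Re z + r * Im z))" for z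
  have FI: "Im z *\<^sub>R F z = k (Re z + Im z) - k (Re z)" for z
  proof -
    have "((\<lambda>r. Im z *\<^sub>R k' (Re z + r * Im z)) has_integral
        k (Re z + 1 * Im z) - k (Re z + 0 * Im z)) {0..1}"
    proof (rule fundamental_theorem_of_calculus)
      fix r :: real
      have "((\<lambda>r. k (Re z + r * Im z)) has_vector_derivative Im z *\<^sub>R k' (Re z + r * Im z)) (at r)"
        by (rule has_vector_derivative_affine[OF k])
      then show "((\<lambda>r. k (Re z + r * Im z)) has_vector_derivative Im z *\<^sub>R k' (Re z + r * Im z)) (at r within {0..1})"
        by (rule has_vector_derivative_at_within)
    qed simp
    from integral_unique[OF this] show ?thesis by (simp add: F_def)
  qed
  have contF: "continuous_on strip F"
    unfolding F_def box_real(2)[symmetric]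
    by (rule integral_continuous_on_param)
       (auto intro!: continuous_intros continuous_on_compose2[OF cont] simp: case_prod_beta)
  have Fn: "F (z + of_int n) = F z" for z n
    using k'n[of "Re z + _ * Im z" n] by (simp add: F_def algebra_simps)
  have bot: "F (of_real t) = k' t" for t by (simp add: F_def)
  have top: "F (of_real t + \<i>) = 1" for t
    using FI[of "of_real t + \<i>"] per[of t] by simp
  \<comment> \<open>The pair (a, b) is the point t = a, u = b - a of the strip. A common integer
    shift of a and b does not change its image, and 0 \<le> a < 1 picks one pair from each class,
    whence injectivity on \<open>Q\<close>.\<close>
  define e where "e = (\<lambda>(a, b). uexp (Complex a (b - a)))"
  have eQ: "e (a, b) = e (a', b') \<longleftrightarrow> (\<exists>n::int. a = a' + of_int n \<and> b = b' + of_int n)" for a b a' b'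
  proof -
    have "Complex a (b - a) = Complex a' (b' - a') + of_int n \<longleftrightarrow> a = a' + of_int n \<and> b = b' + of_int n"
      for n :: int by (auto simp: complex_eq_iff)
    then show ?thesis by (simp add: e_def uexp_eq_iff)
  qed
  have inj: "inj_on e Q"
  proof (rule inj_onI)
    fix x y assume xy: "x \<in> Q" "y \<in> Q" "e x = e y"
    obtain a b a' b' where ab: "x = (a, b)" "y = (a', b')" by (metis surj_pair)
    then obtain n :: int where n: "a = a' + of_int n" "b = b' + of_int n" using xy(3) eQ by auto
    have "0 \<le> a" "a < 1" "0 \<le> a'" "a' < 1" using xy ab by (auto simp: Q)
    then have "n = 0" using n by linarith
    then show "x = y" using n ab by simp
  qed
  have zero: "F z = 0 \<longleftrightarrow> uexp z \<in> e ` Q" if z: "z \<in> strip" for z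
  proof
    assume F0: "F z = 0"
    then have eq: "k (Re z + Im z) = k (Re z)" using FI[of z] by simp
    have "Im z \<noteq> 0"
    proof
      assume "Im z = 0"
      then have "z = of_real (Re z)" by (simp add: complex_eq_iff)
      then show False using bot[of "Re z"] F0 nz by simp
    qed
    moreover have "Im z \<noteq> 1" using per[of "Re z"] eq by auto
    ultimately have u: "0 < Im z" "Im z < 1" using z by auto
    define n where "n = - \<lfloor>Re z\<rfloor>"
    have "(Re z + of_int n, Re z + Im z + of_int n) \<in> Q"
      unfolding Q using u eq kn[of "Re z + Im z" n] kn[of "Re z" n] by (simp add: n_def) linarith
    moreover have "uexp z = e (Re z + of_int n, Re z + Im z + of_int n)"
    proof -
      have "e (Re z, Re z + Im z) = e (Re z + of_int n, Re z + Im z + of_int n)"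
        unfolding eQ by (intro exI[of _ "- n"]) simp
      then show ?thesis by (simp add: e_def)
    qed
    ultimately show "uexp z \<in> e ` Q" by blast
  next
    assume "uexp z \<in> e ` Q"
    then obtain a b where ab: "(a, b) \<in> Q" "uexp z = uexp (Complex a (b - a))" by (auto simp: e_def)
    then obtain n :: int where n: "z = Complex a (b - a) + of_int n" using uexp_eq_iff by blast
    have "(b - a) *\<^sub>R F (Complex a (b - a)) = 0" "b - a \<noteq> 0"
      using FI[of "Complex a (b - a)"] ab(1) by (auto simp: Q)
    then show "F z = 0" unfolding n Fn by simp
  qed
  define \<sigma> where "\<sigma> = (\<lambda>(a, b). crossing_sign (k' a) (k' b))"
  define s where "s \<zeta> = \<sigma> (inv_into Q e \<zeta>)" for \<zeta>
  have s: "s (e x) = \<sigma> x" if "x \<in> Q" for x using that inj by (simp add: s_def)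
  have pm: "s \<zeta> \<in> {1, -1}" if "\<zeta> \<in> e ` Q" for \<zeta>
    using that trans by (auto simp: s \<sigma>_def crossing_sign_def)
  have sz: "simple_zero F \<zeta> (s \<zeta>)" if \<zeta>: "\<zeta> \<in> e ` Q" for \<zeta>
  proof -
    obtain x where x: "x \<in> Q" "\<zeta> = e x" using \<zeta> by blast
    obtain a b where "x = (a, b)" by (cases x)
    then have ab: "(a, b) \<in> Q" "\<zeta> = e (a, b)" using x by simp_all
    define u z0 where "u = b - a" and "z0 = Complex a u"
    have "a < b" "k a = k b" using ab(1) unfolding Q by simp_all
    then have u: "u \<noteq> 0" "k b - k a = 0" by (simp_all add: u_def)
    \<comment> \<open>The candidate derivative of F at z0. Differentiating 1 / Im z contributes
      nothing, because its cofactor k b - k a vanishes.\<close>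
    define D where "D w = inverse u *\<^sub>R ((Re w + Im w) *\<^sub>R k' b - Re w *\<^sub>R k' a)" for w
    have kb: "(k has_derivative (\<lambda>x. x *\<^sub>R k' b)) (at (Re z0 + Im z0))"
      and ka: "(k has_derivative (\<lambda>x. x *\<^sub>R k' a)) (at (Re z0))"
      using k[of b] k[of a] by (simp_all add: has_vector_derivative_def z0_def u_def)
    have Re: "(Re has_derivative Re) (at z0)" and Im: "(Im has_derivative Im) (at z0)"
      using bounded_linear_imp_has_derivative[OF bounded_linear_Re]
        bounded_linear_imp_has_derivative[OF bounded_linear_Im] by blast+
    have dG: "((\<lambda>z. k (Re z + Im z) - k (Re z)) has_derivative
        (\<lambda>w. (Re w + Im w) *\<^sub>R k' b - Re w *\<^sub>R k' a)) (at z0)"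
      by (intro has_derivative_diff has_derivative_compose[OF has_derivative_add[OF Re Im] kb]
          has_derivative_compose[OF Re ka])
    have dI: "((\<lambda>z. inverse (Im z)) has_derivative (\<lambda>w. - (inverse u * Im w * inverse u))) (at z0)"
      using Deriv.has_derivative_inverse[OF _ Im] u by (simp add: z0_def)
    have "((\<lambda>z. inverse (Im z) *\<^sub>R (k (Re z + Im z) - k (Re z))) has_derivative D) (at z0)"
      by (rule has_derivative_eq_rhs[OF has_derivative_scaleR[OF dI dG]])
         (use u in \<open>auto simp: fun_eq_iff D_def z0_def u_def\<close>)
    then have dF: "(F has_derivative D) (at z0)"
    proof (rule has_derivative_transform_within_open)
      show "open {z. Im z \<noteq> 0}" by (intro open_Collect_neq continuous_intros)
      show "z0 \<in> {z. Im z \<noteq> 0}" using u by (simp add: z0_def)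
      show "inverse (Im z) *\<^sub>R (k (Re z + Im z) - k (Re z)) = F z" if "z \<in> {z. Im z \<noteq> 0}" for z
        using that unfolding FI[symmetric] by simp
    qed
    have F0: "F z0 = 0"
      using FI[of z0] u by (simp add: z0_def u_def)
    \<comment> \<open>D 1 is (k' b - k' a) / u and D i is k' b / u. The resulting minus sign matches
      \<open>crossing_sign\<close>, which is 1 when the area is negative.\<close>
    have area: "oriented_area (D 1) (D \<i>) = - oriented_area (k' a) (k' b) / u\<^sup>2"
      using u(1) by (simp add: D_def oriented_area_def field_simps power2_eq_square)
    have "oriented_area (D 1) (D \<i>) > 0 \<and> s \<zeta> = 1 \<or> oriented_area (D 1) (D \<i>) < 0 \<and> s \<zeta> = -1"
      using trans[OF ab(1)] u(1) unfolding area ab(2) s[OF ab(1)]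
      by (auto simp: \<sigma>_def crossing_sign_def divide_less_0_iff zero_less_divide_iff)
    then show ?thesis
      using simple_zero_of_derivative[OF Fn dF F0] ab(2) by (simp add: e_def z0_def u_def)
  qed
  have annulus: "e ` Q \<subseteq> {w. exp (- 2 * pi) < cmod w \<and> cmod w < 1}"
    by (auto simp: e_def Q)
  have "\<theta> 1 - \<theta> 0 = 2 * pi * of_int (\<Sum>\<zeta>\<in>e ` Q. s \<zeta>)"
    by (rule strip_index[OF finite_imageI[OF fin] contF _ zero sz pm annulus top \<theta>(1)])
       (use Fn[of _ 1] \<theta>(2) in \<open>auto simp: bot\<close>)
  also have "(\<Sum>\<zeta>\<in>e ` Q. s \<zeta>) = (\<Sum>x\<in>Q. \<sigma> x)"
    using sum.reindex[OF inj, of s] s by (simp cong: sum.cong)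
  finally show ?thesis by (simp add: \<sigma>_def)
qed

section \<open>Lifting through covering spaces of arbitrary base\<close>

text \<open>The lifting theorems of the library require the base of the covering to be a subset of a normed
  space; here it is an arbitrary topological space, and the lifted map has a convex domain.\<close>

lemma evenly_covered_section:
  fixes p :: "'a::topological_space \<Rightarrow> 'b::topological_space"
  assumes "covering_space C p S" and "x \<in> S"
  obtains T where "openin (top_of_set S) T" "x \<in> T"
    "\<And>z. z \<in> C \<Longrightarrow> p z \<in> T \<Longrightarrow>
       \<exists>q. continuous_on T q \<and> q ` T \<subseteq> C \<and> q (p z) = z \<and> (\<forall>y\<in>T. p (q y) = y)"
proof -
  obtain T v where T: "x \<in> T" "openin (top_of_set S) T"
    and v: "\<Union>v = C \<inter> p -` T" "\<And>u. u \<in> v \<Longrightarrow> \<exists>q. homeomorphism u T p q"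
    using assms unfolding covering_space_def by metis
  have "\<exists>q. continuous_on T q \<and> q ` T \<subseteq> C \<and> q (p z) = z \<and> (\<forall>y\<in>T. p (q y) = y)"
    if z: "z \<in> C" "p z \<in> T" for z
  proof -
    obtain u where u: "u \<in> v" "z \<in> u" using v(1) z by blast
    obtain q where q: "homeomorphism u T p q" using v(2) u by blast
    moreover have "u \<subseteq> C" using u v(1) by blast
    ultimately show ?thesis using u(2) z(2)
      by (metis homeomorphism_apply1 homeomorphism_apply2 homeomorphism_cont2 homeomorphism_image2)
  qed
  then show thesis using T that by blast
qed

lemma covering_space_locally_injective:
  fixes p :: "'a::topological_space \<Rightarrow> 'b::topological_space"
  assumes "covering_space C p S" and "z \<in> C"
  obtains U where "openin (top_of_set C) U" "z \<in> U" "inj_on p U"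
proof -
  have "p z \<in> S" using assms by (auto simp: covering_space_def)
  then obtain T v where "p z \<in> T"
    and v: "\<Union>v = C \<inter> p -` T" "\<And>u. u \<in> v \<Longrightarrow> openin (top_of_set C) u"
    "\<And>u. u \<in> v \<Longrightarrow> \<exists>q. homeomorphism u T p q"
    using assms(1) unfolding covering_space_def by metis
  then obtain u where "u \<in> v" "z \<in> u" using assms(2) by blast
  moreover obtain q where "homeomorphism u T p q" using v(3) calculation by blast
  then have "inj_on p u" by (metis homeomorphism_apply1 inj_onI)
  ultimately show thesis using v(2) that by blast
qed

lemma covering_space_lift_const:
  fixes p :: "'a::real_normed_vector \<Rightarrow> 'b::topological_space"
  assumes "covering_space C p S" and "connected A" and "continuous_on A g" and "g ` A \<subseteq> C"
    and "\<And>x. x \<in> A \<Longrightarrow> p (g x) = d" and "x \<in> A" and "y \<in> A"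
  shows "g x = g y"
proof -
  have "d \<in> S" using assms by (metis covering_space_imp_surjective image_eqI image_subset_iff)
  then show ?thesis
    by (intro covering_space_lift_unique[OF assms(1), of g y "\<lambda>_. g y" A "\<lambda>_. d" x])
      (use assms in \<open>simp_all add: image_subset_iff\<close>)
qed

text \<open>Let \<open>P s\<close> say that a lift exists over times [0, s], with a radius that may
  depend on s. Near each time F maps a small box into one evenly covered set, so \<open>P\<close> is
  locally constant on [0, 1] and passes from 0 to 1 by connectedness.\<close>

lemma covering_space_lift_tube:
  fixes p :: "'a::real_normed_vector \<Rightarrow> 'b::topological_space"
    and F :: "'c::real_normed_vector \<times> real \<Rightarrow> 'b"
  assumes cov: "covering_space C p S" and K: "convex K" "x \<in> K"
    and F: "continuous_on (K \<times> {0..1}) F" "F ` (K \<times> {0..1}) \<subseteq> S"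
    and g: "continuous_on K g" "g ` K \<subseteq> C" "\<And>y. y \<in> K \<Longrightarrow> p (g y) = F (y, 0)"
  shows "\<exists>\<delta>>0. \<exists>G. continuous_on ((ball x \<delta> \<inter> K) \<times> {0..1}) G \<and>
           (\<forall>y\<in>ball x \<delta> \<inter> K. G (y, 0) = g y \<and>
              (\<forall>r\<in>{0..1}. G (y, r) \<in> C \<and> p (G (y, r)) = F (y, r)))"
proof -
  define P where "P s \<longleftrightarrow> (\<exists>\<delta>>0. \<exists>G. continuous_on ((ball x \<delta> \<inter> K) \<times> {0..s}) G \<and>
           (\<forall>y\<in>ball x \<delta> \<inter> K. G (y, 0) = g y \<and>
              (\<forall>r\<in>{0..s}. G (y, r) \<in> C \<and> p (G (y, r)) = F (y, r))))" for s :: real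
  have "P 1"
  proof (rule connected_induction_simple[of "{0..1::real}" 0 1 P])
    have "continuous_on ((ball x 1 \<inter> K) \<times> {0..0::real}) (g \<circ> fst)"
      by (intro continuous_on_compose continuous_intros continuous_on_subset[OF g(1)]) auto
    then show "P 0" unfolding P_def
      by (intro exI[of _ 1] conjI exI[of _ "g \<circ> fst"]) (use g in \<open>auto simp del: o_apply simp: o_def\<close>)
  next
    fix s :: real assume s: "s \<in> {0..1}"
    then have "F (x, s) \<in> S" using K F by auto
    then obtain T where T: "openin (top_of_set S) T" "F (x, s) \<in> T"
      and sec: "\<And>z. z \<in> C \<Longrightarrow> p z \<in> T \<Longrightarrow>
         \<exists>q. continuous_on T q \<and> q ` T \<subseteq> C \<and> q (p z) = z \<and> (\<forall>y\<in>T. p (q y) = y)"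
      using evenly_covered_section[OF cov] by metis
    have opn: "openin (top_of_set (K \<times> {0..1})) (K \<times> {0..1} \<inter> F -` T)"
      using continuous_openin_preimage[OF F(1) _ T(1)] F(2) by auto
    then obtain e where e: "e > 0" "ball (x, s) e \<inter> K \<times> {0..1} \<subseteq> F -` T"
    proof -
      have "(x, s) \<in> K \<times> {0..1} \<inter> F -` T" using T(2) K s by simp
      then obtain e where "e > 0" "ball (x, s) e \<inter> K \<times> {0..1} \<subseteq> K \<times> {0..1} \<inter> F -` T"
        using opn unfolding openin_contains_ball by (meson)
      then show thesis using that[of e] by blast
    qed
    define d where "d = e / 2"
    have d: "d > 0" using e by (simp add: d_def)
    have FT: "F (y, r) \<in> T" if "y \<in> ball x d \<inter> K" "r \<in> ball s d \<inter> {0..1}" for y r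
    proof -
      have "dist (x, s) (y, r) \<le> dist x y + dist s r"
        unfolding dist_prod_def by (simp add: sqrt_sum_squares_le_sum)
      also have "\<dots> < e" using that by (simp add: d_def)
      finally have "(y, r) \<in> ball (x, s) e \<inter> K \<times> {0..1}" using that by simp
      then show ?thesis using e(2) by blast
    qed
    have "P b" if ab: "a \<in> ball s d \<inter> {0..1}" "b \<in> ball s d \<inter> {0..1}" "P a" for a b
    proof -
      obtain \<delta> G where G: "\<delta> > 0" "continuous_on ((ball x \<delta> \<inter> K) \<times> {0..a}) G"
        "\<And>y. y \<in> ball x \<delta> \<inter> K \<Longrightarrow> G (y, 0) = g y"
        "\<And>y r. y \<in> ball x \<delta> \<inter> K \<Longrightarrow> r \<in> {0..a} \<Longrightarrow> G (y, r) \<in> C \<and> p (G (y, r)) = F (y, r)"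
        using ab(3) unfolding P_def by blast
      show ?thesis
      proof (cases "b \<le> a")
        case True
        then have "continuous_on ((ball x \<delta> \<inter> K) \<times> {0..b}) G"
          by (intro continuous_on_subset[OF G(2)]) auto
        then show ?thesis unfolding P_def using G True by (intro exI[of _ \<delta>] exI[of _ G]) auto
      next
        case False
        define V where "V = ball x (min \<delta> d) \<inter> K"
        have V: "y \<in> ball x \<delta> \<inter> K" "y \<in> ball x d \<inter> K" if "y \<in> V" for y
          using that by (auto simp: V_def)
        have xV: "x \<in> V" using K G(1) d by (auto simp: V_def)
        have connV: "connected V"
          unfolding V_def using K by (intro convex_connected convex_Int) auto
        have a: "a \<in> {0..a}" using ab by auto
        obtain q where q: "continuous_on T q" "q ` T \<subseteq> C" "q (p (G (x, a))) = G (x, a)"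
          "\<And>y. y \<in> T \<Longrightarrow> p (q y) = y"
          using sec[of "G (x, a)"] G(4)[OF V(1)[OF xV] a] FT[OF V(2)[OF xV] ab(1)] by metis
        have contF: "continuous_on (V \<times> ({0..1} \<inter> ball s d)) F"
          by (rule continuous_on_subset[OF F(1)]) (auto simp: V_def)
        \<comment> \<open>The section was matched with G only at (x, a). Both sides lift the same
          map on the connected set V, so they agree on all of V and the two pieces can be glued
          along time a.\<close>
        have eq: "G (y, a) = q (F (y, a))" if y: "y \<in> V" for y
        proof (rule covering_space_lift_unique[OF cov, of "\<lambda>y. G (y, a)" x "\<lambda>y. q (F (y, a))" V
              "\<lambda>y. F (y, a)" y])
          show "continuous_on V (\<lambda>y. F (y, a))"
            by (rule continuous_on_compose2[OF contF]) (use ab in \<open>auto intro!: continuous_intros\<close>)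
          then show "continuous_on V (\<lambda>y. q (F (y, a)))"
            by (rule continuous_on_compose2[OF q(1)]) (use FT V ab in auto)
          show "continuous_on V (\<lambda>y. G (y, a))"
            by (rule continuous_on_compose2[OF G(2)]) (use V ab in \<open>auto intro!: continuous_intros\<close>)
          show "(\<lambda>y. F (y, a)) \<in> V \<rightarrow> S" using F(2) V(1) ab by auto
          show "(\<lambda>y. G (y, a)) \<in> V \<rightarrow> C" using G(4) V(1) a by blast
          show "(\<lambda>y. q (F (y, a))) \<in> V \<rightarrow> C" using q(2) FT V(2) ab(1) by blast
          show "F (y, a) = p (G (y, a))" if "y \<in> V" for y using G(4) V(1)[OF that] a by simp
          show "F (y, a) = p (q (F (y, a)))" if "y \<in> V" for y
            using q(4) FT V(2)[OF that] ab(1) by simp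
          show "G (x, a) = q (F (x, a))" using q(3) G(4)[OF V(1)[OF xV] a] by simp
        qed (use connV xV y in auto)
        define G' where "G' w = (if snd w \<le> a then G w else q (F w))" for w
        have mid: "r \<in> ball s d \<inter> {0..1}" if "a \<le> r" "r \<le> b" for r
          using ab that by (simp add: dist_real_def abs_less_iff)
        have "continuous_on (V \<times> {0..b}) G'"
          unfolding G'_def
        proof (rule continuous_on_cases_le)
          show "continuous_on {t \<in> V \<times> {0..b}. snd t \<le> a} G"
            by (rule continuous_on_subset[OF G(2)]) (use V in auto)
          have "continuous_on {t \<in> V \<times> {0..b}. a \<le> snd t} F"
            by (rule continuous_on_subset[OF contF]) (use mid in auto)
          moreover have "F ` {t \<in> V \<times> {0..b}. a \<le> snd t} \<subseteq> T"
            using FT[OF V(2) mid] by auto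
          ultimately show "continuous_on {t \<in> V \<times> {0..b}. a \<le> snd t} (\<lambda>t. q (F t))"
            using continuous_on_compose2[OF q(1)] by blast
          show "G t = q (F t)" if "t \<in> V \<times> {0..b}" "snd t = a" for t
            using eq[of "fst t"] that by (metis mem_Times_iff prod.collapse)
        qed (intro continuous_intros)
        moreover have "G' (y, 0) = g y" if "y \<in> V" for y
          using G(3) V(1)[OF that] a by (simp add: G'_def)
        moreover have "G' (y, r) \<in> C \<and> p (G' (y, r)) = F (y, r)" if "y \<in> V" "r \<in> {0..b}" for y r
        proof (cases "r \<le> a")
          case True
          then show ?thesis using G(4)[OF V(1)[OF that(1)], of r] that by (simp add: G'_def)
        next
          case False
          then have "F (y, r) \<in> T"
            using that(2) by (intro FT[OF V(2)[OF that(1)] mid]) auto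
          then have "q (F (y, r)) \<in> C" "p (q (F (y, r))) = F (y, r)" using q(2,4) by auto
          then show ?thesis using False by (simp add: G'_def)
        qed
        moreover have "min \<delta> d > 0" using G(1) d by simp
        ultimately show ?thesis unfolding P_def V_def by blast
      qed
    qed
    moreover have "openin (top_of_set {0..1}) (ball s d \<inter> {0..1})" "s \<in> ball s d \<inter> {0..1}"
      using s d openin_open_Int[of "ball s d" "{0..1}"] by (simp_all add: Int_commute)
    ultimately show "\<exists>N. openin (top_of_set {0..1}) N \<and> s \<in> N \<and> (\<forall>x\<in>N. \<forall>y\<in>N. P x \<longrightarrow> P y)"
      by (intro exI[of _ "ball s d \<inter> {0..1}"] conjI ballI impI)
  qed auto
  then show ?thesis by (simp add: P_def)
qed

text \<open>K is contracted to a along segments: F starts at the constant map f a, which lifts to z,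
  and ends at f. The tubes around different points are compatible, because over each segment they
  lift the same path from z. Hence their time-one values fit together to a continuous g.\<close>

lemma covering_space_lift_convex:
  fixes p :: "'a::real_normed_vector \<Rightarrow> 'b::topological_space"
    and f :: "'c::real_normed_vector \<Rightarrow> 'b"
  assumes cov: "covering_space C p S" and K: "convex K" "a \<in> K"
    and f: "continuous_on K f" "f ` K \<subseteq> S" and z: "z \<in> C" "p z = f a"
  obtains g where "continuous_on K g" "g ` K \<subseteq> C" "g a = z" "\<And>y. y \<in> K \<Longrightarrow> p (g y) = f y"
proof -
  define F where "F w = f (a + snd w *\<^sub>R (fst w - a))" for w
  have inK: "a + r *\<^sub>R (y - a) \<in> K" if "y \<in> K" "r \<in> {0..1}" for y r
    using convexD_alt[OF K(1) K(2) that(1), of r] that(2)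
    by (simp add: algebra_simps)
  have F: "continuous_on (K \<times> {0..1}) F" "F ` (K \<times> {0..1}) \<subseteq> S"
    unfolding F_def
    by (rule continuous_on_compose2[OF f(1)], use inK f(2) in \<open>auto intro!: continuous_intros\<close>)
  have "\<exists>\<delta>>0. \<exists>G. continuous_on ((ball x \<delta> \<inter> K) \<times> {0..1}) G \<and>
           (\<forall>y\<in>ball x \<delta> \<inter> K. G (y, 0) = z \<and>
              (\<forall>r\<in>{0..1}. G (y, r) \<in> C \<and> p (G (y, r)) = F (y, r)))" if "x \<in> K" for x
    by (rule covering_space_lift_tube[OF cov K(1) that F])
       (use z in \<open>auto simp: F_def\<close>)
  then obtain \<delta> G where \<delta>: "\<And>x. x \<in> K \<Longrightarrow> \<delta> x > 0"
    and G: "\<And>x. x \<in> K \<Longrightarrow> continuous_on ((ball x (\<delta> x) \<inter> K) \<times> {0..1}) (G x)"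
    and G0: "\<And>x y. x \<in> K \<Longrightarrow> y \<in> ball x (\<delta> x) \<inter> K \<Longrightarrow> G x (y, 0) = z"
    and GF: "\<And>x y r. x \<in> K \<Longrightarrow> y \<in> ball x (\<delta> x) \<inter> K \<Longrightarrow> r \<in> {0..1} \<Longrightarrow>
               G x (y, r) \<in> C \<and> p (G x (y, r)) = F (y, r)"
    by metis
  define g where "g y = G y (y, 1)" for y
  have contGy: "continuous_on {0..1} (\<lambda>r. G x (y, r))" if "x \<in> K" "y \<in> ball x (\<delta> x) \<inter> K" for x y
    by (rule continuous_on_compose2[OF G[OF that(1)]]) (use that in \<open>auto intro!: continuous_intros\<close>)
  have agree: "g y = G x (y, 1)" if x: "x \<in> K" "y \<in> ball x (\<delta> x) \<inter> K" for x y
  proof -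
    have y: "y \<in> K" "y \<in> ball y (\<delta> y) \<inter> K" using x \<delta> by auto
    show ?thesis unfolding g_def
    proof (rule covering_space_lift_unique[OF cov, of "\<lambda>r. G y (y, r)" 0 "\<lambda>r. G x (y, r)" "{0..1}"
            "\<lambda>r. F (y, r)"])
      show "continuous_on {0..1} (\<lambda>r. F (y, r))"
        by (rule continuous_on_compose2[OF F(1)]) (use y in \<open>auto intro!: continuous_intros\<close>)
      show "(\<lambda>r. F (y, r)) \<in> {0..1} \<rightarrow> S" using F(2) y by auto
      show "continuous_on {0..1} (\<lambda>r. G y (y, r))" "continuous_on {0..1} (\<lambda>r. G x (y, r))"
        using contGy x y by auto
      show "G y (y, 0) = G x (y, 0)" using G0 x y by simp
    qed (use GF[OF x] GF[OF y] in auto)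
  qed
  have "continuous_on K g"
    unfolding continuous_on_eq_continuous_within
  proof
    fix x assume x: "x \<in> K"
    have "continuous_on (ball x (\<delta> x) \<inter> K) (\<lambda>y. G x (y, 1))"
      by (rule continuous_on_compose2[OF G[OF x]]) (auto intro!: continuous_intros)
    then have "continuous_on (ball x (\<delta> x) \<inter> K) g"
      by (rule continuous_on_eq) (simp add: agree[OF x])
    then have "continuous (at x within ball x (\<delta> x) \<inter> K) g"
      using x \<delta> by (simp add: continuous_on_eq_continuous_within)
    moreover have "at x within K = at x within (ball x (\<delta> x) \<inter> K)"
      using x \<delta>[OF x] by (intro at_within_nhd[of x "ball x (\<delta> x)"]) auto
    ultimately show "continuous (at x within K) g" by simp
  qed
  moreover have "g ` K \<subseteq> C" "\<And>y. y \<in> K \<Longrightarrow> p (g y) = f y"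
    using GF \<delta> by (auto simp: g_def F_def)
  moreover have "g a = z"
  proof -
    have a: "a \<in> ball a (\<delta> a) \<inter> K" using K \<delta> by auto
    have "G a (a, 1) = G a (a, 0)"
      by (rule covering_space_lift_const[OF cov, of "{0..1}" "\<lambda>r. G a (a, r)" "f a"])
         (use contGy[OF K(2) a] GF[OF K(2) a] in \<open>auto simp: F_def\<close>)
    then show ?thesis using G0[OF K(2) a] by (simp add: g_def)
  qed
  ultimately show thesis using that by blast
qed

text \<open>Lift the homotopy to the square. One side of it is the lift h; on the other three sides
  the homotopy is constantly d, so the lift is constant there, and going round them joins h 0 to h
  1.\<close>

lemma covering_space_null_loop_lift:
  fixes p :: "'a::real_normed_vector \<Rightarrow> 'b::topological_space"
  assumes cov: "covering_space C p S" and hom: "homotopic_paths S g (\<lambda>_. d)"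
    and h: "continuous_on {0..1} h" "h ` {0..1} \<subseteq> C" "\<And>t. t \<in> {0..1} \<Longrightarrow> p (h t) = g t"
  shows "h 0 = h 1"
proof -
  obtain H :: "real \<times> real \<Rightarrow> 'b" where H: "continuous_on ({0..1} \<times> {0..1}) H" "H ` ({0..1} \<times> {0..1}) \<subseteq> S"
    "\<And>t. t \<in> {0..1} \<Longrightarrow> H (0, t) = g t" "\<And>t. t \<in> {0..1} \<Longrightarrow> H (1, t) = d"
    "\<And>s. s \<in> {0..1} \<Longrightarrow> H (s, 0) = g 0" "\<And>s. s \<in> {0..1} \<Longrightarrow> H (s, 1) = g 1"
  proof -
    obtain H :: "real \<times> real \<Rightarrow> 'b" where "continuous_on ({0..1} \<times> {0..1}) H" "H \<in> {0..1} \<times> {0..1} \<rightarrow> S"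
      "\<forall>t\<in>{0..1}. H (0, t) = g t" "\<forall>t\<in>{0..1}. H (1, t) = d"
      "\<forall>s\<in>{0..1}. pathstart (H \<circ> Pair s) = pathstart g \<and> pathfinish (H \<circ> Pair s) = pathfinish g"
      using hom unfolding homotopic_paths by (elim exE conjE) (rule that; assumption)
    then show thesis using that[of H] by (simp add: pathstart_def pathfinish_def image_subset_iff Pi_iff)
  qed
  have "g 0 = d" "g 1 = d" using H(4-6)[of 1] H(4)[of 0] by auto
  obtain L where L: "continuous_on ({0..1} \<times> {0..1}) L" "L ` ({0..1} \<times> {0..1}) \<subseteq> C"
    "L (0, 0) = h 0" "\<And>w. w \<in> {0..1} \<times> {0..1} \<Longrightarrow> p (L w) = H w"
    by (rule covering_space_lift_convex[OF cov _ _ H(1,2), of "(0, 0)" "h 0"])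
       (use H(3) h(2,3) in \<open>auto simp: convex_Times\<close>)
  have cont: "continuous_on {0..1} (\<lambda>t. L (u t))"
    if "continuous_on {0..1} u" "u ` {0..1} \<subseteq> {0..1} \<times> {0..1}" for u :: "real \<Rightarrow> real \<times> real"
    by (rule continuous_on_compose2[OF L(1)]) (use that in auto)
  have "L (0, 1) = h 1"
  proof (rule covering_space_lift_unique[OF cov, of "\<lambda>t. L (0, t)" 0 h "{0..1}" g])
    have "continuous_on {0..1} (\<lambda>t. H (0, t))"
      by (rule continuous_on_compose2[OF H(1)]) (auto intro!: continuous_intros)
    then show "continuous_on {0..1} g" by (rule continuous_on_eq) (use H(3) in auto)
    show "g \<in> {0..1} \<rightarrow> S" using H(2,3) by (force simp flip: H(3))
    show "continuous_on {0..1} (\<lambda>t. L (0, t))"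
      by (rule cont) (auto intro!: continuous_intros)
  qed (use L h H(3) in auto)
  moreover have "L (0, 0) = L (1, 0)"
    by (rule covering_space_lift_const[OF cov, of "{0..1}" "\<lambda>s. L (s, 0)" d])
       (use L(2,4) H(5) \<open>g 0 = d\<close> in \<open>simp_all add: cont continuous_on_Pair image_subset_iff\<close>)
  moreover have "L (1, 0) = L (1, 1)"
    by (rule covering_space_lift_const[OF cov, of "{0..1}" "\<lambda>s. L (1, s)" d])
       (use L(2,4) H(4) in \<open>simp_all add: cont continuous_on_Pair image_subset_iff\<close>)
  moreover have "L (1, 1) = L (0, 1)"
    by (rule covering_space_lift_const[OF cov, of "{0..1}" "\<lambda>s. L (s, 1)" d])
       (use L(2,4) H(6) \<open>g 1 = d\<close> in \<open>simp_all add: cont continuous_on_Pair image_subset_iff\<close>)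
  ultimately show ?thesis using L(3) by simp
qed

section \<open>Isometries of the model planes\<close>

text \<open>The metric of the model plane at z is the euclidean metric divided by this
  number.\<close>

fun scale_factor :: "geometry \<Rightarrow> complex \<Rightarrow> real" where
  "scale_factor Euclidean z = 1"
| "scale_factor Hyperbolic z = Im z"

lemma scale_factor_pos: "z \<in> plane G \<Longrightarrow> 0 < scale_factor G z"
  by (cases G) auto

lemma continuous_scale_factor [continuous_intros]:
  "continuous F f \<Longrightarrow> continuous F (\<lambda>x. scale_factor G (f x))"
  by (cases G) (auto intro: continuous_intros)

lemma open_plane: "open (plane G)"
  by (cases G) (auto simp: open_halfspace_Im_gt)

lemma convex_plane: "convex (plane G)"
  by (cases G) (auto simp: convex_halfspace_Im_gt)

text \<open>In both planes the distance is an injective function of |z - w|^2 divided by the product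
  of the scale factors. Clearing denominators gives one algebraic identity for both
  geometries.\<close>

lemma plane_dist_eq_iff:
  assumes "z \<in> plane G" "w \<in> plane G" "z' \<in> plane G" "w' \<in> plane G"
  shows "plane_dist G z' w' = plane_dist G z w \<longleftrightarrow>
    (dist z' w')\<^sup>2 * (scale_factor G z * scale_factor G w) =
    (dist z w)\<^sup>2 * (scale_factor G z' * scale_factor G w')"
proof (cases G)
  case Euclidean
  then show ?thesis by (simp add: power2_eq_iff_nonneg)
next
  case Hyperbolic
  define q where "q u v = 1 + (dist u v)\<^sup>2 / (2 * Im u * Im v)" for u v
  have "1 \<le> q z w" "1 \<le> q z' w'" using assms Hyperbolic by (auto simp: q_def)
  then have "arcosh (q z' w') = arcosh (q z w) \<longleftrightarrow> q z' w' = q z w"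
    by (metis cosh_arcosh_real)
  then show ?thesis using assms Hyperbolic by (auto simp: q_def field_simps)
qed

lemma plane_isometry_in: "plane_isometry G f \<Longrightarrow> z \<in> plane G \<Longrightarrow> f z \<in> plane G"
  by (auto simp: plane_isometry_def bij_betw_def)

lemma plane_isometry_scale:
  assumes "plane_isometry G f" "z \<in> plane G" "w \<in> plane G"
  shows "(dist (f z) (f w))\<^sup>2 * (scale_factor G z * scale_factor G w) =
    (dist z w)\<^sup>2 * (scale_factor G (f z) * scale_factor G (f w))"
  using plane_dist_eq_iff[of z G w "f z" "f w"] assms plane_isometry_in
  unfolding plane_isometry_def by blast

lemma plane_isometryI:
  assumes "bij_betw f (plane G) (plane G)"
    and "\<And>z w. z \<in> plane G \<Longrightarrow> w \<in> plane G \<Longrightarrow>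
      (dist (f z) (f w))\<^sup>2 * (scale_factor G z * scale_factor G w) =
      (dist z w)\<^sup>2 * (scale_factor G (f z) * scale_factor G (f w))"
  shows "plane_isometry G f"
  using assms plane_dist_eq_iff unfolding plane_isometry_def by (metis bij_betwE)

lemma plane_isometry_compose:
  assumes "plane_isometry G f" "plane_isometry G g"
  shows "plane_isometry G (\<lambda>z. f (g z))"
  using assms bij_betw_trans[of g "plane G" "plane G" f "plane G"]
  unfolding plane_isometry_def o_def by (metis bij_betwE)

lemma plane_isometry_inv:
  assumes "plane_isometry G f"
  shows "plane_isometry G (the_inv_into (plane G) f)"
proof -
  have bij: "bij_betw f (plane G) (plane G)" using assms by (simp add: plane_isometry_def)
  let ?g = "the_inv_into (plane G) f"
  have "plane_dist G (?g z) (?g w) = plane_dist G z w" if "z \<in> plane G" "w \<in> plane G" for z w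
    using assms that bij_betw_the_inv_into[OF bij] f_the_inv_into_f_bij_betw[OF bij]
    unfolding plane_isometry_def by (metis bij_betwE)
  then show ?thesis using bij_betw_the_inv_into[OF bij] by (simp add: plane_isometry_def)
qed

text \<open>The columns of D are orthogonal and both of squared length k, so the determinant is k or
  -k, and positivity leaves k. Then (c + b)^2 + (d - a)^2 = 2 k - 2 k = 0, which gives the
  Cauchy-Riemann equations.\<close>

lemma linear_similarity_complex:
  fixes D :: "complex \<Rightarrow> complex"
  assumes lin: "bounded_linear D" and sim: "\<And>v. (cmod (D v))\<^sup>2 = k * (cmod v)\<^sup>2"
    and pos: "0 < oriented_area (D 1) (D \<i>)"
  shows "D v = D 1 * v"
proof -
  have add: "D (u + w) = D u + D w" and sc: "D (r *\<^sub>R u) = r *\<^sub>R D u" for u w r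
    using lin by (simp_all add: bounded_linear.linear linear_add linear_cmul)
  define a b c d where "a = Re (D 1)" and "b = Im (D 1)" and "c = Re (D \<i>)" and "d = Im (D \<i>)"
  have 1: "a\<^sup>2 + b\<^sup>2 = k" and 2: "c\<^sup>2 + d\<^sup>2 = k"
    using sim[of 1] sim[of \<i>] by (simp_all add: cmod_power2 a_def b_def c_def d_def)
  have "(a + c)\<^sup>2 + (b + d)\<^sup>2 = k * 2"
    using sim[of "1 + \<i>"] by (simp add: cmod_power2 add a_def b_def c_def d_def)
  then have 3: "a * c + b * d = 0" using 1 2 by (simp add: power2_sum)
  have "(a * d - b * c)\<^sup>2 + (a * c + b * d)\<^sup>2 = (a\<^sup>2 + b\<^sup>2) * (c\<^sup>2 + d\<^sup>2)"
    by (simp add: power2_eq_square algebra_simps)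
  then have "(a * d - b * c)\<^sup>2 = k\<^sup>2" using 1 2 3 by (simp add: power2_eq_square)
  moreover have "a * d - b * c > 0" using pos by (simp add: oriented_area_def a_def b_def c_def d_def)
  moreover have "k \<ge> 0" using 1 by (metis sum_power2_ge_zero)
  ultimately have 4: "a * d - b * c = k" by (metis less_imp_le power2_eq_imp_eq)
  have "(c + b)\<^sup>2 + (d - a)\<^sup>2 = (a\<^sup>2 + b\<^sup>2) + (c\<^sup>2 + d\<^sup>2) - 2 * (a * d - b * c)"
    by (simp add: power2_eq_square algebra_simps)
  then have "(c + b)\<^sup>2 + (d - a)\<^sup>2 = 0" using 1 2 4 by simp
  then have "c = - b" "d = a" by (auto simp: sum_power2_eq_zero_iff)
  then have Di: "D \<i> = \<i> * D 1" by (simp add: complex_eq_iff a_def b_def c_def d_def)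
  have "v = Re v *\<^sub>R 1 + Im v *\<^sub>R \<i>" by (simp add: complex_eq_iff)
  then have "D v = Re v *\<^sub>R D 1 + Im v *\<^sub>R D \<i>" by (metis add sc)
  then show ?thesis by (simp add: Di complex_eq_iff)
qed

lemma has_vector_derivative_imp_quotient_tendsto:
  fixes f :: "real \<Rightarrow> 'a::real_normed_vector"
  assumes "(f has_vector_derivative D) (at x)"
  shows "((\<lambda>t. (f t - f x) /\<^sub>R (t - x)) \<longlongrightarrow> D) (at x)"
proof -
  have "((\<lambda>t. ((f t - f x) - (t - x) *\<^sub>R D) /\<^sub>R norm (t - x)) \<longlongrightarrow> 0) (at x)"
    using assms unfolding has_vector_derivative_def has_derivative_at_within by simp
  then have "((\<lambda>t. norm (((f t - f x) - (t - x) *\<^sub>R D) /\<^sub>R norm (t - x))) \<longlongrightarrow> 0) (at x)"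
    by (rule tendsto_norm_zero)
  then have "((\<lambda>t. norm ((f t - f x) /\<^sub>R (t - x) - D)) \<longlongrightarrow> 0) (at x)"
  proof (rule Lim_transform_eventually)
    have "norm (((f t - f x) - (t - x) *\<^sub>R D) /\<^sub>R norm (t - x)) = norm ((f t - f x) /\<^sub>R (t - x) - D)"
      if "t \<noteq> x" for t
    proof -
      have "((f t - f x) /\<^sub>R (t - x) - D) = ((f t - f x) - (t - x) *\<^sub>R D) /\<^sub>R (t - x)"
        using that by (simp add: scaleR_diff_right)
      then show ?thesis by simp
    qed
    then show "\<forall>\<^sub>F t in at x. norm (((f t - f x) - (t - x) *\<^sub>R D) /\<^sub>R norm (t - x)) =
                 norm ((f t - f x) /\<^sub>R (t - x) - D)"
      by (simp add: eventually_at_filter)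
  qed
  then show ?thesis using Lim_null tendsto_norm_zero_iff by blast
qed

text \<open>Apply the isometry identity to z and z + t v, divide by t^2 and let t tend to 0: the
  real derivative multiplies all lengths by the quotient of the scale factors. Being orientation
  preserving as well, it is complex linear.\<close>

lemma oriented_isometry_derivative:
  assumes f: "oriented_isometry G f" and z: "z \<in> plane G"
  obtains a where "(f has_field_derivative a) (at z)" "a \<noteq> 0"
    "cmod a = scale_factor G (f z) / scale_factor G z"
proof -
  have iso: "plane_isometry G f" using f by (simp add: oriented_isometry_def)
  obtain D where D: "(f has_derivative D) (at z)" "0 < oriented_area (D 1) (D \<i>)"
    using f z unfolding oriented_isometry_def by blast
  define k where "k = scale_factor G (f z) / scale_factor G z"
  have pos: "0 < scale_factor G z" "0 < scale_factor G (f z)"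
    using scale_factor_pos z plane_isometry_in[OF iso z] by auto
  have sim: "(cmod (D v))\<^sup>2 = k\<^sup>2 * (cmod v)\<^sup>2" for v
  proof -
    define u where "u t = z + of_real t * v" for t :: real
    have u: "(u has_vector_derivative v) (at 0)" unfolding u_def
      by (auto intro!: derivative_eq_intros)
    have u0: "u 0 = z" by (simp add: u_def)
    have "((\<lambda>t. f (u t)) has_derivative (\<lambda>t. D (t *\<^sub>R v))) (at 0)"
      using has_derivative_compose[of u "\<lambda>t. t *\<^sub>R v" 0 UNIV f D] u D(1) u0
      by (simp add: has_vector_derivative_def)
    moreover have "D (t *\<^sub>R v) = t *\<^sub>R D v" for t
      using D(1) by (simp add: has_derivative_linear linear_cmul)
    ultimately have fu: "((\<lambda>t. f (u t)) has_vector_derivative D v) (at 0)"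
      by (simp add: has_vector_derivative_def)
    have contu: "isCont u 0" "isCont (\<lambda>t. f (u t)) 0"
      using u fu by (auto intro: has_vector_derivative_continuous)
    define l where "l t = (cmod ((f (u t) - f z) /\<^sub>R t))\<^sup>2 * (scale_factor G z * scale_factor G (u t))" for t
    define r where "r t = (cmod v)\<^sup>2 * (scale_factor G (f z) * scale_factor G (f (u t)))" for t
    have lim1: "(l \<longlongrightarrow>
            (cmod (D v))\<^sup>2 * (scale_factor G z * scale_factor G z)) (at 0)"
      unfolding l_def using has_vector_derivative_imp_quotient_tendsto[OF fu]
        continuous_scale_factor[OF contu(1), of G] u0
      by (intro tendsto_intros) (auto simp: isCont_def)
    have lim2: "(r \<longlongrightarrow>
            (cmod v)\<^sup>2 * (scale_factor G (f z) * scale_factor G (f z))) (at 0)"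
      unfolding r_def using continuous_scale_factor[OF contu(2), of G] u0
      by (intro tendsto_intros) (auto simp: isCont_def)
    have ev: "\<forall>\<^sub>F t in at 0. l t = r t"
    proof -
      have "\<forall>\<^sub>F t in at 0. u t \<in> plane G"
        using topological_tendstoD[of u "u 0" "at 0" "plane G"] contu(1) z u0 open_plane
        by (simp add: isCont_def)
      then have "\<forall>\<^sub>F t in at 0. u t \<in> plane G \<and> t \<noteq> 0"
        by (simp add: eventually_at_filter eventually_conj_iff)
      then show ?thesis
      proof (rule eventually_mono)
        fix t assume t: "u t \<in> plane G \<and> t \<noteq> 0"
        have "dist z (u t) = \<bar>t\<bar> * cmod v" by (simp add: u_def dist_norm norm_mult)
        then have "(cmod (f (u t) - f z))\<^sup>2 * (scale_factor G z * scale_factor G (u t)) =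
            (t * cmod v)\<^sup>2 * (scale_factor G (f z) * scale_factor G (f (u t)))"
          using plane_isometry_scale[OF iso z, of "u t"] t
          by (simp add: dist_norm norm_minus_commute power_mult_distrib)
        moreover have "(cmod ((f (u t) - f z) /\<^sub>R t))\<^sup>2 * t\<^sup>2 = (cmod (f (u t) - f z))\<^sup>2"
          using t by (simp add: power_mult_distrib power_inverse)
        moreover have "t\<^sup>2 * (Q * S) = t\<^sup>2 * (V * R)" if "N * S = t\<^sup>2 * V * R" "Q * t\<^sup>2 = N" for N S V R Q :: real
          using that by (metis mult.assoc mult.commute)
        ultimately have "t\<^sup>2 * l t = t\<^sup>2 * r t"
          unfolding l_def r_def by (simp only: power_mult_distrib)
        then show "l t = r t" using t by simp
      qed
    qed
    have "(cmod (D v))\<^sup>2 * (scale_factor G z * scale_factor G z) =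
        (cmod v)\<^sup>2 * (scale_factor G (f z) * scale_factor G (f z))"
      by (rule tendsto_unique[OF trivial_limit_at Lim_transform_eventually[OF lim1 ev] lim2])
    then show ?thesis using pos by (simp add: k_def field_simps power2_eq_square)
  qed
  have Dv: "D v = D 1 * v" for v
    by (rule linear_similarity_complex[OF _ sim D(2)]) (rule has_derivative_bounded_linear[OF D(1)])
  then have "(f has_field_derivative D 1) (at z)"
    unfolding has_field_derivative_def by (intro has_derivative_eq_rhs[OF D(1)] ext)
  moreover have norm: "cmod (D 1) = k"
    using sim[of 1] pos power2_eq_imp_eq[of "cmod (D 1)" k] by (simp add: k_def)
  moreover have "D 1 \<noteq> 0" using norm pos by (auto simp: k_def)
  ultimately show thesis using that by (simp add: k_def)
qed

lemma oriented_isometry_holomorphic: "oriented_isometry G f \<Longrightarrow> f holomorphic_on plane G"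
  by (rule holomorphic_onI) (metis oriented_isometry_derivative field_differentiable_def
      field_differentiable_at_within)

lemma oriented_isometry_inverse:
  assumes "oriented_isometry G f"
  obtains k where "k holomorphic_on plane G"
    and "\<And>z. z \<in> plane G \<Longrightarrow> deriv f z * deriv k (f z) = 1"
    and "\<And>z. z \<in> plane G \<Longrightarrow> k (f z) = z"
proof -
  have f: "inj_on f (plane G)" "f ` plane G = plane G"
    using assms by (auto simp: oriented_isometry_def plane_isometry_def bij_betw_def)
  obtain k where k: "k holomorphic_on (f ` plane G)"
    "\<And>z. z \<in> plane G \<Longrightarrow> deriv f z * deriv k (f z) = 1" "\<And>z. z \<in> plane G \<Longrightarrow> k (f z) = z"
    using holomorphic_has_inverse[OF oriented_isometry_holomorphic[OF assms] open_plane f(1)] by blast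
  show thesis
    by (rule that[OF k(1)[unfolded f(2)] k(2,3)])
qed

section \<open>Charts and the derivative of deck transformations\<close>

lemma charts_cover:
  assumes "geometric_surface G M A" and "x \<in> M"
  obtains U c where "(U, c) \<in> A" "x \<in> U"
proof -
  have "(\<Union>(U, c)\<in>A. U) = M" using assms(1) unfolding geometric_surface_def by (elim conjE)
  then show thesis using assms(2) that by blast
qed

lemma universal_covering_chart:
  assumes "universal_covering G M A p" "(U, c) \<in> A" "z \<in> plane G" "p z \<in> U"
  obtains g where "oriented_isometry G g" "\<forall>\<^sub>F w in nhds z. c (p w) = g w"
proof -
  have "\<forall>z\<in>plane G. \<forall>(U, c)\<in>A. p z \<in> U \<longrightarrow>
        (\<exists>g. oriented_isometry G g \<and> (\<forall>\<^sub>F w in nhds z. c (p w) = g w))"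
    using assms(1) unfolding universal_covering_def by (elim conjE)
  then show thesis using assms(2-4) that by blast
qed

lemma deck_transformation_in:
  "deck_transformation G p T \<Longrightarrow> z \<in> plane G \<Longrightarrow> T z \<in> plane G"
  unfolding deck_transformation_def homeomorphism_def by blast

text \<open>By definition T is just a homeomorphism over p. In a chart around p z = p (T z), p is an
  oriented isometry g1 near z and g2 near T z, so locally T is the inverse of g2 after g1. The scale
  factors at g1 z = g2 (T z) cancel.\<close>

lemma deck_transformation_derivative:
  assumes M: "geometric_surface G M A" and p: "universal_covering G M A p"
    and T: "deck_transformation G p T" and z: "z \<in> plane G"
  obtains a where "(T has_field_derivative a) (at z)" "a \<noteq> 0"
    "cmod a = scale_factor G (T z) / scale_factor G z"
proof -
  have Tz: "T z \<in> plane G" using deck_transformation_in[OF T z] .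
  have "p z \<in> M" using p z by (auto simp: universal_covering_def covering_space_def)
  then obtain U c where U: "(U, c) \<in> A" "p z \<in> U" using charts_cover[OF M] by blast
  have pT: "p (T z) = p z" using T z by (simp add: deck_transformation_def)
  obtain g1 where g1: "oriented_isometry G g1" "\<forall>\<^sub>F w in nhds z. c (p w) = g1 w"
    using universal_covering_chart[OF p U(1) z U(2)] by blast
  obtain g2 where g2: "oriented_isometry G g2" "\<forall>\<^sub>F w in nhds (T z). c (p w) = g2 w"
    using universal_covering_chart[OF p U(1) Tz] U(2) pT by metis
  obtain k where k: "k holomorphic_on plane G"
    "\<And>z. z \<in> plane G \<Longrightarrow> deriv g2 z * deriv k (g2 z) = 1"
    "\<And>z. z \<in> plane G \<Longrightarrow> k (g2 z) = z"
    using oriented_isometry_inverse[OF g2(1)] by metis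
  have "continuous_on (plane G) T" using T by (auto simp: deck_transformation_def homeomorphism_def)
  then have "isCont T z" using z open_plane continuous_on_eq_continuous_at by blast
  then have "\<forall>\<^sub>F w in nhds z. c (p (T w)) = g2 (T w)"
    using g2(2) unfolding isCont_def tendsto_at_iff_tendsto_nhds
    by (rule eventually_compose_filterlim[rotated])
  moreover have "\<forall>\<^sub>F w in nhds z. w \<in> plane G" using z open_plane eventually_nhds_in_open by blast
  ultimately have ev: "\<forall>\<^sub>F w in nhds z. T w = k (g1 w)" using g1(2)
  proof eventually_elim
    case (elim w)
    then have "p (T w) = p w" using T by (simp add: deck_transformation_def)
    then show ?case using elim k(3) deck_transformation_in[OF T] by metis
  qed
  have gz: "g1 z = g2 (T z)"
    using eventually_nhds_x_imp_x[OF g1(2)] eventually_nhds_x_imp_x[OF g2(2)] pT by simp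
  obtain a1 where a1: "(g1 has_field_derivative a1) (at z)" "a1 \<noteq> 0"
    "cmod a1 = scale_factor G (g1 z) / scale_factor G z"
    using oriented_isometry_derivative[OF g1(1) z] by blast
  obtain a2 where a2: "(g2 has_field_derivative a2) (at (T z))" "a2 \<noteq> 0"
    "cmod a2 = scale_factor G (g2 (T z)) / scale_factor G (T z)"
    using oriented_isometry_derivative[OF g2(1) Tz] by blast
  have iso: "plane_isometry G g1" using g1(1) by (simp add: oriented_isometry_def)
  have "(k has_field_derivative deriv k (g1 z)) (at (g1 z))"
    using k(1) open_plane plane_isometry_in[OF iso z] holomorphic_derivI by blast
  then have "((\<lambda>w. k (g1 w)) has_field_derivative deriv k (g1 z) * a1) (at z)"
    using DERIV_chain2 a1(1) by blast
  then have 1: "(T has_field_derivative deriv k (g1 z) * a1) (at z)"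
    using DERIV_cong_ev[OF refl ev refl] by blast
  have dk: "a2 * deriv k (g1 z) = 1"
    using k(2)[OF Tz] DERIV_imp_deriv[OF a2(1)] gz by simp
  then have "cmod (deriv k (g1 z)) = 1 / cmod a2" using a2(2)
    by (metis nonzero_eq_divide_eq norm_eq_zero norm_mult norm_one mult.commute)
  then have "cmod (deriv k (g1 z) * a1) = scale_factor G (T z) / scale_factor G z"
    using a1(3) a2(3) gz scale_factor_pos[OF z] scale_factor_pos[OF Tz]
      scale_factor_pos[OF plane_isometry_in[OF iso z]] by (simp add: norm_mult)
  moreover have "deriv k (g1 z) * a1 \<noteq> 0" using dk a1(2) by auto
  ultimately show thesis using that 1 by blast
qed

section \<open>Isometries without fixed points\<close>

text \<open>The derivative is entire and bounded, hence a constant a by Liouville, and a \<noteq> 1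
  would give the fixed point b / (1 - a).\<close>

lemma euclidean_isometry_translation:
  fixes T :: "complex \<Rightarrow> complex"
  assumes T: "\<And>z. \<exists>a. (T has_field_derivative a) (at z) \<and> cmod a = 1" and fpf: "\<And>z. T z \<noteq> z"
  obtains b where "b \<noteq> 0" "\<And>z. T z = z + b"
proof -
  have hol: "T holomorphic_on UNIV"
    using T by (metis holomorphic_onI field_differentiable_def field_differentiable_at_within)
  have "cmod (deriv T z) = 1" for z using T DERIV_imp_deriv by metis
  then have "bounded (range (deriv T))" by (auto simp: bounded_iff)
  then have "deriv T constant_on UNIV"
    using Liouville_theorem holomorphic_deriv[OF hol] by blast
  then obtain a where a: "\<And>z. deriv T z = a" by (auto simp: constant_on_def)
  have "\<exists>b. \<forall>z\<in>UNIV. T z - a * z = b"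
  proof (rule has_field_derivative_zero_constant)
    fix z
    have "(T has_field_derivative a) (at z)"
      using holomorphic_derivI[OF hol, of z] a by simp
    then show "((\<lambda>z. T z - a * z) has_field_derivative 0) (at z)"
      by (auto intro!: derivative_eq_intros)
  qed simp
  then obtain b where b: "\<And>z. T z = a * z + b" by (metis UNIV_I add.commute diff_add_cancel)
  have "a = 1"
  proof (rule ccontr)
    assume "a \<noteq> 1"
    then have "T (b / (1 - a)) = b / (1 - a)" unfolding b by (simp add: field_simps)
    then show False using fpf by blast
  qed
  moreover have "b \<noteq> 0" using b[of 0] fpf[of 0] by simp
  ultimately show thesis using that b by simp
qed

text \<open>Conjugating by Cayley transforms turns such a map into a self-map of the disc that fixes the centre
  and has derivative of modulus 1 there: by the Schwarz lemma it is a rotation.\<close>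

lemma hyperbolic_isometry_moebius:
  fixes T :: "complex \<Rightarrow> complex"
  assumes T: "\<And>z. 0 < Im z \<Longrightarrow> 0 < Im (T z) \<and>
      (\<exists>a. (T has_field_derivative a) (at z) \<and> cmod a = Im (T z) / Im z)"
  obtains x y c s :: real where "0 < y" "c\<^sup>2 + s\<^sup>2 = 1"
    "\<And>z. 0 < Im z \<Longrightarrow> T z = of_real x + of_real y * (of_real c * z + of_real s) / (of_real c - of_real s * z)"
    "\<And>z. 0 < Im z \<Longrightarrow> of_real c - of_real s * z \<noteq> 0"
proof -
  \<comment> \<open>z -> (z - x) / y carries T i back to i, so after this correction the map fixes
    i, the point that the Cayley transform C sends to 0; K is the inverse of C.\<close>
  define x y where "x = Re (T \<i>)" and "y = Im (T \<i>)"
  have y: "y > 0" using T[of \<i>] by (simp add: y_def)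
  define C where "C z = (z - \<i>) / (z + \<i>)" for z
  define K where "K \<zeta> = \<i> * (1 + \<zeta>) / (1 - \<zeta>)" for \<zeta>
  have normC: "cmod (C z) < 1 \<longleftrightarrow> 0 < Im z" if "z \<noteq> - \<i>" for z
  proof -
    have "z + \<i> \<noteq> 0" using that by (simp add: add_eq_0_iff2)
    then have "cmod (C z) < 1 \<longleftrightarrow> cmod (z - \<i>) < cmod (z + \<i>)"
      by (simp add: C_def norm_divide)
    also have "\<dots> \<longleftrightarrow> (cmod (z - \<i>))\<^sup>2 < (cmod (z + \<i>))\<^sup>2"
      by (meson norm_ge_zero pos2 power2_less_imp_less power_strict_mono)
    also have "\<dots> \<longleftrightarrow> 0 < Im z" unfolding cmod_power2 by (simp add: power2_eq_square algebra_simps)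
    finally show ?thesis .
  qed
  have CK: "C (K \<zeta>) = \<zeta>" "K \<zeta> \<noteq> - \<i>" if "\<zeta> \<noteq> 1" for \<zeta>
  proof -
    have 1: "K \<zeta> + \<i> = 2 * \<i> / (1 - \<zeta>)" "K \<zeta> - \<i> = 2 * \<i> * \<zeta> / (1 - \<zeta>)"
      using that by (simp_all add: K_def field_simps)
    then show "C (K \<zeta>) = \<zeta>" using that by (simp add: C_def)
    have "K \<zeta> + \<i> \<noteq> 0" using 1 that by simp
    then show "K \<zeta> \<noteq> - \<i>" by auto
  qed
  have K: "0 < Im (K \<zeta>)" if "cmod \<zeta> < 1" for \<zeta>
  proof -
    have "\<zeta> \<noteq> 1" using that by auto
    then show ?thesis using normC[of "K \<zeta>"] CK[of \<zeta>] that by simp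
  qed
  have KC: "K (C z) = z" if "0 < Im z" for z
  proof -
    have "z + \<i> \<noteq> 0" using that by (auto simp: complex_eq_iff)
    then have "1 + C z = 2 * z / (z + \<i>)" "1 - C z = 2 * \<i> / (z + \<i>)"
      by (simp_all add: C_def field_simps)
    then show ?thesis using \<open>z + \<i> \<noteq> 0\<close> by (simp add: K_def)
  qed
  define f where "f \<zeta> = C ((T (K \<zeta>) - of_real x) / of_real y)" for \<zeta>
  define D where "D \<zeta> = deriv T (K \<zeta>)" for \<zeta>
  have Im_arg: "0 < Im ((T z - of_real x) / of_real y)" if "0 < Im z" for z
    using T[OF that] y by simp
  have df: "(f has_field_derivative
      2 * \<i> / ((T (K \<zeta>) - of_real x) / of_real y + \<i>)\<^sup>2 * (D \<zeta> * (2 * \<i> / (1 - \<zeta>)\<^sup>2) / of_real y)) (at \<zeta>)"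
    if "cmod \<zeta> < 1" for \<zeta>
  proof -
    have n1: "1 - \<zeta> \<noteq> 0" using that by auto
    have dK: "(K has_field_derivative 2 * \<i> / (1 - \<zeta>)\<^sup>2) (at \<zeta>)"
      unfolding K_def using n1
      by (auto intro!: derivative_eq_intros simp: field_simps power2_eq_square)
    have dT: "(T has_field_derivative D \<zeta>) (at (K \<zeta>))"
      using T[OF K[OF that]] DERIV_imp_deriv unfolding D_def by metis
    have dC: "(C has_field_derivative 2 * \<i> / (z + \<i>)\<^sup>2) (at z)" if "0 < Im z" for z
    proof -
      have "z + \<i> \<noteq> 0" using that by (auto simp: complex_eq_iff)
      then show ?thesis unfolding C_def
        by (auto intro!: derivative_eq_intros simp: field_simps power2_eq_square)
    qed
    have "((\<lambda>\<zeta>. (T (K \<zeta>) - of_real x) / of_real y) has_field_derivative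
        D \<zeta> * (2 * \<i> / (1 - \<zeta>)\<^sup>2) / of_real y) (at \<zeta>)"
      using y by (auto intro!: derivative_eq_intros DERIV_chain2[OF dT dK])
    then show ?thesis unfolding f_def
      by (intro DERIV_chain2[where f = C and g = "\<lambda>\<zeta>. (T (K \<zeta>) - of_real x) / of_real y"]
          dC[OF Im_arg[OF K[OF that]]])
  qed
  have K0: "K 0 = \<i>" by (simp add: K_def)
  have arg0: "(T (K 0) - of_real x) / of_real y = \<i>"
  proof -
    have "T \<i> - of_real x = of_real y * \<i>" by (rule complex_eqI) (simp_all add: x_def y_def)
    then show ?thesis using y unfolding K0 by (metis less_irrefl nonzero_mult_div_cancel_left of_real_eq_0_iff)
  qed
  have "\<exists>\<alpha>. (\<forall>z. norm z < 1 \<longrightarrow> f z = \<alpha> * z) \<and> norm \<alpha> = 1"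
  proof (rule Schwarz_Lemma(3)[where \<xi> = 0])
    show "f holomorphic_on ball 0 1"
    proof (rule holomorphic_onI)
      fix z :: complex assume "z \<in> ball 0 1"
      then have "cmod z < 1" by simp
      then show "f field_differentiable at z within ball 0 1"
        using df field_differentiable_at_within field_differentiable_def by blast
    qed
    show "f 0 = 0" using arg0 by (simp add: f_def C_def)
    show "norm (f z) < 1" if "norm z < 1" for z
    proof -
      have pos: "0 < Im ((T (K z) - of_real x) / of_real y)" by (rule Im_arg[OF K[OF that]])
      then have "(T (K z) - of_real x) / of_real y \<noteq> - \<i>" by (metis Im_i_times imaginary_unit.sel(2) less_asym' neg_less_0_iff_less uminus_complex.sel(2) zero_less_one)
      then show ?thesis unfolding f_def using normC pos by blast
    qed
    \<comment> \<open>The assumed modulus of the derivative at i is Im (T i) / Im i = y, which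
      cancels the division by y in f.\<close>
    have "cmod (D 0) = y" using T[of \<i>] DERIV_imp_deriv unfolding D_def K0 y_def
      by (metis div_by_1 imaginary_unit.sel(2) zero_less_one)
    moreover have "deriv f 0 = 2 * \<i> / (2 * \<i>)\<^sup>2 * (D 0 * (2 * \<i>) / of_real y)"
      using DERIV_imp_deriv[OF df[of 0]] unfolding arg0 by simp
    ultimately have "cmod (deriv f 0) = 1"
      using y by (simp add: norm_mult norm_divide norm_power power2_eq_square)
    then show "(\<exists>z. cmod z < 1 \<and> z \<noteq> 0 \<and> cmod (f z) = cmod z) \<or> cmod (deriv f 0) = 1" by simp
  qed (simp add: norm_zero[where 'a = complex])
  then obtain \<alpha> where \<alpha>: "\<And>z. norm z < 1 \<Longrightarrow> f z = \<alpha> * z" "norm \<alpha> = 1" by blast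
  \<comment> \<open>The rotation of the disc by \<alpha> corresponds to the Moebius map of the
    half-plane with rows (c, s) and (-s, c), a rotation matrix for half the angle. Its entries are
    therefore the parts of a square root of \<alpha>.\<close>
  define \<beta> where "\<beta> = csqrt \<alpha>"
  have \<beta>: "\<beta> * \<beta> = \<alpha>" by (metis \<beta>_def power2_csqrt power2_eq_square)
  then have "(cmod \<beta>)\<^sup>2 = 1" using \<alpha>(2) by (simp add: power2_eq_square flip: norm_mult)
  define c s where "c = Re \<beta>" and "s = Im \<beta>"
  have cs: "c\<^sup>2 + s\<^sup>2 = 1" using \<open>(cmod \<beta>)\<^sup>2 = 1\<close> by (simp add: cmod_power2 c_def s_def)
  have nz: "of_real c - of_real s * z \<noteq> 0" if "0 < Im z" for z
  proof
    assume *: "of_real c - of_real s * z = 0"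
    then have "s * Im z = 0" by (auto simp: complex_eq_iff)
    then have "s = 0" "c = 0" using that * by auto
    then show False using cs by simp
  qed
  have "T z = of_real x + of_real y * (of_real c * z + of_real s) / (of_real c - of_real s * z)" if z: "0 < Im z" for z
  proof -
    define u where "u = (T z - of_real x) / of_real y"
    have u: "0 < Im u" using Im_arg[OF z] by (simp add: u_def)
    have "z \<noteq> - \<i>" "u + \<i> \<noteq> 0" "z + \<i> \<noteq> 0" using z u by (auto simp: complex_eq_iff)
    then have "C u = \<alpha> * C z"
      using \<alpha>(1)[of "C z"] normC[of z] z KC[OF z] by (simp add: f_def u_def)
    then have "(u - \<i>) * (z + \<i>) = \<alpha> * ((z - \<i>) * (u + \<i>))"
      using \<open>u + \<i> \<noteq> 0\<close> \<open>z + \<i> \<noteq> 0\<close> by (simp add: C_def field_simps)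
    then have "cnj \<beta> * ((u - \<i>) * (z + \<i>)) = cnj \<beta> * \<beta> * (\<beta> * ((z - \<i>) * (u + \<i>)))"
      using \<beta> by (simp add: mult.assoc)
    moreover have "cnj \<beta> * \<beta> = 1" using \<open>(cmod \<beta>)\<^sup>2 = 1\<close>
      using complex_norm_square[of \<beta>] by (simp add: mult.commute flip: of_real_power)
    moreover have "\<beta> = c + \<i> * s" "cnj \<beta> = c - \<i> * s" by (simp_all add: complex_eq_iff c_def s_def)
    ultimately have "(c - \<i> * s) * ((u - \<i>) * (z + \<i>)) = (c + \<i> * s) * ((z - \<i>) * (u + \<i>))" 
      by (metis mult.assoc mult_1)
    then have "2 * \<i> * (u * (of_real c - of_real s * z)) = 2 * \<i> * (of_real c * z + of_real s)"
      by (simp add: algebra_simps)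
    then have "u * (of_real c - of_real s * z) = of_real c * z + of_real s" by simp
    then have "u = (of_real c * z + of_real s) / (of_real c - of_real s * z)" using nz[OF z] by (simp add: eq_divide_eq)
    moreover have "T z = x + y * u" using y by (simp add: u_def)
    ultimately show ?thesis by simp
  qed
  then show thesis using that[OF y cs] nz by blast
qed

section \<open>Explicit isometries of the half-plane, and those commuting with a translation or a
  scaling\<close>

lemma hyperbolic_isometry_translation: "plane_isometry Hyperbolic (\<lambda>z. z + of_real e)"
proof (rule plane_isometryI)
  show "bij_betw (\<lambda>z. z + of_real e) (plane Hyperbolic) (plane Hyperbolic)"
    by (rule bij_betw_byWitness[where f' = "\<lambda>z. z - of_real e"]) auto
qed (simp add: dist_norm)

lemma hyperbolic_isometry_scaling:
  assumes "0 < \<alpha>"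
  shows "plane_isometry Hyperbolic (\<lambda>z. of_real \<alpha> * z)"
proof (rule plane_isometryI)
  show "bij_betw (\<lambda>z. of_real \<alpha> * z) (plane Hyperbolic) (plane Hyperbolic)"
    by (rule bij_betw_byWitness[where f' = "\<lambda>z. of_real (1 / \<alpha>) * z"]) (use assms in auto)
  show "(dist (of_real \<alpha> * z) (of_real \<alpha> * w))\<^sup>2 * (scale_factor Hyperbolic z * scale_factor Hyperbolic w) =
      (dist z w)\<^sup>2 * (scale_factor Hyperbolic (of_real \<alpha> * z) * scale_factor Hyperbolic (of_real \<alpha> * w))"
    for z w
    by (simp add: dist_norm norm_mult power_mult_distrib flip: right_diff_distrib)
      (simp add: power2_eq_square)
qed

lemma Im_reciprocal: "Im (1 / z) = - Im z / (cmod z)\<^sup>2"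
  by (simp add: Im_divide cmod_power2)

lemma hyperbolic_isometry_neg_inverse: "plane_isometry Hyperbolic (\<lambda>z. - 1 / z)"
proof (rule plane_isometryI)
  show "bij_betw (\<lambda>z. - 1 / z) (plane Hyperbolic) (plane Hyperbolic)"
    by (rule bij_betw_byWitness[where f' = "\<lambda>z. - 1 / z"])
       (auto simp: Im_reciprocal intro!: divide_pos_pos)
  fix z w assume "z \<in> plane Hyperbolic" "w \<in> plane Hyperbolic"
  then have nz: "z \<noteq> 0" "w \<noteq> 0" by auto
  then have "- 1 / z - - 1 / w = (z - w) / (z * w)" by (simp add: field_simps)
  then have "dist (- 1 / z) (- 1 / w) = dist z w / (cmod z * cmod w)"
    unfolding dist_norm by (metis norm_divide norm_mult)
  then show "(dist (- 1 / z) (- 1 / w))\<^sup>2 * (scale_factor Hyperbolic z * scale_factor Hyperbolic w) =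
      (dist z w)\<^sup>2 * (scale_factor Hyperbolic (- 1 / z) * scale_factor Hyperbolic (- 1 / w))"
    by (simp add: Im_reciprocal power_divide power_mult_distrib)
qed

text \<open>1, t and t^2 are three distinct roots of the polynomial with coefficients a, b,
  c.\<close>

lemma quadratic_coeffs_zero:
  fixes a b c t :: real
  assumes "a + b + c = 0" "a + b * t + c * t\<^sup>2 = 0" "a + b * t\<^sup>2 + c * (t\<^sup>2)\<^sup>2 = 0"
    and "t > 0" "t \<noteq> 1"
  shows "c = 0"
proof -
  have a: "a = - b - c" using assms(1) by simp
  have "(t - 1) * (b + c * (t + 1)) = 0"
    using assms(2) unfolding a by (simp add: algebra_simps power2_eq_square)
  then have 1: "b + c * (t + 1) = 0" using assms(5) by simp
  have "(t\<^sup>2 - 1) * (b + c * (t\<^sup>2 + 1)) = 0"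
    using assms(3) unfolding a by (simp add: algebra_simps power2_eq_square)
  moreover have "t\<^sup>2 \<noteq> 1" using assms(4,5) by (simp add: power2_eq_1_iff)
  ultimately have 2: "b + c * (t\<^sup>2 + 1) = 0" by simp
  have "c * (t * (t - 1)) = (b + c * (t\<^sup>2 + 1)) - (b + c * (t + 1))"
    by (simp add: algebra_simps power2_eq_square)
  then have "c * (t * (t - 1)) = 0" unfolding 1 2 by simp
  then show ?thesis using assms(4,5) by simp
qed

lemma cmod_diff_scaled:
  "(cmod (u - of_real t * v))\<^sup>2 = (cmod u)\<^sup>2 + (- 2 * (u \<bullet> v)) * t + (cmod v)\<^sup>2 * t\<^sup>2"
  unfolding cmod_power2 by (simp add: inner_complex_def power2_eq_square algebra_simps)

text \<open>Comparing the distances from \<open>z\<close> to \<open>t * w\<close> for \<open>t = 1, \<alpha>, \<alpha>\<^sup>2\<close> shows that the isometry is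
  \<open>z \<mapsto> \<mu> * z\<close> up to a reflection, which squaring removes.\<close>

lemma isometry_commuting_with_scaling:
  assumes F: "plane_isometry Hyperbolic F" and \<alpha>: "0 < \<alpha>" "\<alpha> \<noteq> 1"
    and comm: "\<And>z. 0 < Im z \<Longrightarrow> F (of_real \<alpha> * z) = of_real \<alpha> * F z"
  obtains \<mu> where "0 < \<mu>" "\<And>z. 0 < Im z \<Longrightarrow> F (F z) = of_real \<mu> * z"
proof -
  have pos: "0 < Im (F z)" if "0 < Im z" for z
    using plane_isometry_in[OF F, of z] that by simp
  have dist: "(cmod (F z - F w))\<^sup>2 * (Im z * Im w) = (cmod (z - w))\<^sup>2 * (Im (F z) * Im (F w))"
    if "0 < Im z" "0 < Im w" for z w
    using plane_isometry_scale[OF F, of z w] that by (simp add: dist_norm)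
  have comm2: "F (of_real (\<alpha>\<^sup>2) * z) = of_real (\<alpha>\<^sup>2) * F z" if "0 < Im z" for z
    using comm[of "of_real \<alpha> * z"] comm[OF that] that \<alpha> by (simp add: power2_eq_square mult.assoc)
  have main: "(cmod (F w))\<^sup>2 * (Im z * Im w) = (cmod w)\<^sup>2 * (Im (F z) * Im (F w))"
    if z: "0 < Im z" and w: "0 < Im w" for z w
  proof -
    have eq: "(cmod (F z - of_real t * F w))\<^sup>2 * (Im z * Im w) =
        (cmod (z - of_real t * w))\<^sup>2 * (Im (F z) * Im (F w))"
      if "t > 0" "F (of_real t * w) = of_real t * F w" for t
      using dist[OF z, of "of_real t * w"] that w by simp
    let ?k = "Im z * Im w" and ?l = "Im (F z) * Im (F w)"
    have eq': "((cmod (F z))\<^sup>2 * ?k - (cmod z)\<^sup>2 * ?l) + (2 * (z \<bullet> w) * ?l - 2 * (F z \<bullet> F w) * ?k) * t +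
        ((cmod (F w))\<^sup>2 * ?k - (cmod w)\<^sup>2 * ?l) * t\<^sup>2 = 0"
      if "t > 0" "F (of_real t * w) = of_real t * F w" for t
      using eq[OF that] unfolding cmod_diff_scaled by (simp add: algebra_simps)
    have "(cmod (F w))\<^sup>2 * ?k - (cmod w)\<^sup>2 * ?l = 0"
      by (rule quadratic_coeffs_zero[OF _ eq'[of \<alpha>] eq'[of "\<alpha>\<^sup>2"] \<alpha>])
         (use eq'[of 1] comm[OF w] comm2[OF w] \<alpha> in simp_all)
    then show ?thesis by simp
  qed
  define \<mu> where "\<mu> = Im (F \<i>)"
  have \<mu>: "\<mu> > 0" using pos[of \<i>] by (simp add: \<mu>_def)
  have norm1: "(cmod (F w))\<^sup>2 * Im w = (cmod w)\<^sup>2 * (\<mu> * Im (F w))" if "0 < Im w" for w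
    using main[of \<i> w] that by (simp add: \<mu>_def)
  have Im: "Im (F z) = \<mu> * Im z" if z: "0 < Im z" for z
  proof -
    have "cmod (F \<i>) ^ 2 * Im z = \<mu> * Im (F z)"
      using main[of z \<i>] z by (simp add: \<mu>_def mult.commute)
    moreover have "(cmod (F \<i>))\<^sup>2 = \<mu> * \<mu>" using norm1[of \<i>] by (simp add: \<mu>_def)
    ultimately show ?thesis using \<mu> by simp
  qed
  have norm: "(cmod (F w))\<^sup>2 = \<mu>\<^sup>2 * (cmod w)\<^sup>2" if "0 < Im w" for w
    using norm1[OF that] Im[OF that] that by (simp add: power2_eq_square)
  \<comment> \<open>Moduli, imaginary parts and distances are all multiplied by \<mu>, so
    polarisation multiplies the products of real parts by its square.\<close>
  have inner: "Re (F z) * Re (F w) = \<mu>\<^sup>2 * (Re z * Re w)" if z: "0 < Im z" and w: "0 < Im w" for z w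
  proof -
    have "(cmod (F z - F w))\<^sup>2 = \<mu>\<^sup>2 * (cmod (z - w))\<^sup>2"
      using dist[OF z w] Im[OF z] Im[OF w] z w by (simp add: power2_eq_square)
    moreover have "(cmod (u - v))\<^sup>2 = (cmod u)\<^sup>2 + (cmod v)\<^sup>2 - 2 * (Re u * Re v + Im u * Im v)" for u v
      unfolding cmod_power2 by (simp add: power2_eq_square algebra_simps)
    ultimately have "\<mu>\<^sup>2 * (cmod z)\<^sup>2 + \<mu>\<^sup>2 * (cmod w)\<^sup>2 - 2 * (Re (F z) * Re (F w) + \<mu> * Im z * (\<mu> * Im w)) =
        \<mu>\<^sup>2 * ((cmod z)\<^sup>2 + (cmod w)\<^sup>2 - 2 * (Re z * Re w + Im z * Im w))"
      by (metis norm[OF z] norm[OF w] Im[OF z] Im[OF w])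
    then show ?thesis by (simp add: algebra_simps power2_eq_square)
  qed
  have "F (F z) = of_real (\<mu>\<^sup>2) * z" if z: "0 < Im z" for z
  proof (rule complex_eqI)
    show "Im (F (F z)) = Im (of_real (\<mu>\<^sup>2) * z)"
      using Im[OF pos[OF z]] Im[OF z] by (simp add: power2_eq_square)
    have 1: "Re (F z) * Re (F (F z)) = Re (F z) * (\<mu>\<^sup>2 * Re z)"
      using inner[OF z pos[OF z]] by (simp add: mult_ac)
    have 2: "Re (F z) * Re (F z) = \<mu>\<^sup>2 * (Re z * Re z)" using inner[OF z z] .
    have 3: "Re (F (F z)) * Re (F (F z)) = \<mu>\<^sup>2 * (Re (F z) * Re (F z))"
      using inner[OF pos[OF z] pos[OF z]] .
    \<comment> \<open>If Re (F z) = 0, then \<open>2\<close> and \<open>3\<close> make Re z and Re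
      (F (F z)) vanish; otherwise Re (F z) cancels in \<open>1\<close>.\<close>
    show "Re (F (F z)) = Re (of_real (\<mu>\<^sup>2) * z)"
      using 1 2 3 \<mu> by (cases "Re (F z) = 0") auto
  qed
  then show thesis using that[of "\<mu>\<^sup>2"] \<mu> by simp
qed

text \<open>Compare the distances from z to w + t for t = 0, b, 2 b. The second difference in t
  gives equal products of imaginary parts, and then the first difference gives equal differences of
  real parts. Taking z = w shows that F preserves imaginary parts.\<close>

lemma isometry_commuting_with_translation:
  fixes b :: real
  assumes F: "plane_isometry Hyperbolic F" and b: "b \<noteq> 0"
    and comm: "\<And>z. 0 < Im z \<Longrightarrow> F (z + of_real b) = F z + of_real b"
  obtains c :: real where "\<And>z. 0 < Im z \<Longrightarrow> F z = z + of_real c"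
proof -
  have pos: "0 < Im (F z)" if "0 < Im z" for z
    using plane_isometry_in[OF F, of z] that by simp
  have dist: "(cmod (F z - F w))\<^sup>2 * (Im z * Im w) = (cmod (z - w))\<^sup>2 * (Im (F z) * Im (F w))"
    if "0 < Im z" "0 < Im w" for z w
    using plane_isometry_scale[OF F, of z w] that by (simp add: dist_norm)
  have comm2: "F (z + of_real (2 * b)) = F z + of_real (2 * b)" if "0 < Im z" for z
    using comm[of "z + of_real b"] comm[OF that] that by (simp add: add.assoc)
  have both: "Im z * Im w = Im (F z) * Im (F w) \<and> Re (F z) - Re (F w) = Re z - Re w"
    if z: "0 < Im z" and w: "0 < Im w" for z w
  proof -
    let ?k = "Im z * Im w" and ?l = "Im (F z) * Im (F w)"
    define P where "P u t = (Re u)\<^sup>2 + (Im u)\<^sup>2 - 2 * t * Re u + t\<^sup>2" for u :: complex and t :: real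
    have P: "(cmod (u - of_real t))\<^sup>2 = P u t" for u t
      unfolding cmod_power2 P_def by (simp add: power2_eq_square algebra_simps)
    have eq: "P (F z - F w) t * ?k = P (z - w) t * ?l"
      if "F (w + of_real t) = F w + of_real t" for t
      using dist[OF z, of "w + of_real t"] that w by (simp add: diff_diff_eq flip: P)
    have e0: "P (F z - F w) 0 * ?k = P (z - w) 0 * ?l" using eq[of 0] by simp
    have e1: "P (F z - F w) b * ?k = P (z - w) b * ?l" using eq[of b] comm[OF w] by simp
    have e2: "P (F z - F w) (2 * b) * ?k = P (z - w) (2 * b) * ?l" using eq[of "2 * b"] comm2[OF w] by simp
    have PP: "P u (2 * b) - 2 * P u b + P u 0 = 2 * b\<^sup>2" "P u b - P u 0 = b\<^sup>2 - 2 * b * Re u" for u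
      by (simp_all add: P_def power_mult_distrib)
    have "(2 * b\<^sup>2) * ?k = (P (F z - F w) (2 * b) - 2 * P (F z - F w) b + P (F z - F w) 0) * ?k"
      by (simp add: PP)
    also have "\<dots> = (P (z - w) (2 * b) - 2 * P (z - w) b + P (z - w) 0) * ?l"
      using e0 e1 e2 by (simp add: left_diff_distrib distrib_right)
    also have "\<dots> = (2 * b\<^sup>2) * ?l" by (simp add: PP)
    finally have k: "?k = ?l" using b by simp
    have "P (F z - F w) 0 = P (z - w) 0" "P (F z - F w) b = P (z - w) b"
      using e0 e1 z w by (simp_all flip: k)
    then have "P (F z - F w) b - P (F z - F w) 0 = P (z - w) b - P (z - w) 0" by simp
    then have "Re (F z - F w) = Re (z - w)" using b by (simp add: PP)
    then show ?thesis using k by simp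
  qed
  have Im: "Im (F z) = Im z" if "0 < Im z" for z
  proof -
    have "(Im (F z))\<^sup>2 = (Im z)\<^sup>2" using both[OF that that] by (simp add: power2_eq_square)
    then show ?thesis using pos[OF that] that by (simp add: power2_eq_iff_nonneg)
  qed
  have "F z = z + of_real (Re (F \<i>))" if "0 < Im z" for z
    using both[OF that, of \<i>] Im[OF that] by (auto intro: complex_eqI)
  then show thesis using that by blast
qed

text \<open>\<open>A 1\<close> is the normal form of a fixed-point-free map and \<open>\<kappa>\<close> a coordinate turning \<open>A\<close> into
  translations. An isometry \<open>F\<close> commuting with \<open>A 1\<close> enters only squared, since \<open>F\<close> itself may
  reverse the orientation.\<close>

definition normal_flow :: "(real \<Rightarrow> complex \<Rightarrow> complex) \<Rightarrow> (complex \<Rightarrow> complex) \<Rightarrow> bool" where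
  "normal_flow A \<kappa> \<longleftrightarrow>
     (\<forall>s. plane_isometry Hyperbolic (A s)) \<and> (\<forall>w. A 0 w = w) \<and>
     (\<forall>s t w. A (s + t) w = A s (A t w)) \<and>
     \<kappa> holomorphic_on plane Hyperbolic \<and> inj_on \<kappa> (plane Hyperbolic) \<and>
     (\<forall>s. \<forall>w\<in>plane Hyperbolic. \<kappa> (A s w) = \<kappa> w + of_real s) \<and>
     (\<forall>F. plane_isometry Hyperbolic F \<longrightarrow> (\<forall>w\<in>plane Hyperbolic. F (A 1 w) = A 1 (F w)) \<longrightarrow>
        (\<exists>\<beta>. \<forall>w\<in>plane Hyperbolic. \<kappa> (F (F w)) = \<kappa> w + \<beta>))"

text \<open>The parabolic case. Here F is itself a horizontal translation, before any
  squaring.\<close>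

lemma normal_flow_translation:
  assumes "b \<noteq> (0::real)"
  shows "normal_flow (\<lambda>s z. z + of_real (s * b)) (\<lambda>z. z / of_real b)"
proof -
  have "\<exists>\<beta>. \<forall>w\<in>plane Hyperbolic. F (F w) / of_real b = w / of_real b + \<beta>"
    if F: "plane_isometry Hyperbolic F"
      "\<forall>w\<in>plane Hyperbolic. F (w + of_real (1 * b)) = F w + of_real (1 * b)" for F
  proof -
    obtain c :: real where c: "\<And>z. 0 < Im z \<Longrightarrow> F z = z + of_real c"
      using isometry_commuting_with_translation[OF F(1) assms] F(2) by auto
    show ?thesis
      by (intro exI[of _ "of_real (2 * c) / of_real b"] ballI)
         (simp add: c add_divide_distrib)
  qed
  then show ?thesis unfolding normal_flow_def using assms
    by (intro conjI allI impI hyperbolic_isometry_translation)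
       (auto simp: algebra_simps add_divide_distrib inj_on_def intro!: holomorphic_intros)
qed

text \<open>The hyperbolic case. The logarithm turns scalings into translations, and the upper
  half-plane avoids its branch cut.\<close>

lemma normal_flow_scaling:
  assumes "0 < \<alpha>" "\<alpha> \<noteq> (1::real)"
  shows "normal_flow (\<lambda>s z. of_real (\<alpha> powr s) * z) (\<lambda>z. Ln z / of_real (ln \<alpha>))"
proof -
  have ln: "ln \<alpha> \<noteq> 0" using assms by simp
  have Ln: "Ln (of_real r * z) = of_real (ln r) + Ln z" if "0 < r" "0 < Im z" for r z
  proof -
    have "z \<noteq> 0" using that(2) by auto
    then show ?thesis using Ln_times_of_real[OF that(1), of z] by (simp add: Ln_of_real that(1))
  qed
  have "\<exists>\<beta>. \<forall>w\<in>plane Hyperbolic. Ln (F (F w)) / of_real (ln \<alpha>) = Ln w / of_real (ln \<alpha>) + \<beta>"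
    if F: "plane_isometry Hyperbolic F"
      "\<forall>w\<in>plane Hyperbolic. F (of_real (\<alpha> powr 1) * w) = of_real (\<alpha> powr 1) * F w" for F
  proof -
    obtain \<mu> where \<mu>: "0 < \<mu>" "\<And>z. 0 < Im z \<Longrightarrow> F (F z) = of_real \<mu> * z"
      using isometry_commuting_with_scaling[OF F(1) assms] F(2) assms by auto
    show ?thesis
      by (intro exI[of _ "of_real (ln \<mu>) / of_real (ln \<alpha>)"] ballI)
         (simp add: \<mu> Ln add_divide_distrib)
  qed
  moreover have "(\<lambda>z. Ln z / of_real (ln \<alpha>)) holomorphic_on plane Hyperbolic"
    using ln by (auto intro!: holomorphic_intros simp: complex_nonpos_Reals_iff)
  moreover have "inj_on (\<lambda>z. Ln z / of_real (ln \<alpha>)) (plane Hyperbolic)"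
  proof (rule inj_onI)
    fix x y assume xy: "x \<in> plane Hyperbolic" "y \<in> plane Hyperbolic"
      "Ln x / of_real (ln \<alpha>) = Ln y / of_real (ln \<alpha>)"
    then have "Ln x = Ln y" "x \<noteq> 0" "y \<noteq> 0" using ln by auto
    then show "x = y" by (metis exp_Ln)
  qed
  moreover have "Ln (of_real (\<alpha> powr s) * w) / of_real (ln \<alpha>) = Ln w / of_real (ln \<alpha>) + of_real s"
    if "w \<in> plane Hyperbolic" for s w
    using that assms ln by (simp add: Ln ln_powr add_divide_distrib)
  ultimately show ?thesis unfolding normal_flow_def using assms
    by (intro conjI allI impI hyperbolic_isometry_scaling) (auto simp: powr_add)
qed

text \<open>A Moebius map with no fixed point in the half-plane fixes a boundary point. Moving that
  point to infinity makes T an affine map w -> \<alpha> w + \<beta>. For \<alpha> = 1 this is a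
  translation; otherwise the finite fixed point is moved to 0 and a scaling remains.\<close>

lemma hyperbolic_normal_form:
  fixes T :: "complex \<Rightarrow> complex"
  assumes T: "\<And>z. 0 < Im z \<Longrightarrow> 0 < Im (T z) \<and>
      (\<exists>a. (T has_field_derivative a) (at z) \<and> cmod a = Im (T z) / Im z)"
    and fpf: "\<And>z. 0 < Im z \<Longrightarrow> T z \<noteq> z"
  obtains g A \<kappa> where "plane_isometry Hyperbolic g" "g holomorphic_on plane Hyperbolic"
    "normal_flow A \<kappa>" "\<And>z. z \<in> plane Hyperbolic \<Longrightarrow> g (T z) = A 1 (g z)"
proof -
  obtain x y c s :: real where y: "0 < y" and cs: "c\<^sup>2 + s\<^sup>2 = 1"
    and Tz: "\<And>z. 0 < Im z \<Longrightarrow> T z = of_real x + of_real y * (of_real c * z + of_real s) / (of_real c - of_real s * z)"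
    and nz: "\<And>z. 0 < Im z \<Longrightarrow> of_real c - of_real s * z \<noteq> 0"
    using hyperbolic_isometry_moebius[OF T] by metis
  have "\<exists>g \<alpha> \<beta>. plane_isometry Hyperbolic g \<and> g holomorphic_on plane Hyperbolic \<and> 0 < \<alpha> \<and>
      (\<forall>z. 0 < Im z \<longrightarrow> g (T z) = of_real \<alpha> * g z + of_real \<beta>)"
  proof (cases "s = 0")
    case True
    then have "c \<noteq> 0" using cs by auto
    then have "T z = of_real y * z + of_real x" if "0 < Im z" for z
      using Tz[OF that] True by simp
    then show ?thesis using y hyperbolic_isometry_translation[of 0]
      by (intro exI[of _ "\<lambda>z. z"] exI[of _ y] exI[of _ x]) auto
  next
    case s: False
    \<comment> \<open>These are the coefficients of the fixed point equation s z^2 - b z + q = 0. A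
      negative discriminant would give a root in the upper half-plane; |s| in the witness makes its
      imaginary part positive.\<close>
    define b q where "b = c + x * s - y * c" and "q = x * c + y * s"
    define disc where "disc = b\<^sup>2 - 4 * s * q"
    have "disc \<ge> 0"
    proof (rule ccontr)
      assume neg: "\<not> disc \<ge> 0"
      define z where "z = Complex (b / (2 * s)) (sqrt (- disc) / (2 * \<bar>s\<bar>))"
      have z: "0 < Im z" using neg s by (simp add: z_def)
      have "of_real s * z\<^sup>2 - of_real b * z + of_real q = 0"
      proof -
        have 1: "(sqrt (- disc) / (2 * \<bar>s\<bar>))\<^sup>2 = - disc / (4 * s\<^sup>2)"
          using neg by (simp add: power_divide power_mult_distrib)
        have "s * ((b / (2 * s))\<^sup>2 - (- disc / (4 * s\<^sup>2))) - b * (b / (2 * s)) + q = 0"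
          using s by (simp add: disc_def field_simps power2_eq_square)
        moreover have "s * (2 * (b / (2 * s)) * (sqrt (- disc) / (2 * \<bar>s\<bar>))) - b * (sqrt (- disc) / (2 * \<bar>s\<bar>)) = 0"
          using s by simp
        ultimately show ?thesis
          using neg unfolding complex_eq_iff by (simp add: z_def power2_eq_square)
      qed
      then have "(z - of_real x) * (of_real c - of_real s * z) = of_real y * (of_real c * z + of_real s)"
        by (simp add: b_def q_def power2_eq_square algebra_simps)
      then have "z = of_real x + of_real y * (of_real c * z + of_real s) / (of_real c - of_real s * z)" using nz[OF z] by (simp add: field_simps)
      then show False using Tz[OF z] fpf[OF z] by simp
    qed
    define r where "r = (b + sqrt disc) / (2 * s)"
    have "s * r\<^sup>2 - b * r + q = 0"
    proof -
      have "2 * s * r = b + sqrt disc" using s by (simp add: r_def)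
      then have "(2 * s * r - b)\<^sup>2 = disc" using \<open>disc \<ge> 0\<close> by simp
      then have "4 * s * (s * r\<^sup>2 - b * r + q) = 0"
        by (simp add: disc_def power2_eq_square algebra_simps)
      then show ?thesis using s by simp
    qed
    then have r: "(r - x) * (c - s * r) = y * (c * r + s)"
      by (simp add: b_def q_def power2_eq_square algebra_simps)
    \<comment> \<open>The denominator of T at its boundary fixed point r. If it vanished, the fixed
      point equation would make the numerator c r + s vanish too, that is s (r^2 + 1) = 0.\<close>
    define d where "d = c - s * r"
    have d: "d \<noteq> 0"
    proof
      assume "d = 0"
      then have "c * r + s = 0" "c = s * r" using r y by (auto simp: d_def)
      then have "s * (r\<^sup>2 + 1) = 0" by (simp add: power2_eq_square algebra_simps)
      then show False using s by (simp add: power2_eq_square add_nonneg_eq_0_iff)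
    qed
    define g where "g z = - 1 / (z + of_real (- r))" for z :: complex
    have g: "plane_isometry Hyperbolic g"
      unfolding g_def by (rule plane_isometry_compose[OF hyperbolic_isometry_neg_inverse hyperbolic_isometry_translation])
    have hol: "g holomorphic_on plane Hyperbolic"
      unfolding g_def by (intro holomorphic_intros) (auto simp: complex_eq_iff)
    \<comment> \<open>The factor d^2 / y is the reciprocal of the derivative y / d^2 of the Moebius
      map at r, since c^2 + s^2 = 1.\<close>
    have "g (T z) = of_real (d\<^sup>2 / y) * g z + of_real (s * d / y)" if z: "0 < Im z" for z
    proof -
      define m where "m = of_real c - of_real s * z"
      define e where "e = z - of_real r"
      have m: "m \<noteq> 0" using nz[OF z] by (simp add: m_def)
      have e: "e \<noteq> 0" using z by (auto simp: e_def complex_eq_iff)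
      have md: "m = of_real d - of_real s * e" by (simp add: m_def d_def e_def algebra_simps)
      have "d * (x - r) = - (y * (c * r + s))" using r by (simp add: d_def algebra_simps)
      then have key: "of_real d * (of_real x - of_real r) = - (of_real y * of_real (c * r + s) :: complex)"
        by (metis of_real_diff of_real_minus of_real_mult)
      have "of_real d * m * (T z - of_real r) =
          m * (of_real d * (of_real x - of_real r)) + of_real y * (of_real d * (of_real c * z + of_real s))"
        using m unfolding Tz[OF z] m_def[symmetric] by (simp add: field_simps)
      also have "\<dots> = of_real y * (of_real d * (of_real c * z + of_real s) - m * of_real (c * r + s))"
        unfolding key by (simp add: right_diff_distrib mult.left_commute)
      also have "\<dots> = of_real y * (of_real (c\<^sup>2 + s\<^sup>2) * e)"
        by (simp add: d_def m_def e_def power2_eq_square algebra_simps)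
      finally have 1: "of_real d * m * (T z - of_real r) = of_real y * e" using cs by simp
      then have "T z - of_real r = of_real y * e / (of_real d * m)"
        using m d by (simp add: field_simps)
      then have "g (T z) = - (of_real d * m) / (of_real y * e)"
        by (simp add: g_def)
      also have "\<dots> = of_real (d\<^sup>2 / y) * (- 1 / e) + of_real (s * d / y)"
        unfolding md using y e by (simp add: field_simps power2_eq_square)
      finally show ?thesis by (simp add: g_def e_def)
    qed
    then show ?thesis using g hol d y
      by (intro exI[of _ g] exI[of _ "d\<^sup>2 / y"] exI[of _ "s * d / y"]) simp
  qed
  then obtain g \<alpha> \<beta> where g: "plane_isometry Hyperbolic g" "g holomorphic_on plane Hyperbolic"
    and \<alpha>: "0 < \<alpha>" and gT: "\<And>z. 0 < Im z \<Longrightarrow> g (T z) = of_real \<alpha> * g z + of_real \<beta>"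
    by blast
  show thesis
  proof (cases "\<alpha> = 1")
    case True
    have inj: "inj_on g (plane Hyperbolic)" using g(1) by (simp add: plane_isometry_def bij_betw_def)
    have "g (T \<i>) \<noteq> g \<i>"
      using inj_onD[OF inj, of "T \<i>" \<i>] T[of \<i>] fpf[of \<i>] by auto
    then have "\<beta> \<noteq> 0" using gT[of \<i>] True by auto
    then show thesis
      using that[OF g normal_flow_translation[of \<beta>]] gT True by simp
  next
    case False
    define g2 where "g2 z = g z + of_real (\<beta> / (\<alpha> - 1))" for z :: complex
    have "plane_isometry Hyperbolic g2"
      unfolding g2_def by (rule plane_isometry_compose[OF hyperbolic_isometry_translation g(1)])
    moreover have "g2 holomorphic_on plane Hyperbolic"
      unfolding g2_def by (intro holomorphic_intros g(2))
    moreover have "g2 (T z) = of_real (\<alpha> powr 1) * g2 z" if "z \<in> plane Hyperbolic" for z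
    proof -
      have "of_real \<alpha> - 1 \<noteq> (0::complex)" using False by (metis eq_iff_diff_eq_0 of_real_1 of_real_eq_iff)
      then have "of_real \<beta> + of_real (\<beta> / (\<alpha> - 1)) = (of_real \<alpha> * of_real (\<beta> / (\<alpha> - 1)) :: complex)"
        by (simp add: field_simps)
      then show ?thesis using gT that \<alpha> by (simp add: g2_def distrib_left)
    qed
    ultimately show thesis using that normal_flow_scaling[OF \<alpha> False] by blast
  qed
qed

section \<open>The straightening coordinate of a one-parameter group\<close>

lemma one_parameter_group_isometry:
  "one_parameter_isometry_group G \<phi> \<Longrightarrow> plane_isometry G (\<phi> s)"
  "one_parameter_isometry_group G \<phi> \<Longrightarrow> z \<in> plane G \<Longrightarrow> \<phi> s z \<in> plane G"
  "one_parameter_isometry_group G \<phi> \<Longrightarrow> z \<in> plane G \<Longrightarrow> \<phi> 0 z = z"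
  "one_parameter_isometry_group G \<phi> \<Longrightarrow> z \<in> plane G \<Longrightarrow> \<phi> (s + t) z = \<phi> s (\<phi> t z)"
  unfolding one_parameter_isometry_group_def by (auto intro: plane_isometry_in)

text \<open>\<open>\<psi>\<close> straightens every one-parameter group through \<open>T\<close>, although the group itself need not be
  known: commuting with \<open>T\<close> already forces each of its elements to be a translation in \<open>\<psi>\<close>.\<close>

lemma translation_coordinate_exists:
  fixes T :: "complex \<Rightarrow> complex"
  assumes T: "\<And>z. z \<in> plane G \<Longrightarrow> T z \<in> plane G \<and>
      (\<exists>a. (T has_field_derivative a) (at z) \<and> cmod a = scale_factor G (T z) / scale_factor G z)"
    and fpf: "\<And>z. z \<in> plane G \<Longrightarrow> T z \<noteq> z"
  obtains \<psi> \<phi> where "\<psi> holomorphic_on plane G" "inj_on \<psi> (plane G)"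
    "one_parameter_isometry_group G \<phi>" "\<And>z. z \<in> plane G \<Longrightarrow> \<phi> 1 z = T z"
    "\<And>s z. z \<in> plane G \<Longrightarrow> \<psi> (\<phi> s z) = \<psi> z + of_real s"
    "\<And>\<phi>' s. one_parameter_isometry_group G \<phi>' \<Longrightarrow> (\<And>z. z \<in> plane G \<Longrightarrow> \<phi>' 1 z = T z) \<Longrightarrow>
       \<exists>\<beta>. \<forall>z\<in>plane G. \<psi> (\<phi>' s z) = \<psi> z + \<beta>"
proof (cases G)
  case Euclidean
  obtain b where b: "b \<noteq> 0" "\<And>z. T z = z + b"
    using euclidean_isometry_translation[of T] T fpf Euclidean by auto
  have "one_parameter_isometry_group G (\<lambda>s z. z + of_real s * b)"
  proof -
    have "plane_isometry G (\<lambda>z. z + of_real s * b)" for s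
    proof (rule plane_isometryI)
      show "bij_betw (\<lambda>z. z + of_real s * b) (plane G) (plane G)"
        by (rule bij_betw_byWitness[where f' = "\<lambda>z. z - of_real s * b"]) (auto simp: Euclidean)
    qed (simp add: Euclidean dist_norm)
    then show ?thesis unfolding one_parameter_isometry_group_def by (auto simp: algebra_simps)
  qed
  moreover have "(\<lambda>z. z / b) holomorphic_on plane G" using b by (intro holomorphic_intros) auto
  moreover have "\<exists>\<beta>. \<forall>z\<in>plane G. \<phi>' s z / b = z / b + \<beta>"
    if "one_parameter_isometry_group G \<phi>'" for \<phi>' s
  proof -
    have "\<exists>e. \<forall>z. \<phi>' s z = z + e"
      using that Euclidean unfolding one_parameter_isometry_group_def by (elim conjE) simp
    then obtain e where "\<And>z. \<phi>' s z = z + e" by blast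
    then show ?thesis by (intro exI[of _ "e / b"]) (simp add: add_divide_distrib)
  qed
  ultimately show thesis
    using that[of "\<lambda>z. z / b" "\<lambda>s z. z + of_real s * b"] b
    by (simp add: add_divide_distrib inj_on_def)
next
  case Hyperbolic
  obtain g A \<kappa> where g: "plane_isometry Hyperbolic g" "g holomorphic_on plane Hyperbolic"
    and flow: "normal_flow A \<kappa>" and gT: "\<And>z. z \<in> plane Hyperbolic \<Longrightarrow> g (T z) = A 1 (g z)"
    by (rule hyperbolic_normal_form[of T]) (use T fpf Hyperbolic in auto)
  let ?H = "plane Hyperbolic"
  have A: "\<And>s. plane_isometry Hyperbolic (A s)" "\<And>w. A 0 w = w" "\<And>s t w. A (s + t) w = A s (A t w)"
    and hol: "\<kappa> holomorphic_on ?H" and inj: "inj_on \<kappa> ?H"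
    and \<kappa>A: "\<And>s w. w \<in> ?H \<Longrightarrow> \<kappa> (A s w) = \<kappa> w + of_real s"
    and comm: "\<And>F. plane_isometry Hyperbolic F \<Longrightarrow> (\<And>w. w \<in> ?H \<Longrightarrow> F (A 1 w) = A 1 (F w)) \<Longrightarrow>
        \<exists>\<beta>. \<forall>w\<in>?H. \<kappa> (F (F w)) = \<kappa> w + \<beta>"
    using flow unfolding normal_flow_def by simp_all
  define k where "k = the_inv_into ?H g"
  have bij: "bij_betw g ?H ?H" using g(1) by (simp add: plane_isometry_def)
  have k: "plane_isometry Hyperbolic k" unfolding k_def by (rule plane_isometry_inv[OF g(1)])
  have gk: "g (k w) = w" if "w \<in> ?H" for w
    unfolding k_def using f_the_inv_into_f_bij_betw[OF bij] that by blast
  have kg: "k (g z) = z" if "z \<in> ?H" for z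
    unfolding k_def using the_inv_into_f_f bij that by (metis bij_betw_def)
  note inH = plane_isometry_in[OF g(1)] plane_isometry_in[OF k] plane_isometry_in[OF A(1)]
  define \<phi> where "\<phi> s z = k (A s (g z))" for s z
  define \<psi> where "\<psi> z = \<kappa> (g z)" for z
  have "\<psi> holomorphic_on ?H"
    unfolding \<psi>_def using holomorphic_on_compose_gen[OF g(2) hol] inH by (auto simp: o_def)
  moreover have "inj_on \<psi> ?H"
    unfolding \<psi>_def using inj bij inH by (auto simp: inj_on_def bij_betw_def)
  moreover have "one_parameter_isometry_group Hyperbolic \<phi>"
    unfolding one_parameter_isometry_group_def
  proof (intro conjI allI ballI impI)
    show "plane_isometry Hyperbolic (\<phi> s)" for s
      unfolding \<phi>_def by (intro plane_isometry_compose[OF k] plane_isometry_compose[OF A(1) g(1)])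
    show "\<phi> 0 z = z" if "z \<in> ?H" for z using kg[OF that] by (simp add: \<phi>_def A(2))
    show "\<phi> (s + t) z = \<phi> s (\<phi> t z)" if "z \<in> ?H" for s t z
      using gk[of "A t (g z)"] inH that by (simp add: \<phi>_def A(3))
  qed simp
  moreover have "\<phi> 1 z = T z" if "z \<in> ?H" for z
    using gT[OF that] kg[of "T z"] T[of z] that Hyperbolic by (simp add: \<phi>_def)
  moreover have "\<psi> (\<phi> s z) = \<psi> z + of_real s" if "z \<in> ?H" for s z
    using gk[of "A s (g z)"] inH(1)[OF that] inH(3)[OF inH(1)[OF that]] \<kappa>A
    by (simp add: \<phi>_def \<psi>_def)
  moreover have "\<exists>\<beta>. \<forall>z\<in>?H. \<psi> (\<phi>' s z) = \<psi> z + \<beta>"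
    if \<phi>': "one_parameter_isometry_group Hyperbolic \<phi>'" "\<And>z. z \<in> ?H \<Longrightarrow> \<phi>' 1 z = T z" for \<phi>' s
  proof -
    note grp = one_parameter_group_isometry[OF \<phi>'(1)]
    \<comment> \<open>Half of the time s, so that the square of F is \<open>\<phi>' s\<close>
      conjugated by g, the form that \<open>normal_flow\<close> controls. F commutes with
      \<open>A 1\<close> because \<open>\<phi>' (s / 2)\<close> commutes with
      \<open>\<phi>' 1\<close>, which is T.\<close>
    define F where "F w = g (\<phi>' (s / 2) (k w))" for w
    have "plane_isometry Hyperbolic F"
      unfolding F_def by (intro plane_isometry_compose[OF g(1)] plane_isometry_compose[OF grp(1) k])
    moreover have "F (A 1 w) = A 1 (F w)" if w: "w \<in> ?H" for w
    proof -
      have "k (A 1 w) = T (k w)"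
        using gT[OF inH(2)[OF w]] gk[OF w] kg[of "T (k w)"] T[of "k w"] inH(2)[OF w] Hyperbolic by simp
      moreover have "\<phi>' (s / 2) (T (k w)) = T (\<phi>' (s / 2) (k w))"
        using grp(4)[of "k w" "s / 2" 1] grp(4)[of "k w" 1 "s / 2"] \<phi>'(2) grp(2) inH(2)[OF w]
        by (simp add: add.commute)
      ultimately show ?thesis
        using gT[OF grp(2)[OF inH(2)[OF w]]] by (simp add: F_def)
    qed
    ultimately obtain \<beta> where \<beta>: "\<And>w. w \<in> ?H \<Longrightarrow> \<kappa> (F (F w)) = \<kappa> w + \<beta>"
      using comm by meson
    have "F (F (g z)) = g (\<phi>' s z)" if z: "z \<in> ?H" for z
      using kg[OF z] kg[OF grp(2)[OF z]] grp(4)[OF z, of "s / 2" "s / 2"] by (simp add: F_def)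
    then show ?thesis unfolding \<psi>_def using \<beta> inH(1) by metis
  qed
  ultimately show thesis using that[of \<psi> \<phi>] unfolding Hyperbolic by blast
qed

lemma oriented_area_mult: "oriented_area (u * a) (v * a) = (cmod a)\<^sup>2 * oriented_area u v"
  unfolding cmod_power2 by (simp add: oriented_area_def power2_eq_square algebra_simps)

lemma crossing_sign_mult: "a \<noteq> 0 \<Longrightarrow> crossing_sign (u * a) (v * a) = crossing_sign u v"
  by (simp add: crossing_sign_def oriented_area_mult zero_less_mult_iff mult_less_0_iff)

text \<open>\<open>\<psi> \<circ> \<phi> s - \<psi>\<close> is additive and differentiable in \<open>s\<close>, hence linear, and it is \<open>1\<close> for \<open>s = 1\<close>.\<close>

lemma generating_field_coordinate:
  assumes grp: "one_parameter_isometry_group G \<phi>" and X: "generating_field G \<phi> X"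
    and hol: "\<psi> holomorphic_on plane G"
    and transl: "\<And>s. \<exists>\<beta>. \<forall>z\<in>plane G. \<psi> (\<phi> s z) = \<psi> z + \<beta>"
    and one: "\<And>z. z \<in> plane G \<Longrightarrow> \<psi> (\<phi> 1 z) = \<psi> z + 1" and z: "z \<in> plane G"
  shows "deriv \<psi> z * X z = 1"
proof -
  note grp' = one_parameter_group_isometry[OF grp]
  define \<beta> where "\<beta> s = \<psi> (\<phi> s z) - \<psi> z" for s
  have add: "\<beta> (s + t) = \<beta> s + \<beta> t" for s t
  proof -
    obtain b where b: "\<And>w. w \<in> plane G \<Longrightarrow> \<psi> (\<phi> s w) = \<psi> w + b" using transl by blast
    show ?thesis using b[OF z] b[OF grp'(2)[OF z]] grp'(4)[OF z] by (simp add: \<beta>_def)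
  qed
  define c where "c s = X (\<phi> s z) * deriv \<psi> (\<phi> s z)" for s
  have d: "(\<beta> has_vector_derivative c s) (at s)" for s
  proof -
    have "((\<lambda>s. \<phi> s z) has_vector_derivative X (\<phi> s z)) (at s)"
      using X z by (simp add: generating_field_def)
    moreover have "(\<psi> has_field_derivative deriv \<psi> (\<phi> s z)) (at (\<phi> s z))"
      using hol open_plane grp'(2)[OF z] holomorphic_derivI by blast
    ultimately have "((\<psi> \<circ> (\<lambda>s. \<phi> s z)) has_vector_derivative c s) (at s)"
      unfolding c_def by (rule field_vector_diff_chain_at)
    then show ?thesis unfolding \<beta>_def o_def by (auto intro!: derivative_eq_intros)
  qed
  have c: "c s = c 0" for s
  proof -
    have "((\<lambda>r. \<beta> (s + r * 1)) has_vector_derivative 1 *\<^sub>R c s) (at 0)"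
      by (rule has_vector_derivative_affine) (use d in simp)
    moreover have "((\<lambda>r. \<beta> s + \<beta> r) has_vector_derivative c 0) (at 0)"
      by (auto intro!: derivative_eq_intros d)
    ultimately show ?thesis using vector_derivative_unique_at by (fastforce simp: add)
  qed
  have "\<beta> 1 - \<beta> 0 = c 0"
  proof -
    have "((\<lambda>s. \<beta> s - s *\<^sub>R c 0) has_vector_derivative 0) (at s)" for s
      using d[of s] c[of s] by (auto intro!: derivative_eq_intros)
    then obtain e where e: "\<And>s. \<beta> s - s *\<^sub>R c 0 = e"
      using has_vector_derivative_zero_constant[of UNIV "\<lambda>s. \<beta> s - s *\<^sub>R c 0"] by auto
    show ?thesis using e[of 1] e[of 0] by (simp add: algebra_simps)
  qed
  moreover have "\<beta> 1 = 1" "\<beta> 0 = 0" using one[OF z] grp'(3)[OF z] by (simp_all add: \<beta>_def)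
  ultimately show ?thesis using grp'(3)[OF z] by (simp add: c_def mult.commute)
qed

text \<open>In the coordinate the flow is w -> w + s. Pulled back by the holomorphic inverse of
  \<open>\<psi>\<close>, its unit velocity becomes 1 / \<open>deriv \<psi>\<close>.\<close>

lemma generating_field_exists:
  assumes grp: "one_parameter_isometry_group G \<phi>"
    and hol: "\<psi> holomorphic_on plane G" and inj: "inj_on \<psi> (plane G)"
    and transl: "\<And>s z. z \<in> plane G \<Longrightarrow> \<psi> (\<phi> s z) = \<psi> z + of_real s"
  shows "generating_field G \<phi> (\<lambda>z. 1 / deriv \<psi> z)"
  unfolding generating_field_def
proof (intro ballI allI)
  fix z s assume z: "z \<in> plane G"
  note grp' = one_parameter_group_isometry[OF grp]
  obtain g where g: "g holomorphic_on \<psi> ` plane G"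
    "\<And>z. z \<in> plane G \<Longrightarrow> deriv \<psi> z * deriv g (\<psi> z) = 1" "\<And>z. z \<in> plane G \<Longrightarrow> g (\<psi> z) = z"
    using holomorphic_has_inverse[OF hol open_plane inj] by blast
  have op: "open (\<psi> ` plane G)" using open_mapping_thm3[OF hol open_plane inj] .
  have eq: "\<phi> s z = g (\<psi> z + of_real s)" for s
    using g(3)[OF grp'(2)[OF z, of s]] transl[OF z] by simp
  have "\<psi> z + of_real s \<in> \<psi> ` plane G" using transl[OF z, of s] grp'(2)[OF z, of s] by (metis imageI)
  then have "(g has_field_derivative deriv g (\<psi> z + of_real s)) (at (\<psi> z + of_real s))"
    using g(1) op holomorphic_derivI by blast
  moreover have "((\<lambda>s. \<psi> z + of_real s) has_vector_derivative 1) (at s)"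
    by (auto intro!: derivative_eq_intros)
  ultimately have "((g \<circ> (\<lambda>s. \<psi> z + of_real s)) has_vector_derivative 1 * deriv g (\<psi> z + of_real s)) (at s)"
    using field_vector_diff_chain_at by blast
  moreover have "deriv g (\<psi> z + of_real s) = 1 / deriv \<psi> (\<phi> s z)"
    using g(2)[OF grp'(2)[OF z, of s]] transl[OF z, of s] by (metis nonzero_eq_divide_eq mult.commute mult_zero_left zero_neq_one)
  ultimately show "((\<lambda>s. \<phi> s z) has_vector_derivative 1 / deriv \<psi> (\<phi> s z)) (at s)"
    by (simp add: o_def flip: eq)
qed

section \<open>Covers of a generic curve\<close>

lemma circle_cover_eq_iff: "circle_cover s = circle_cover t \<longleftrightarrow> (\<exists>n::int. t = s + of_int n)"
proof -
  have "circle_cover s = circle_cover t \<longleftrightarrow> sin (2 * pi * s) = sin (2 * pi * t) \<and> cos (2 * pi * s) = cos (2 * pi * t)"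
    by (auto simp: circle_cover_def complex_eq_iff)
  also have "\<dots> \<longleftrightarrow> (\<exists>n::int. 2 * pi * s = 2 * pi * t + 2 * pi * of_int n)"
    by (rule sin_cos_eq_iff)
  also have "\<dots> \<longleftrightarrow> (\<exists>n::int. s = t + of_int n)"
    by (simp flip: distrib_left)
  also have "\<dots> \<longleftrightarrow> (\<exists>n::int. t = s + of_int n)"
    by (metis add_diff_cancel_right' diff_add_cancel diff_minus_eq_add of_int_minus)
  finally show ?thesis .
qed

lemma circle_cover_add_1 [simp]: "circle_cover (t + 1) = circle_cover t"
  using circle_cover_eq_iff[of t "t + 1"] by (metis of_int_1)

lemma norm_circle_cover [simp]: "cmod (circle_cover t) = 1"
  by (simp add: circle_cover_def)

lemma continuous_on_circle_cover [continuous_intros]: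
  "continuous_on S f \<Longrightarrow> continuous_on S (\<lambda>t. circle_cover (f t))"
  unfolding circle_cover_def by (intro continuous_intros)

lemma circle_cover_surj:
  assumes "z \<in> sphere 0 1"
  obtains t where "0 \<le> t" "t < 1" "circle_cover t = z"
proof (rule that[of "Arg2pi z / (2 * pi)"])
  have "z = of_real (norm z) * exp (\<i> * of_real (Arg2pi z))" using Arg2pi_eq by metis
  then show "circle_cover (Arg2pi z / (2 * pi)) = z"
    using assms by (simp add: circle_cover_def cis_conv_exp)
qed (use Arg2pi_ge_0 Arg2pi_lt_2pi in auto)

text \<open>An injective linear D is bounded below by a positive multiple of the norm, which beats
  the remainder of the first-order expansion.\<close>

lemma linear_has_isolated_zero:
  fixes f :: "'a::euclidean_space \<Rightarrow> 'b::euclidean_space"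
  assumes "(f has_derivative D) (at x)" and "inj D" and "f x = 0"
  shows "\<forall>\<^sub>F y in at x. f y \<noteq> 0"
proof -
  have lin: "linear D" using assms(1) has_derivative_linear by blast
  obtain B where B: "B > 0" "\<And>v. B * norm v \<le> norm (D v)"
    using linear_inj_bounded_below_pos[OF lin assms(2)] by blast
  have "((\<lambda>y. norm ((f y - f x) - D (y - x)) / norm (y - x)) \<longlongrightarrow> 0) (at x)"
    using assms(1) unfolding has_derivative_iff_norm by blast
  then have "\<forall>\<^sub>F y in at x. norm ((f y - f x) - D (y - x)) / norm (y - x) < B"
    using B(1) by (rule order_tendstoD(2))
  then have "\<forall>\<^sub>F y in at x. norm ((f y - f x) - D (y - x)) / norm (y - x) < B \<and> y \<noteq> x"
    by (simp add: eventually_at_filter)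
  then show ?thesis
  proof (rule eventually_mono)
    fix y assume y: "norm ((f y - f x) - D (y - x)) / norm (y - x) < B \<and> y \<noteq> x"
    then have "norm ((f y - f x) - D (y - x)) < B * norm (y - x)" by (simp add: divide_less_eq)
    also have "\<dots> \<le> norm (D (y - x))" by (rule B(2))
    finally show "f y \<noteq> 0" using assms(3) by (auto simp: norm_minus_commute)
  qed
qed

lemma locally_finite_compact_imp_finite:
  fixes P :: "'a::t2_space set"
  assumes "compact K" and "P \<subseteq> K" and "\<And>x. x \<in> K \<Longrightarrow> \<forall>\<^sub>F y in at x. y \<notin> P"
  shows "finite P"
proof (rule ccontr)
  assume "infinite P"
  then obtain x where "x \<in> K" "x islimpt P"
    using Heine_Borel_imp_Bolzano_Weierstrass[OF assms(1) _ assms(2)] by blast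
  then show False using assms(3) by (simp add: islimpt_iff_eventually)
qed

locale generic_curve =
  fixes G :: geometry and M :: "'m::t2_space set" and A p \<gamma>
  assumes surface: "geometric_surface G M A"
    and covering: "universal_covering G M A p"
    and generic: "generic_regular_curve M A \<gamma>"
    and essential: "\<not> null_homotopic_curve M \<gamma>"
begin

abbreviation cur :: "real \<Rightarrow> 'm" where "cur t \<equiv> \<gamma> (circle_cover t)"

section \<open>Existence and uniqueness of covers and deck transformations\<close>

lemma cov: "covering_space (plane G) p M"
  using covering by (simp add: universal_covering_def)

lemma cont_p: "continuous_on (plane G) p" and p_in: "z \<in> plane G \<Longrightarrow> p z \<in> M"
  using cov by (auto simp: covering_space_def)

lemma regular: "regular_closed_curve M A \<gamma>"
  using generic by (simp add: generic_regular_curve_def)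

lemma cur_in: "cur t \<in> M"
  using regular by (auto simp: regular_closed_curve_def image_subset_iff)

lemma cont_cur: "continuous_on UNIV cur"
proof -
  have "continuous_on (sphere 0 1) \<gamma>" using regular by (simp add: regular_closed_curve_def)
  then show ?thesis
    by (rule continuous_on_compose2) (auto intro!: continuous_intros)
qed

lemma coverD:
  assumes "is_cover G p \<gamma> h"
  shows "continuous_on UNIV h" "h t \<in> plane G" "p (h t) = cur t"
  using assms by (auto simp: is_cover_def)

lemma cover_through:
  assumes "z \<in> plane G" "p z = cur t"
  obtains h where "is_cover G p \<gamma> h" "h t = z"
proof -
  have "cur ` UNIV \<subseteq> M" using cur_in by blast
  then obtain h where "continuous_on UNIV h" "h ` UNIV \<subseteq> plane G" "h t = z" "\<And>s. s \<in> UNIV \<Longrightarrow> p (h s) = cur s"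
    using covering_space_lift_convex[OF cov convex_UNIV UNIV_I cont_cur _ assms] by metis
  then have "is_cover G p \<gamma> h" by (simp add: is_cover_def image_subset_iff)
  then show thesis using that \<open>h t = z\<close> by blast
qed

lemma cover_exists: obtains h where "is_cover G p \<gamma> h"
proof -
  have "cur 0 \<in> p ` plane G" using cur_in cov by (simp add: covering_space_def)
  then show thesis using cover_through[of _ 0] that by (metis imageE)
qed

lemma cover_unique:
  assumes h: "is_cover G p \<gamma> h1" "is_cover G p \<gamma> h2" and "h1 t = h2 t"
  shows "h1 s = h2 s"
  by (rule covering_space_lift_unique[OF cov, of h1 t h2 UNIV cur s])
     (use coverD[OF h(1)] coverD[OF h(2)] cur_in cont_cur assms(3) in auto)

lemma deck_unique:
  assumes T: "deck_transformation G p T1" "deck_transformation G p T2"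
    and z: "z \<in> plane G" "T1 z = T2 z" and w: "w \<in> plane G"
  shows "T1 w = T2 w"
proof -
  have c: "continuous_on (plane G) T1" "continuous_on (plane G) T2"
    using T unfolding deck_transformation_def homeomorphism_def by blast+
  show ?thesis
    by (rule covering_space_lift_unique[OF cov, of T1 z T2 "plane G" p w])
       (use z w T c p_in cont_p convex_connected[OF convex_plane]
         deck_transformation_in[OF T(1)] deck_transformation_in[OF T(2)]
        in \<open>auto simp: deck_transformation_def\<close>)
qed

text \<open>T and S are lifts of p through p itself, sending z to w and w to z. Both composites lift
  p and fix a point, so they are the identity.\<close>

lemma deck_through:
  assumes z: "z \<in> plane G" "w \<in> plane G" "p z = p w"
  obtains T where "deck_transformation G p T" "T z = w"
proof -
  have lift: "\<exists>g. continuous_on (plane G) g \<and> g ` plane G \<subseteq> plane G \<and> g a = b \<and> (\<forall>y\<in>plane G. p (g y) = p y)"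
    if "a \<in> plane G" "b \<in> plane G" "p a = p b" for a b
    by (rule covering_space_lift_convex[OF cov convex_plane that(1) cont_p _ that(2)])
      (use that(3) p_in in auto)
  obtain T where T: "continuous_on (plane G) T" "T ` plane G \<subseteq> plane G" "T z = w"
    "\<And>y. y \<in> plane G \<Longrightarrow> p (T y) = p y"
    using lift[OF z] by metis
  obtain S where S: "continuous_on (plane G) S" "S ` plane G \<subseteq> plane G" "S w = z"
    "\<And>y. y \<in> plane G \<Longrightarrow> p (S y) = p y"
    using lift[OF z(2,1)] z(3) by metis
  have id: "f (g y) = y"
    if f: "continuous_on (plane G) f" "f ` plane G \<subseteq> plane G" "\<And>y. y \<in> plane G \<Longrightarrow> p (f y) = p y"
    and g: "continuous_on (plane G) g" "g ` plane G \<subseteq> plane G" "\<And>y. y \<in> plane G \<Longrightarrow> p (g y) = p y"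
    and a: "a \<in> plane G" "f (g a) = a" and y: "y \<in> plane G" for f g a y
  proof (rule covering_space_lift_unique[OF cov, of "\<lambda>y. f (g y)" a "\<lambda>y. y" "plane G" p y])
    show "continuous_on (plane G) (\<lambda>y. f (g y))" by (rule continuous_on_compose2[OF f(1) g(1,2)])
  qed (use f g a y p_in cont_p convex_connected[OF convex_plane] in \<open>auto simp: image_subset_iff\<close>)
  have "S (T y) = y" "T (S y) = y" if "y \<in> plane G" for y
    using id[OF S(1,2,4) T(1,2,4) z(1) _ that] id[OF T(1,2,4) S(1,2,4) z(2) _ that] S(3) T(3) by auto
  then have "homeomorphism (plane G) (plane G) T S"
    using T S by (intro homeomorphismI) auto
  then show thesis using that[of T] T by (auto simp: deck_transformation_def)
qed

lemma deck_cover: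
  assumes "deck_transformation G p T" "is_cover G p \<gamma> h"
  shows "is_cover G p \<gamma> (\<lambda>t. T (h t))"
proof -
  have "continuous_on (plane G) T" using assms(1) unfolding deck_transformation_def homeomorphism_def by blast
  then have "continuous_on UNIV (\<lambda>t. T (h t))"
    by (rule continuous_on_compose2) (use coverD[OF assms(2)] in auto)
  then show ?thesis
    using coverD[OF assms(2)] assms(1) deck_transformation_in[OF assms(1)]
    by (auto simp: is_cover_def deck_transformation_def)
qed

lemma shift_cover:
  assumes "is_cover G p \<gamma> h"
  shows "is_cover G p \<gamma> (\<lambda>t. h (t + of_int n))"
proof -
  have "circle_cover (t + of_int n) = circle_cover t" for t
    using circle_cover_eq_iff[of t "t + of_int n"] by metis
  then show ?thesis using coverD[OF assms] unfolding is_cover_def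
    by (auto intro!: continuous_on_compose2[of UNIV h] continuous_intros)
qed

lemma cover_deck:
  assumes h: "is_cover G p \<gamma> h1" "is_cover G p \<gamma> h2"
  obtains S where "deck_transformation G p S" "\<And>t. h2 t = S (h1 t)"
proof -
  obtain S where S: "deck_transformation G p S" "S (h1 0) = h2 0"
    using deck_through[of "h1 0" "h2 0"] coverD[OF h(1)] coverD[OF h(2)] by metis
  have "h2 t = S (h1 t)" for t
    using cover_unique[OF h(2) deck_cover[OF S(1) h(1)], of 0 t] S(2) by simp
  then show thesis using that S by blast
qed

section \<open>Regularity and transversality of covers\<close>

lemma chart_at:
  obtains U c where "(U, c) \<in> A" "cur t \<in> U" "open {s. cur s \<in> U}"
proof -
  obtain U c where U: "(U, c) \<in> A" "cur t \<in> U" using charts_cover[OF surface cur_in[of t]] by blast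
  have "\<forall>(U, c)\<in>A. openin (top_of_set M) U \<and> open (c ` U) \<and> c ` U \<subseteq> plane G \<and>
                  (\<exists>c'. homeomorphism U (c ` U) c c')"
    using surface unfolding geometric_surface_def by (elim conjE)
  then have "openin (top_of_set M) U" using U(1) by blast
  then have "openin (top_of_set UNIV) (UNIV \<inter> cur -` U)"
    using continuous_openin_preimage[OF cont_cur] cur_in by blast
  then have "open {s. cur s \<in> U}" by (simp add: vimage_def)
  then show thesis using U that by blast
qed

lemma chart_regular:
  assumes "(U, c) \<in> A"
  shows "(\<lambda>t. c (cur t)) C1_differentiable_on {t. cur t \<in> U}"
    and "cur t \<in> U \<Longrightarrow> velocity c \<gamma> t \<noteq> 0"
proof -
  have "\<forall>(U, c)\<in>A.
        (\<lambda>t. c (cur t)) C1_differentiable_on {t. cur t \<in> U} \<and>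
        (\<forall>t. cur t \<in> U \<longrightarrow> velocity c \<gamma> t \<noteq> 0)"
    using regular unfolding regular_closed_curve_def by (elim conjE)
  then show "(\<lambda>t. c (cur t)) C1_differentiable_on {t. cur t \<in> U}"
    "cur t \<in> U \<Longrightarrow> velocity c \<gamma> t \<noteq> 0" using assms by auto
qed

text \<open>Near t the cover is k after q, where q is the curve read in a chart and k the
  holomorphic inverse of the isometry that p becomes in that chart. Regularity of \<gamma> thus
  passes to the cover.\<close>

lemma cover_C1_local:
  assumes h: "is_cover G p \<gamma> h"
  obtains N D where "open N" "t \<in> N" "continuous_on N D"
    "\<And>s. s \<in> N \<Longrightarrow> (h has_vector_derivative D s) (at s) \<and> D s \<noteq> 0"
proof -
  obtain U c where U: "(U, c) \<in> A" "cur t \<in> U" "open {s. cur s \<in> U}" by (rule chart_at)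
  define q where "q s = c (cur s)" for s
  obtain D where D: "\<And>s. cur s \<in> U \<Longrightarrow> (q has_vector_derivative D s) (at s)"
    "continuous_on {s. cur s \<in> U} D"
    using chart_regular(1)[OF U(1)] unfolding C1_differentiable_on_def q_def by auto
  have D0: "D s \<noteq> 0" if "cur s \<in> U" for s
    using chart_regular(2)[OF U(1) that] vector_derivative_at[OF D(1)[OF that]]
    by (simp add: velocity_def q_def[abs_def])
  have ht: "h t \<in> plane G" "p (h t) \<in> U" using coverD[OF h] U(2) by auto
  obtain g where g: "oriented_isometry G g" "\<forall>\<^sub>F w in nhds (h t). c (p w) = g w"
    using universal_covering_chart[OF covering U(1) ht] by blast
  obtain W where W: "open W" "h t \<in> W" "\<And>w. w \<in> W \<Longrightarrow> c (p w) = g w"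
    using g(2) unfolding eventually_nhds by blast
  obtain k where k: "k holomorphic_on plane G"
    "\<And>z. z \<in> plane G \<Longrightarrow> deriv g z * deriv k (g z) = 1"
    "\<And>z. z \<in> plane G \<Longrightarrow> k (g z) = z"
    using oriented_isometry_inverse[OF g(1)] by metis
  define N where "N = {s. cur s \<in> U} \<inter> h -` W"
  have N: "open N" "t \<in> N"
    unfolding N_def using U W(1,2) coverD(1)[OF h] by (auto intro!: open_Int simp: open_vimage)
  have hk: "h s = k (q s)" "q s = g (h s)" if "s \<in> N" for s
  proof -
    have "c (p (h s)) = g (h s)" using that W(3) by (simp add: N_def)
    then show "q s = g (h s)" by (simp add: q_def coverD(3)[OF h])
    then show "h s = k (q s)" using k(3) coverD(2)[OF h] by simp
  qed
  have gin: "g z \<in> plane G" if "z \<in> plane G" for z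
    using g(1) plane_isometry_in that unfolding oriented_isometry_def by blast
  have qin: "q s \<in> plane G" if "s \<in> N" for s
    using hk(2)[OF that] gin coverD(2)[OF h] by simp
  define E where "E s = D s * deriv k (q s)" for s
  have "(h has_vector_derivative E s) (at s) \<and> E s \<noteq> 0" if s: "s \<in> N" for s
  proof
    have "(k has_field_derivative deriv k (q s)) (at (q s))"
      using k(1) open_plane qin[OF s] holomorphic_derivI by blast
    moreover have "(q has_vector_derivative D s) (at s)" using D(1) s by (simp add: N_def)
    ultimately have "((k \<circ> q) has_vector_derivative E s) (at s)"
      unfolding E_def by (rule field_vector_diff_chain_at[rotated])
    then show "(h has_vector_derivative E s) (at s)"
      by (rule has_vector_derivative_transform_within_open[OF _ N(1) s]) (simp add: hk(1))
    have "deriv k (q s) \<noteq> 0" using k(2)[of "h s"] coverD(2)[OF h] hk(2)[OF s] by auto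
    then show "E s \<noteq> 0" using D0[of s] s by (simp add: E_def N_def)
  qed
  moreover have "continuous_on N E"
  proof -
    have "continuous_on N D" by (rule continuous_on_subset[OF D(2)]) (auto simp: N_def)
    moreover have "continuous_on N q"
      using D(1) by (intro continuous_on_vector_derivative) (auto simp: N_def intro: has_vector_derivative_at_within)
    moreover have "continuous_on (plane G) (deriv k)"
      using holomorphic_deriv[OF k(1) open_plane] holomorphic_on_imp_continuous_on by blast
    ultimately show ?thesis unfolding E_def
      using qin by (intro continuous_intros continuous_on_compose2[of "plane G" "deriv k" N q]) auto
  qed
  ultimately show thesis using that N by blast
qed

abbreviation vd :: "(real \<Rightarrow> complex) \<Rightarrow> real \<Rightarrow> complex" where
  "vd h t \<equiv> vector_derivative h (at t)"

lemma cover_C1: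
  assumes h: "is_cover G p \<gamma> h"
  shows "(h has_vector_derivative vd h t) (at t)" "vd h t \<noteq> 0" "continuous_on UNIV (vd h)"
proof -
  have 1: "(h has_vector_derivative vd h t) (at t) \<and> vd h t \<noteq> 0 \<and> isCont (vd h) t" for t
  proof -
    obtain N D where N: "open N" "t \<in> N" "continuous_on N D"
      "\<And>s. s \<in> N \<Longrightarrow> (h has_vector_derivative D s) (at s) \<and> D s \<noteq> 0"
      using cover_C1_local[OF h] by metis
    then have "continuous_on N (vd h)"
      using continuous_on_cong vector_derivative_at by (metis (no_types, lifting))
    then have "isCont (vd h) t" using N continuous_on_eq_continuous_at by blast
    moreover have "vd h t = D t" using N(2,4) vector_derivative_at by blast
    ultimately show ?thesis using N(2,4) by metis
  qed
  show "(h has_vector_derivative vd h t) (at t)" "vd h t \<noteq> 0" using 1 by auto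
  show "continuous_on UNIV (vd h)" using 1 by (simp add: continuous_on_eq_continuous_at)
qed

lemma velocity_cover:
  assumes h: "is_cover G p \<gamma> h" and g: "oriented_isometry G g" "\<forall>\<^sub>F w in nhds (h t). c (p w) = g w"
  shows "velocity c \<gamma> t = vd h t * deriv g (h t)"
proof -
  have "(g has_field_derivative deriv g (h t)) (at (h t))"
    using oriented_isometry_holomorphic[OF g(1)] open_plane coverD(2)[OF h] holomorphic_derivI by blast
  then have 1: "((g \<circ> h) has_vector_derivative vd h t * deriv g (h t)) (at t)"
    using cover_C1(1)[OF h] field_vector_diff_chain_at by blast
  have "isCont h t" using coverD(1)[OF h] continuous_on_eq_continuous_at by blast
  then have "\<forall>\<^sub>F s in nhds t. c (p (h s)) = g (h s)"
    using g(2) unfolding isCont_def tendsto_at_iff_tendsto_nhds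
    by (rule eventually_compose_filterlim[rotated])
  then have ev: "\<forall>\<^sub>F s in nhds t. c (cur s) = (g \<circ> h) s" using coverD(3)[OF h] by simp
  have "((\<lambda>s. c (cur s)) has_vector_derivative vd h t * deriv g (h t)) (at t)"
  proof -
    obtain N where "open N" "t \<in> N" "\<And>s. s \<in> N \<Longrightarrow> c (cur s) = (g \<circ> h) s"
      using ev unfolding eventually_nhds by blast
    then show ?thesis using has_vector_derivative_transform_within_open[OF 1] by simp
  qed
  then show ?thesis unfolding velocity_def by (rule vector_derivative_at)
qed

text \<open>At a common point both velocities are multiplied by the same nonzero number when read in
  a chart, so transversality of \<gamma> passes to covers. The two covers may differ, which allows
  crossings whose loops do not lift to closed ones.\<close>

lemma cover_transversal:
  assumes h: "is_cover G p \<gamma> h1" "is_cover G p \<gamma> h2"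
    and "circle_cover s \<noteq> circle_cover t" "h1 s = h2 t"
  shows "oriented_area (vd h1 s) (vd h2 t) \<noteq> 0"
proof -
  have eq: "cur s = cur t" using coverD(3)[OF h(1)] coverD(3)[OF h(2)] assms(4) by metis
  obtain U c where U: "(U, c) \<in> A" "cur s \<in> U" by (rule chart_at)
  have "\<forall>s t. circle_cover s \<noteq> circle_cover t \<longrightarrow> cur s = cur t \<longrightarrow>
        (\<forall>(U, c)\<in>A. cur s \<in> U \<longrightarrow>
           oriented_area (velocity c \<gamma> s) (velocity c \<gamma> t) \<noteq> 0)"
    using generic unfolding generic_regular_curve_def by (elim conjE)
  then have ne: "oriented_area (velocity c \<gamma> s) (velocity c \<gamma> t) \<noteq> 0"
    using U eq assms(3) by blast
  obtain g where g: "oriented_isometry G g" "\<forall>\<^sub>F w in nhds (h1 s). c (p w) = g w"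
    using universal_covering_chart[OF covering U(1)] U(2) coverD[OF h(1)] by metis
  have "velocity c \<gamma> s = vd h1 s * deriv g (h1 s)" "velocity c \<gamma> t = vd h2 t * deriv g (h1 s)"
    using velocity_cover[OF h(1) g] velocity_cover[OF h(2) g(1)] g(2) assms(4) by metis+
  then show ?thesis using ne by (simp add: oriented_area_mult)
qed

text \<open>A fixed point would make T the identity and h a 1-periodic curve. Such a loop contracts
  linearly in the convex plane, and p carries the contraction to a null homotopy of \<gamma>,
  against \<open>essential\<close>.\<close>

lemma shift_deck:
  assumes h: "is_cover G p \<gamma> h"
  obtains T where "deck_transformation G p T" "\<And>t. T (h t) = h (t + 1)"
    "\<And>z. z \<in> plane G \<Longrightarrow> T z \<noteq> z"
proof -
  obtain T where T: "deck_transformation G p T" "\<And>t. h (t + of_int 1) = T (h t)"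
    using cover_deck[OF h shift_cover[OF h]] by metis
  have "T z \<noteq> z" if z: "z \<in> plane G" for z
  proof
    assume fp: "T z = z"
    have "deck_transformation G p (\<lambda>z. z)"
      unfolding deck_transformation_def by (intro conjI exI[of _ "\<lambda>z. z"] homeomorphismI) auto
    then have id: "T w = w" if "w \<in> plane G" for w
      using deck_unique[OF T(1) _ z _ that] fp by metis
    have per: "h (t + 1) = h t" for t using T(2)[of t] id coverD(2)[OF h] by simp
    have "homotopic_loops (plane G) h (\<lambda>_. h 0)"
    proof (rule homotopic_loops_linear)
      show "path h" using coverD(1)[OF h] continuous_on_subset unfolding path_def by blast
      show "closed_segment (h t) (h 0) \<subseteq> plane G" for t
        using convex_plane coverD(2)[OF h] closed_segment_subset by blast
      show "pathfinish h = pathstart h" using per[of 0] by (simp add: pathfinish_def pathstart_def)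
    qed (simp_all add: path_def pathfinish_def pathstart_def)
    then have "homotopic_loops M (p \<circ> h) (p \<circ> (\<lambda>_. h 0))"
      by (rule homotopic_loops_continuous_image[OF _ cont_p]) (use p_in in auto)
    then have *: "homotopic_with_canon (\<lambda>_. True) (sphere 0 1) M
        ((p \<circ> h) \<circ> (\<lambda>z. Arg2pi z / (2 * pi))) ((p \<circ> (\<lambda>_. h 0)) \<circ> (\<lambda>z. Arg2pi z / (2 * pi)))"
      by (rule homotopic_loops_imp_homotopic_circlemaps)
    have "homotopic_with_canon (\<lambda>_. True) (sphere 0 1) M \<gamma> (\<lambda>_. p (h 0))"
    proof (rule homotopic_with_eq[OF *])
      fix z :: complex assume "z \<in> topspace (top_of_set (sphere 0 1))"
      then have "cmod z = 1" by simp
      then have "circle_cover (Arg2pi z / (2 * pi)) = z"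
        using Arg2pi_eq[of z] by (simp add: circle_cover_def cis_conv_exp)
      then show "\<gamma> z = ((p \<circ> h) \<circ> (\<lambda>z. Arg2pi z / (2 * pi))) z"
        using coverD(3)[OF h] by simp
    qed auto
    then show False using essential unfolding null_homotopic_curve_def by blast
  qed
  then show thesis using that T by simp
qed

text \<open>If the two values differ, they differ nearby. At a crossing, the difference of the two
  covers has an injective derivative by transversality. If both parameters give the same point of
  the circle, an immersion is locally injective there. Compactness of the square of parameters will
  turn this into finiteness.\<close>

lemma double_pairs_isolated:
  "\<forall>\<^sub>F w in at (s0, t0). \<not> (cur (fst w) = cur (snd w) \<and> circle_cover (fst w) \<noteq> circle_cover (snd w))"
proof (cases "cur s0 = cur t0")
  case False
  have "open {w. cur (fst w) \<noteq> cur (snd w)}"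
    by (intro open_Collect_neq continuous_on_compose2[OF cont_cur] continuous_intros) auto
  then have "\<forall>\<^sub>F w in nhds (s0, t0). w \<in> {w. cur (fst w) \<noteq> cur (snd w)}"
    using False by (intro eventually_nhds_in_open) auto
  then show ?thesis by (auto simp: eventually_at_filter elim: eventually_mono)
next
  case True
  obtain h1 where h1: "is_cover G p \<gamma> h1" by (rule cover_exists)
  obtain h2 where h2: "is_cover G p \<gamma> h2" "h2 t0 = h1 s0"
    using cover_through[of "h1 s0" t0] coverD[OF h1] True by metis
  obtain V where V: "openin (top_of_set (plane G)) V" "h1 s0 \<in> V" "inj_on p V"
    using covering_space_locally_injective[OF cov coverD(2)[OF h1]] by blast
  have opV: "open V" using V(1) open_plane openin_open_trans by (metis openin_open_eq)
  have cont: "continuous_on UNIV (\<lambda>w. h1 (fst w))" "continuous_on UNIV (\<lambda>w. h2 (snd w))"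
    by (rule continuous_on_compose2[OF coverD(1)[OF h1]] continuous_on_compose2[OF coverD(1)[OF h2(1)]],
        auto intro!: continuous_intros)+
  have "\<forall>\<^sub>F w in at (s0, t0). h1 (fst w) \<in> V" "\<forall>\<^sub>F w in at (s0, t0). h2 (snd w) \<in> V"
    using eventually_at_in_open'[OF open_vimage[OF opV cont(1)], of "(s0, t0)"]
      eventually_at_in_open'[OF open_vimage[OF opV cont(2)], of "(s0, t0)"] V(2) h2(2) by simp_all
  \<comment> \<open>Near the common point p is injective, so nearby coincidences on the surface are
    coincidences of the covers.\<close>
  then have same: "\<forall>\<^sub>F w in at (s0, t0). cur (fst w) = cur (snd w) \<longrightarrow> h1 (fst w) = h2 (snd w)"
  proof eventually_elim
    case (elim w)
    then show ?case using inj_onD[OF V(3), of "h1 (fst w)" "h2 (snd w)"] coverD(3)[OF h1] coverD(3)[OF h2(1)] by simp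
  qed
  show ?thesis
  proof (cases "circle_cover s0 = circle_cover t0")
    case False
    define u v where "u = vd h1 s0" and "v = vd h2 t0"
    have area: "oriented_area u v \<noteq> 0"
      using cover_transversal[OF h1 h2(1) False] h2(2) by (simp add: u_def v_def)
    define D where "D w = fst w *\<^sub>R u - snd w *\<^sub>R v" for w :: "real \<times> real"
    have "\<forall>\<^sub>F w in at (s0, t0). h1 (fst w) - h2 (snd w) \<noteq> 0"
    proof (rule linear_has_isolated_zero)
      have "(h1 has_derivative (\<lambda>x. x *\<^sub>R u)) (at (fst (s0, t0)))"
           "(h2 has_derivative (\<lambda>x. x *\<^sub>R v)) (at (snd (s0, t0)))"
        using cover_C1(1)[OF h1] cover_C1(1)[OF h2(1)] by (auto simp: has_vector_derivative_def u_def v_def)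
      then show "((\<lambda>w. h1 (fst w) - h2 (snd w)) has_derivative D) (at (s0, t0))"
        unfolding D_def by (intro has_derivative_diff)
          (rule has_derivative_compose[OF has_derivative_fst[OF has_derivative_ident]] 
                has_derivative_compose[OF has_derivative_snd[OF has_derivative_ident]], assumption)+
      have "w = 0" if "D w = 0" for w
      proof -
        have 1: "fst w * Re u = snd w * Re v" "fst w * Im u = snd w * Im v"
          using that by (auto simp: D_def complex_eq_iff)
        have "fst w * oriented_area u v = (fst w * Re u) * Im v - (fst w * Im u) * Re v"
          by (simp add: oriented_area_def algebra_simps)
        also have "\<dots> = 0" unfolding 1 by simp
        finally have "fst w * oriented_area u v = 0" .
        moreover have "snd w * oriented_area u v = Re u * (snd w * Im v) - Im u * (snd w * Re v)"
          by (simp add: oriented_area_def algebra_simps)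
        then have "snd w * oriented_area u v = 0" unfolding 1[symmetric] by simp
        ultimately have "fst w = 0" "snd w = 0" using area by simp_all
        then show "w = 0" by (simp add: prod_eq_iff)
      qed
      moreover have "linear D" unfolding D_def
        by (intro linearI) (auto simp: algebra_simps)
      ultimately show "inj D" by (simp add: linear_injective_0)
    qed (simp add: h2(2))
    with same show ?thesis by eventually_elim auto
  next
    case True
    then obtain n where n: "t0 = s0 + of_int n" using circle_cover_eq_iff by blast
    have sh: "h2 (t + of_int n) = h1 t" for t
      using cover_unique[OF shift_cover[OF h2(1), of n] h1, of s0 t] h2(2) n by simp
    define u where "u = vd h1 s0"
    have u: "u \<noteq> 0" using cover_C1(2)[OF h1] by (simp add: u_def)
    \<comment> \<open>This real part is |u| times the component of the velocity in the direction u.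
      It stays positive near s0, so h1 advances strictly in that direction and does not
      return.\<close>
    have "open {s. 0 < Re (vd h1 s * cnj u)}"
      by (intro open_Collect_less continuous_intros cover_C1(3)[OF h1])
    moreover have "s0 \<in> {s. 0 < Re (vd h1 s * cnj u)}"
      using complex_neq_0[of u] u by (simp add: u_def power2_eq_square)
    ultimately obtain e where e: "e > 0" "\<And>s. dist s s0 < e \<Longrightarrow> Re (vd h1 s * cnj u) > 0"
      unfolding open_dist by blast
    have "\<forall>\<^sub>F w in at (s0, t0). dist (fst w) s0 < e" "\<forall>\<^sub>F w in at (s0, t0). dist (snd w) t0 < e"
      using e(1) tendsto_fst[OF tendsto_ident_at, of "(s0, t0)" UNIV]
        tendsto_snd[OF tendsto_ident_at, of "(s0, t0)" UNIV] by (auto dest: tendstoD)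
    with same show ?thesis
    proof eventually_elim
      case (elim w)
      define a b where "a = fst w" and "b = snd w - of_int n"
      have ab: "dist a s0 < e" "dist b s0 < e" using elim n by (auto simp: a_def b_def dist_real_def)
      have mono: "Re (h1 x * cnj u) < Re (h1 y * cnj u)" if "dist x s0 < e" "dist y s0 < e" "x < y" for x y
      proof (rule DERIV_pos_imp_increasing[OF that(3)])
        fix z assume z: "x \<le> z" "z \<le> y"
        have "((\<lambda>s. Re (h1 s * cnj u)) has_vector_derivative Re (vd h1 z * cnj u)) (at z)"
          by (rule bounded_linear.has_vector_derivative[OF bounded_linear_compose[OF
                bounded_linear_Re bounded_linear_mult_left] cover_C1(1)[OF h1]])
        then have "DERIV (\<lambda>s. Re (h1 s * cnj u)) z :> Re (vd h1 z * cnj u)"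
          by (simp add: has_real_derivative_iff_has_vector_derivative)
        moreover have "dist z s0 < e" using that z by (auto simp: dist_real_def)
        ultimately show "\<exists>d. DERIV (\<lambda>s. Re (h1 s * cnj u)) z :> d \<and> d > 0" using e(2) by blast
      qed
      show ?case
      proof
        assume *: "cur (fst w) = cur (snd w) \<and> circle_cover (fst w) \<noteq> circle_cover (snd w)"
        then have "h1 a = h1 b" using elim(1) sh[of b] by (simp add: a_def b_def)
        then have "a = b" using mono[OF ab] mono[OF ab(2,1)] by (metis less_irrefl linorder_neqE_linordered_idom)
        then have "snd w = fst w + of_int n" by (simp add: a_def b_def)
        then show False using * circle_cover_eq_iff by blast
      qed
    qed
  qed
qed

lemma finite_double_points: "finite (double_points \<gamma>)"
proof -
  define P where "P = {w \<in> {0..1} \<times> {0..1}. cur (fst w) = cur (snd w) \<and> circle_cover (fst w) \<noteq> circle_cover (snd w)}"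
  have "finite P"
  proof (rule locally_finite_compact_imp_finite)
    show "compact ({0..1::real} \<times> {0..1::real})" by (intro compact_Times compact_Icc)
    show "\<forall>\<^sub>F y in at x. y \<notin> P" for x
      using double_pairs_isolated[of "fst x" "snd x"] by (auto simp: P_def elim: eventually_mono)
  qed (auto simp: P_def)
  moreover have "double_points \<gamma> \<subseteq> (\<lambda>w. cur (fst w)) ` P"
  proof
    fix d assume "d \<in> double_points \<gamma>"
    then obtain z w where zw: "z \<in> sphere 0 1" "w \<in> sphere 0 1" "z \<noteq> w" "\<gamma> z = d" "\<gamma> w = d"
      unfolding double_points_def by blast
    obtain s where s: "0 \<le> s" "s < 1" "circle_cover s = z" using circle_cover_surj[OF zw(1)] by blast
    obtain t where t: "0 \<le> t" "t < 1" "circle_cover t = w" using circle_cover_surj[OF zw(2)] by blast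
    have "(s, t) \<in> P" using s t zw by (simp add: P_def)
    then show "d \<in> (\<lambda>w. cur (fst w)) ` P" using s zw(4) by force
  qed
  ultimately show ?thesis by (rule finite_surj)
qed

text \<open>A null homotopy lifts and closes up the lifted path; conversely a closed lift contracts
  linearly in the convex plane, and p carries the contraction down.\<close>

lemma null_sub_loop_iff:
  assumes h: "is_cover G p \<gamma> h" and d: "p (h a) = d"
  shows "homotopic_paths M (sub_loop \<gamma> a b) (\<lambda>_. d) \<longleftrightarrow> h a = h b"
proof
  define k where "k u = h ((1 - u) * a + u * b)" for u
  have k: "continuous_on {0..1} k"
    unfolding k_def by (rule continuous_on_compose2[OF coverD(1)[OF h]]) (auto intro!: continuous_intros)
  have pk: "sub_loop \<gamma> a b = p \<circ> k" using coverD(3)[OF h] by (simp add: sub_loop_def k_def fun_eq_iff)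
  show "h a = h b" if "homotopic_paths M (sub_loop \<gamma> a b) (\<lambda>_. d)"
  proof -
    have "k 0 = k 1"
      by (rule covering_space_null_loop_lift[OF cov that k])
         (use coverD(2)[OF h] in \<open>auto simp: pk k_def\<close>)
    then show ?thesis by (simp add: k_def)
  qed
  assume eq: "h a = h b"
  have "homotopic_paths (plane G) k (\<lambda>_. h a)"
  proof (rule homotopic_paths_linear)
    show "path k" using k by (simp add: path_def)
    show "closed_segment (k t) (h a) \<subseteq> plane G" for t
      using convex_plane coverD(2)[OF h] closed_segment_subset unfolding k_def by blast
  qed (use eq in \<open>simp_all add: path_def pathstart_def pathfinish_def k_def\<close>)
  then have "homotopic_paths M (p \<circ> k) (p \<circ> (\<lambda>_. h a))"
    by (rule homotopic_paths_continuous_image[OF _ cont_p]) (use p_in in auto)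
  then show "homotopic_paths M (sub_loop \<gamma> a b) (\<lambda>_. d)" using d by (simp add: pk o_def)
qed

text \<open>T agrees with the fixed-point-free map of \<open>shift_deck\<close> at h 0, hence
  everywhere, so the translation coordinate exists for any T that shifts h.\<close>

lemma straightening:
  assumes h: "is_cover G p \<gamma> h" and T: "deck_transformation G p T" "\<And>t. T (h t) = h (t + 1)"
  obtains \<psi> \<phi> where "\<psi> holomorphic_on plane G" "inj_on \<psi> (plane G)"
    "one_parameter_isometry_group G \<phi>" "\<And>z. z \<in> plane G \<Longrightarrow> \<phi> 1 z = T z"
    "\<And>s z. z \<in> plane G \<Longrightarrow> \<psi> (\<phi> s z) = \<psi> z + of_real s"
    "\<And>\<phi>' s. one_parameter_isometry_group G \<phi>' \<Longrightarrow> \<forall>z\<in>plane G. \<phi>' 1 z = T z \<Longrightarrow>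
       \<exists>\<beta>. \<forall>z\<in>plane G. \<psi> (\<phi>' s z) = \<psi> z + \<beta>"
    "\<And>t. \<psi> (h (t + 1)) = \<psi> (h t) + 1"
proof -
  obtain T0 where T0: "deck_transformation G p T0" "\<And>t. T0 (h t) = h (t + 1)"
    "\<And>z. z \<in> plane G \<Longrightarrow> T0 z \<noteq> z"
    using shift_deck[OF h] by metis
  have TT: "T z = T0 z" if "z \<in> plane G" for z
    using deck_unique[OF T(1) T0(1) coverD(2)[OF h, of 0] _ that] T(2) T0(2) by simp
  have T': "T z \<in> plane G \<and> (\<exists>a. (T has_field_derivative a) (at z) \<and>
      cmod a = scale_factor G (T z) / scale_factor G z)" if z: "z \<in> plane G" for z
    using deck_transformation_derivative[OF surface covering T(1) z] deck_transformation_in[OF T(1) z]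
    by metis
  have fpf: "T z \<noteq> z" if "z \<in> plane G" for z using T0(3) TT that by simp
  obtain \<psi> \<phi> where \<psi>: "\<psi> holomorphic_on plane G" "inj_on \<psi> (plane G)"
    "one_parameter_isometry_group G \<phi>" "\<And>z. z \<in> plane G \<Longrightarrow> \<phi> 1 z = T z"
    "\<And>s z. z \<in> plane G \<Longrightarrow> \<psi> (\<phi> s z) = \<psi> z + of_real s"
    "\<And>\<phi>' s. one_parameter_isometry_group G \<phi>' \<Longrightarrow> (\<And>z. z \<in> plane G \<Longrightarrow> \<phi>' 1 z = T z) \<Longrightarrow>
       \<exists>\<beta>. \<forall>z\<in>plane G. \<psi> (\<phi>' s z) = \<psi> z + \<beta>"
    using translation_coordinate_exists[OF T' fpf] by blast
  have shift: "\<psi> (h (t + 1)) = \<psi> (h t) + 1" for t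
    using \<psi>(5)[of "h t" 1] \<psi>(4)[of "h t"] T(2) coverD(2)[OF h] by simp
  have six: "\<exists>\<beta>. \<forall>z\<in>plane G. \<psi> (\<phi>' s z) = \<psi> z + \<beta>"
    if "one_parameter_isometry_group G \<phi>'" "\<forall>z\<in>plane G. \<phi>' 1 z = T z" for \<phi>' s
    using \<psi>(6)[OF that(1)] that(2) by blast
  show thesis by (rule that[of \<psi> \<phi>]) (fact \<psi> shift six)+
qed

text \<open>In the straightening coordinate an integer shift of the parameter adds that integer, so
  different shifts of one point never coincide.\<close>

lemma cover_int_shift:
  assumes h: "is_cover G p \<gamma> h" and "h s = h t"
  shows "h (s + of_int m) = h (t + of_int n) \<longleftrightarrow> m = n"
proof -
  obtain T where T: "deck_transformation G p T" "\<And>t. T (h t) = h (t + 1)"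
    using shift_deck[OF h] by metis
  obtain \<psi> :: "complex \<Rightarrow> complex" where \<psi>: "inj_on \<psi> (plane G)" "\<And>t. \<psi> (h (t + 1)) = \<psi> (h t) + 1"
    by (rule straightening[OF h T], rule that)
  have "h (s + of_int m) = h (t + of_int n) \<longleftrightarrow> \<psi> (h (s + of_int m)) = \<psi> (h (t + of_int n))"
    using inj_on_eq_iff[OF \<psi>(1)] coverD(2)[OF h] by metis
  then show ?thesis
    using translation_by_int[of "\<lambda>t. \<psi> (h t)", OF \<psi>(2)] assms(2) by simp
qed

text \<open>d has exactly two preimages on the circle, so t1 and t2 are a and b up to order and
  integers. \<open>cover_int_shift\<close> makes the two integers equal, and t1 < t2 excludes the
  exchanged order. Independence of the sign from its choices rests on this.\<close>

lemma cover_double_point_parameters: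
  assumes h: "is_cover G p \<gamma> h" and ab: "a < b" "b < a + 1" "h a = h b"
    and h': "is_cover G p \<gamma> h'" and t: "t1 < t2" "h' t1 = h' t2" "p (h' t1) = cur a"
  obtains n :: int where "t1 = a + of_int n" "t2 = b + of_int n"
proof -
  obtain S where S: "deck_transformation G p S" "\<And>t. h' t = S (h t)" using cover_deck[OF h h'] by metis
  have "inj_on S (plane G)"
    using S(1) unfolding deck_transformation_def by (metis homeomorphism_apply1 inj_onI)
  then have ht: "h t1 = h t2" using t(2) S(2) coverD(2)[OF h] by (simp add: inj_on_eq_iff)
  have ne: "circle_cover t1 \<noteq> circle_cover t2"
  proof
    assume "circle_cover t1 = circle_cover t2"
    then obtain n :: int where n: "t2 = t1 + of_int n" using circle_cover_eq_iff by blast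
    then have "n = 0" using cover_int_shift[OF h refl, of t1 0 n] ht by simp
    then show False using n t(1) by simp
  qed
  have ne': "circle_cover a \<noteq> circle_cover b"
  proof
    assume "circle_cover a = circle_cover b"
    then obtain n :: int where "b = a + of_int n" using circle_cover_eq_iff by blast
    then have "0 < n" "n < 1" using ab by simp_all
    then show False by simp
  qed
  define d where "d = cur a"
  have cur: "cur b = d" "cur t1 = d" "cur t2 = d"
    using coverD(3)[OF h, of a] coverD(3)[OF h, of b] ab(3) coverD(3)[OF h', of t1] coverD(3)[OF h', of t2] t(2,3)
    by (simp_all add: d_def)
  have "d \<in> double_points \<gamma>"
    unfolding double_points_def using ne' cur(1) d_def by (intro CollectI bexI[of _ "circle_cover a"] bexI[of _ "circle_cover b"]) auto
  then have card: "card {z \<in> sphere 0 1. \<gamma> z = d} = 2" using generic by (simp add: generic_regular_curve_def)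
  then have "finite {z \<in> sphere 0 1. \<gamma> z = d}" by (metis card.infinite zero_neq_numeral)
  moreover have "{circle_cover a, circle_cover b} \<subseteq> {z \<in> sphere 0 1. \<gamma> z = d}"
    using cur d_def by auto
  moreover have "card {circle_cover a, circle_cover b} = 2" using ne' by simp
  ultimately have "{circle_cover a, circle_cover b} = {z \<in> sphere 0 1. \<gamma> z = d}"
    using card by (intro card_subset_eq) auto
  then have "circle_cover t1 \<in> {circle_cover a, circle_cover b}" "circle_cover t2 \<in> {circle_cover a, circle_cover b}"
    using cur by auto
  then consider "circle_cover a = circle_cover t1" "circle_cover b = circle_cover t2"
    | "circle_cover b = circle_cover t1" "circle_cover a = circle_cover t2"
    using ne by fastforce
  then show thesis
  proof cases
    case 1
    then obtain m n :: int where "t1 = a + of_int m" "t2 = b + of_int n" using circle_cover_eq_iff by metis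
    moreover have "m = n" using cover_int_shift[OF h ab(3), of m n] ht calculation by simp
    ultimately show thesis using that by simp
  next
    case 2
    then obtain m n :: int where mn: "t1 = b + of_int m" "t2 = a + of_int n" using circle_cover_eq_iff by metis
    then have "m = n" using cover_int_shift[OF h ab(3)[symmetric], of m n] ht by simp
    then show thesis using mn t(1) ab(1) by simp
  qed
qed

text \<open>Parameter intervals shorter than a period on which the cover closes up, with one
  representative for each class under simultaneous integer shifts.\<close>

definition loop_pairs :: "(real \<Rightarrow> complex) \<Rightarrow> (real \<times> real) set" where
  "loop_pairs h = {(a, b). 0 \<le> a \<and> a < 1 \<and> a < b \<and> b < a + 1 \<and> h a = h b}"

lemma loop_pair_transversal:
  assumes h: "is_cover G p \<gamma> h" and ab: "(a, b) \<in> loop_pairs h"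
  shows "circle_cover a \<noteq> circle_cover b" "oriented_area (vd h a) (vd h b) \<noteq> 0"
proof -
  show "circle_cover a \<noteq> circle_cover b"
  proof
    assume "circle_cover a = circle_cover b"
    then obtain n :: int where "b = a + of_int n" using circle_cover_eq_iff by blast
    then have "0 < n" "n < 1" using ab by (simp_all add: loop_pairs_def)
    then show False by simp
  qed
  then show "oriented_area (vd h a) (vd h b) \<noteq> 0"
    using cover_transversal[OF h h] ab by (simp add: loop_pairs_def)
qed

text \<open>Injectivity is the uniqueness of the parameters up to a common integer, which 0 \<le> a
  < 1 fixes. For surjectivity either of the two loops at d may be the null-homotopic one; the loop
  on [b, a + 1] yields the pair (b, a + 1), up to a shift.\<close>

lemma bij_loop_pairs:
  assumes h: "is_cover G p \<gamma> h"
  shows "bij_betw (\<lambda>x. cur (fst x)) (loop_pairs h) (null_double_points M \<gamma>)"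
proof (rule bij_betwI')
  fix x y assume xy: "x \<in> loop_pairs h" "y \<in> loop_pairs h"
  obtain a b a' b' where ab: "x = (a, b)" "y = (a', b')" by (metis surj_pair)
  have 1: "0 \<le> a" "a < 1" "a < b" "b < a + 1" "h a = h b" and 2: "0 \<le> a'" "a' < 1" "a' < b'" "h a' = h b'"
    using xy by (auto simp: ab loop_pairs_def)
  have "x = y" if "cur a = cur a'"
  proof -
    have "p (h a') = cur a" using coverD(3)[OF h] that by simp
    then obtain n :: int where n: "a' = a + of_int n" "b' = b + of_int n"
      by (rule cover_double_point_parameters[OF h 1(3-5) h 2(3,4)])
    then have "n = 0" using 1 2 by linarith
    then show ?thesis using n ab by simp
  qed
  then show "cur (fst x) = cur (fst y) \<longleftrightarrow> x = y" by (auto simp: ab)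
next
  fix x assume x: "x \<in> loop_pairs h"
  obtain a b where ab: "x = (a, b)" by (metis surj_pair)
  have 1: "a < b" "b < a + 1" "h a = h b" using x by (auto simp: ab loop_pairs_def)
  have ne: "circle_cover a \<noteq> circle_cover b" using loop_pair_transversal[OF h] x ab by blast
  have cur: "cur a = cur b" using 1(3) coverD(3)[OF h] by metis
  have "cur a \<in> double_points \<gamma>"
    unfolding double_points_def using ne cur by (intro CollectI bexI[of _ "circle_cover a"] bexI[of _ "circle_cover b"]) auto
  moreover have "homotopic_paths M (sub_loop \<gamma> a b) (\<lambda>_. cur a)"
    using null_sub_loop_iff[OF h coverD(3)[OF h]] 1(3) by blast
  ultimately show "cur (fst x) \<in> null_double_points M \<gamma>"
    unfolding null_double_points_def ab using 1 cur by (simp only: fst_conv mem_Collect_eq) metis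
next
  fix d assume "d \<in> null_double_points M \<gamma>"
  then obtain a b where ab: "a < b" "b < a + 1" "cur a = d" "cur b = d"
    and hom: "homotopic_paths M (sub_loop \<gamma> a b) (\<lambda>_. d) \<or> homotopic_paths M (sub_loop \<gamma> b (a + 1)) (\<lambda>_. d)"
    unfolding null_double_points_def by blast
  have pd: "p (h a) = d" "p (h b) = d" using coverD(3)[OF h] ab by simp_all
  have main: "\<exists>x\<in>loop_pairs h. d = cur (fst x)" if *: "s < t" "t < s + 1" "h s = h t" "cur s = d" for s t
  proof -
    define n where "n = - \<lfloor>s\<rfloor>"
    have "h (s + of_int n) = h (t + of_int n)" using cover_int_shift[OF h *(3)] by blast
    moreover have "0 \<le> s + of_int n" "s + of_int n < 1" unfolding n_def by linarith+
    ultimately have "(s + of_int n, t + of_int n) \<in> loop_pairs h" using * by (simp add: loop_pairs_def)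
    moreover have "circle_cover (s + of_int n) = circle_cover s" using circle_cover_eq_iff by metis
    ultimately show ?thesis using *(4) by (metis fst_conv)
  qed
  from hom show "\<exists>x\<in>loop_pairs h. d = cur (fst x)"
  proof
    assume "homotopic_paths M (sub_loop \<gamma> a b) (\<lambda>_. d)"
    then show ?thesis using null_sub_loop_iff[OF h pd(1)] main[of a b] ab by blast
  next
    assume "homotopic_paths M (sub_loop \<gamma> b (a + 1)) (\<lambda>_. d)"
    then have "h b = h (a + 1)" using null_sub_loop_iff[OF h pd(2)] by blast
    then show ?thesis using main[of b "a + 1"] ab by simp
  qed
qed

text \<open>The two covers differ by a deck transformation, whose derivative at z is D. D depends on
  the point and not on the parameter, so both branches through a double point share it and the
  crossing sign is unchanged.\<close>

lemma shift_deck_vd: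
  assumes h: "is_cover G p \<gamma> h" and h': "is_cover G p \<gamma> h'"
  obtains D where "\<And>t. h t = z \<Longrightarrow> vd h' (t + of_int n) = vd h t * D" "z \<in> plane G \<Longrightarrow> D \<noteq> 0"
proof -
  obtain S where S: "deck_transformation G p S" "\<And>t. h' (t + of_int n) = S (h t)"
    using cover_deck[OF h shift_cover[OF h', of n]] by metis
  have vd: "vd h' (t + of_int n) = vd h t * D" if "h t = z" "(S has_field_derivative D) (at z)" for t D
  proof -
    have "((S \<circ> h) has_vector_derivative vd h t * D) (at t)"
      using field_vector_diff_chain_at[OF cover_C1(1)[OF h]] that by blast
    moreover have "((\<lambda>t. h' (of_int n + t * 1)) has_vector_derivative 1 *\<^sub>R vd h' (t + of_int n)) (at t)"
      by (rule has_vector_derivative_affine) (use cover_C1(1)[OF h', of "t + of_int n"] in \<open>simp add: add.commute\<close>)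
    moreover have "(\<lambda>t. h' (of_int n + t * 1)) = S \<circ> h" using S(2) by (auto simp: add.commute)
    ultimately show ?thesis using vector_derivative_unique_at by (metis scaleR_one)
  qed
  show thesis
  proof (cases "z \<in> plane G")
    case True
    then obtain D where "(S has_field_derivative D) (at z)" "D \<noteq> 0"
      using deck_transformation_derivative[OF surface covering S(1)] by metis
    then show thesis using that vd by blast
  next
    case False
    then show thesis using that[of 0] coverD(2)[OF h] by blast
  qed
qed

text \<open>The definite description is resolved: any other cover and parameters arise from h, a, b
  by a deck transformation and an integer shift, which preserve the sign.\<close>

lemma double_point_sign_loop_pair:
  assumes h: "is_cover G p \<gamma> h" and ab: "(a, b) \<in> loop_pairs h"
  shows "double_point_sign G M p \<gamma> (cur a) = cover_sign h a b"
proof -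
  have 1: "a < b" "b < a + 1" "h a = h b" using ab by (auto simp: loop_pairs_def)
  have "cur a \<in> null_double_points M \<gamma>"
    using bij_betwE[OF bij_loop_pairs[OF h]] ab by fastforce
  moreover have "(THE s. \<exists>h t\<^sub>1 t\<^sub>2. is_cover G p \<gamma> h \<and> t\<^sub>1 < t\<^sub>2 \<and> h t\<^sub>1 = h t\<^sub>2 \<and> p (h t\<^sub>1) = cur a \<and>
      s = cover_sign h t\<^sub>1 t\<^sub>2) = cover_sign h a b"
  proof (rule the_equality)
    show "\<exists>h' t\<^sub>1 t\<^sub>2. is_cover G p \<gamma> h' \<and> t\<^sub>1 < t\<^sub>2 \<and> h' t\<^sub>1 = h' t\<^sub>2 \<and> p (h' t\<^sub>1) = cur a \<and>
      cover_sign h a b = cover_sign h' t\<^sub>1 t\<^sub>2"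
      using h 1 coverD(3)[OF h] by metis
    fix s assume "\<exists>h t\<^sub>1 t\<^sub>2. is_cover G p \<gamma> h \<and> t\<^sub>1 < t\<^sub>2 \<and> h t\<^sub>1 = h t\<^sub>2 \<and> p (h t\<^sub>1) = cur a \<and>
      s = cover_sign h t\<^sub>1 t\<^sub>2"
    then obtain h' t1 t2 where h': "is_cover G p \<gamma> h'" "t1 < t2" "h' t1 = h' t2" "p (h' t1) = cur a"
      and s: "s = cover_sign h' t1 t2" by blast
    obtain n :: int where n: "t1 = a + of_int n" "t2 = b + of_int n"
      by (rule cover_double_point_parameters[OF h 1 h'])
    obtain D where D: "\<And>t. h t = h a \<Longrightarrow> vd h' (t + of_int n) = vd h t * D" "h a \<in> plane G \<Longrightarrow> D \<noteq> 0"
      by (rule shift_deck_vd[OF h h'(1)], rule that)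
    have "vd h' t1 = vd h a * D" "vd h' t2 = vd h b * D" "D \<noteq> 0"
      using D n 1(3) coverD(2)[OF h] by auto
    then show "s = cover_sign h a b" by (simp add: s cover_sign_def crossing_sign_mult)
  qed
  ultimately show ?thesis by (simp add: double_point_sign_def)
qed

lemma sum_sign_loop_pairs:
  assumes h: "is_cover G p \<gamma> h"
  shows "(\<Sum>(a, b)\<in>loop_pairs h. cover_sign h a b) = (\<Sum>d\<in>null_double_points M \<gamma>. double_point_sign G M p \<gamma> d)"
proof -
  have "(\<Sum>d\<in>null_double_points M \<gamma>. double_point_sign G M p \<gamma> d) =
      (\<Sum>x\<in>loop_pairs h. double_point_sign G M p \<gamma> (cur (fst x)))"
    by (rule sum.reindex_bij_betw[OF bij_loop_pairs[OF h], symmetric])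
  also have "\<dots> = (\<Sum>(a, b)\<in>loop_pairs h. cover_sign h a b)"
    by (rule sum.cong) (auto simp: double_point_sign_loop_pair[OF h])
  finally show ?thesis by simp
qed

lemma null_double_points_subset: "null_double_points M \<gamma> \<subseteq> double_points \<gamma>"
  by (auto simp: null_double_points_def)

section \<open>The winding number as the rotation number of the straightened cover\<close>

lemma continuous_on_straightened_velocity:
  assumes h: "is_cover G p \<gamma> h" and hol: "\<psi> holomorphic_on plane G"
  shows "continuous_on UNIV (\<lambda>t. vd h t * deriv \<psi> (h t))"
proof -
  have "continuous_on (plane G) (deriv \<psi>)"
    using holomorphic_deriv[OF hol open_plane] holomorphic_on_imp_continuous_on by blast
  then have "continuous_on UNIV (\<lambda>t. deriv \<psi> (h t))"
    by (rule continuous_on_compose2[OF _ coverD(1)[OF h]]) (use coverD(2)[OF h] in auto)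
  then show ?thesis by (intro continuous_intros cover_C1(3)[OF h])
qed

text \<open>Applies \<open>translational_curve_rotation\<close> to \<open>\<psi>\<close> after h.
  Since \<open>\<psi>\<close> is injective the double points are unchanged, and at each of them both
  velocities are multiplied by the same nonzero derivative, so transversality and signs
  survive.\<close>

lemma straightened_cover_rotation:
  assumes h: "is_cover G p \<gamma> h" and \<psi>: "\<psi> holomorphic_on plane G" "inj_on \<psi> (plane G)"
    and per: "\<And>t. \<psi> (h (t + 1)) = \<psi> (h t) + 1"
    and \<theta>: "continuous_on UNIV \<theta>" "\<And>t. \<exists>r>0. vd h t * deriv \<psi> (h t) = of_real r * cis (\<theta> t)"
  shows "\<theta> 1 - \<theta> 0 = 2 * pi * of_int (\<Sum>d\<in>null_double_points M \<gamma>. double_point_sign G M p \<gamma> d)"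
proof -
  define k where "k t = \<psi> (h t)" for t
  define k' where "k' t = vd h t * deriv \<psi> (h t)" for t
  have d\<psi>: "deriv \<psi> z \<noteq> 0" if "z \<in> plane G" for z
    using holomorphic_injective_imp_regular[OF \<psi>(1) open_plane \<psi>(2) that] .
  have k: "(k has_vector_derivative k' t) (at t)" for t
  proof -
    have "(\<psi> has_field_derivative deriv \<psi> (h t)) (at (h t))"
      using \<psi>(1) open_plane coverD(2)[OF h] holomorphic_derivI by blast
    then have "((\<psi> \<circ> h) has_vector_derivative k' t) (at t)"
      unfolding k'_def by (rule field_vector_diff_chain_at[OF cover_C1(1)[OF h]])
    then show ?thesis by (simp add: k_def[abs_def] o_def)
  qed
  have cont: "continuous_on UNIV k'"
    unfolding k'_def by (rule continuous_on_straightened_velocity[OF h \<psi>(1)])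
  have eq: "k a = k b \<longleftrightarrow> h a = h b" for a b
    unfolding k_def using inj_on_eq_iff[OF \<psi>(2)] coverD(2)[OF h] by blast
  have Q: "loop_pairs h = {(a, b). 0 \<le> a \<and> a < 1 \<and> a < b \<and> b < a + 1 \<and> k a = k b}"
    by (simp add: loop_pairs_def eq)
  have fin: "finite (loop_pairs h)"
    using bij_betw_finite[OF bij_loop_pairs[OF h]] finite_subset[OF null_double_points_subset finite_double_points]
    by blast
  have sign: "oriented_area (k' a) (k' b) \<noteq> 0 \<and> crossing_sign (k' a) (k' b) = cover_sign h a b"
    if "(a, b) \<in> loop_pairs h" for a b
  proof -
    have "h a = h b" using that by (simp add: loop_pairs_def)
    then have "k' a = vd h a * deriv \<psi> (h a)" "k' b = vd h b * deriv \<psi> (h a)" by (simp_all add: k'_def)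
    then show ?thesis
      using loop_pair_transversal(2)[OF h that] d\<psi>[OF coverD(2)[OF h]]
      by (simp add: crossing_sign_mult cover_sign_def oriented_area_mult)
  qed
  have "\<theta> 1 - \<theta> 0 = 2 * pi * of_int (\<Sum>(a, b)\<in>loop_pairs h. crossing_sign (k' a) (k' b))"
  proof (rule translational_curve_rotation[OF k cont _ _ Q fin _ \<theta>(1)])
    show "k' t \<noteq> 0" for t using cover_C1(2)[OF h] d\<psi>[OF coverD(2)[OF h]] by (simp add: k'_def)
    show "k (t + 1) = k t + 1" for t by (simp add: k_def per)
  qed (use sign \<theta>(2) in \<open>auto simp: k'_def\<close>)
  also have "(\<Sum>(a, b)\<in>loop_pairs h. crossing_sign (k' a) (k' b)) = (\<Sum>(a, b)\<in>loop_pairs h. cover_sign h a b)"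
    by (rule sum.cong) (use sign in auto)
  finally show ?thesis using sum_sign_loop_pairs[OF h] by simp
qed

text \<open>Existence takes the field 1 / \<open>deriv \<psi>\<close> and an angle from a logarithm
  of the straightened velocity. For uniqueness, any admissible field satisfies
  \<open>deriv \<psi> z * X z = 1\<close>, so every admissible angle function is an argument of that
  same velocity for its cover, and \<open>straightened_cover_rotation\<close> gives the same
  value.\<close>

lemma curve_winding_eq:
  "curve_winding G p \<gamma> = (\<Sum>d\<in>null_double_points M \<gamma>. double_point_sign G M p \<gamma> d)" (is "_ = ?S")
  unfolding curve_winding_def
proof (rule the_equality)
  obtain h where h: "is_cover G p \<gamma> h" by (rule cover_exists)
  obtain T where T: "deck_transformation G p T" "\<And>t. T (h t) = h (t + 1)"
    using shift_deck[OF h] by metis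
  obtain \<psi> \<phi> where \<psi>: "\<psi> holomorphic_on plane G" "inj_on \<psi> (plane G)"
    and grp: "one_parameter_isometry_group G \<phi>" "\<And>z. z \<in> plane G \<Longrightarrow> \<phi> 1 z = T z"
    and transl: "\<And>s z. z \<in> plane G \<Longrightarrow> \<psi> (\<phi> s z) = \<psi> z + of_real s"
    and per: "\<And>t. \<psi> (h (t + 1)) = \<psi> (h t) + 1"
    by (rule straightening[OF h T], rule that)
  have d\<psi>: "deriv \<psi> (h t) \<noteq> 0" for t
    using holomorphic_injective_imp_regular[OF \<psi>(1) open_plane \<psi>(2)] coverD(2)[OF h] by blast
  define f where "f t = vd h t * deriv \<psi> (h t)" for t
  have contf: "continuous_on UNIV f"
    unfolding f_def by (rule continuous_on_straightened_velocity[OF h \<psi>(1)])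
  have fnz: "f t \<noteq> 0" for t using cover_C1(2)[OF h] d\<psi> by (simp add: f_def)
  have contr: "contractible (UNIV :: real set)" by (rule convex_imp_contractible[OF convex_UNIV])
  obtain L where L: "continuous_on UNIV L" "\<And>t. t \<in> UNIV \<Longrightarrow> f t = exp (L t)"
    using continuous_logarithm_on_contractible[OF contf contr fnz] by blast
  define \<theta> where "\<theta> t = Im (L t)" for t
  have f: "f t = of_real (exp (Re (L t))) * cis (\<theta> t)" for t
    using L(2)[of t] by (simp add: \<theta>_def exp_eq_polar)
  have cont\<theta>: "continuous_on UNIV \<theta>" unfolding \<theta>_def by (intro continuous_intros L(1))
  have "angle_function (\<lambda>z. 1 / deriv \<psi> z) h \<theta>"
    unfolding angle_function_def
  proof (intro conjI allI cont\<theta>)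
    fix t
    show "1 / deriv \<psi> (h t) \<noteq> 0" using d\<psi> by simp
    have "vd h t = of_real (exp (Re (L t))) * cis (\<theta> t) * (1 / deriv \<psi> (h t))"
      using f[of t] d\<psi>[of t] by (simp add: f_def field_simps)
    then show "\<exists>r>0. vd h t = of_real r * cis (\<theta> t) * (1 / deriv \<psi> (h t))"
      by (intro exI[of _ "exp (Re (L t))"]) simp
  qed
  moreover have "\<theta> 1 - \<theta> 0 = 2 * pi * of_int ?S"
  proof (rule straightened_cover_rotation[OF h \<psi> per cont\<theta>])
    show "\<exists>r>0. vd h t * deriv \<psi> (h t) = of_real r * cis (\<theta> t)" for t
      using f[of t] by (intro exI[of _ "exp (Re (L t))"]) (simp add: f_def)
  qed
  moreover have "generating_field G \<phi> (\<lambda>z. 1 / deriv \<psi> z)"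
    by (rule generating_field_exists[OF grp(1) \<psi> transl])
  ultimately show "\<exists>h T \<phi> X \<theta>. is_cover G p \<gamma> h \<and> deck_transformation G p T \<and> (\<forall>t. T (h t) = h (t + 1)) \<and>
        one_parameter_isometry_group G \<phi> \<and> (\<forall>z\<in>plane G. \<phi> 1 z = T z) \<and>
        generating_field G \<phi> X \<and> angle_function X h \<theta> \<and>
        of_int ?S = (\<theta> 1 - \<theta> 0) / (2 * pi)"
    using h T grp
    by (intro exI[of _ h] exI[of _ T] exI[of _ \<phi>] exI[of _ "\<lambda>z. 1 / deriv \<psi> z"] exI[of _ \<theta>]) simp
next
  fix w :: int
  assume "\<exists>h T \<phi> X \<theta>. is_cover G p \<gamma> h \<and> deck_transformation G p T \<and> (\<forall>t. T (h t) = h (t + 1)) \<and>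
        one_parameter_isometry_group G \<phi> \<and> (\<forall>z\<in>plane G. \<phi> 1 z = T z) \<and>
        generating_field G \<phi> X \<and> angle_function X h \<theta> \<and>
        of_int w = (\<theta> 1 - \<theta> 0) / (2 * pi)"
  then obtain h T \<phi> X \<theta> where h: "is_cover G p \<gamma> h" and T: "deck_transformation G p T" "\<And>t. T (h t) = h (t + 1)"
    and grp: "one_parameter_isometry_group G \<phi>" "\<And>z. z \<in> plane G \<Longrightarrow> \<phi> 1 z = T z"
    and X: "generating_field G \<phi> X" and \<theta>: "angle_function X h \<theta>"
    and w: "of_int w = (\<theta> 1 - \<theta> 0) / (2 * pi)" by metis
  obtain \<psi> \<phi>0 where \<psi>: "\<psi> holomorphic_on plane G" "inj_on \<psi> (plane G)"
    and grp0: "\<And>z. z \<in> plane G \<Longrightarrow> \<phi>0 1 z = T z" "\<And>s z. z \<in> plane G \<Longrightarrow> \<psi> (\<phi>0 s z) = \<psi> z + of_real s"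
    and transl: "\<And>\<phi>' s. one_parameter_isometry_group G \<phi>' \<Longrightarrow> \<forall>z\<in>plane G. \<phi>' 1 z = T z \<Longrightarrow>
       \<exists>\<beta>. \<forall>z\<in>plane G. \<psi> (\<phi>' s z) = \<psi> z + \<beta>"
    and per: "\<And>t. \<psi> (h (t + 1)) = \<psi> (h t) + 1"
    by (rule straightening[OF h T], rule that)
  have one: "\<psi> (\<phi> 1 z) = \<psi> z + 1" if "z \<in> plane G" for z
    using grp0(1)[OF that] grp0(2)[OF that, of 1] grp(2)[OF that] by simp
  have dX: "deriv \<psi> (h t) * X (h t) = 1" for t
    by (rule generating_field_coordinate[OF grp(1) X \<psi>(1) transl[OF grp(1)] one coverD(2)[OF h]])
      (use grp(2) in blast)
  have "\<theta> 1 - \<theta> 0 = 2 * pi * of_int ?S"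
  proof (rule straightened_cover_rotation[OF h \<psi> per])
    show "continuous_on UNIV \<theta>" using \<theta> by (simp add: angle_function_def)
    fix t
    obtain r where r: "r > 0" "vd h t = of_real r * cis (\<theta> t) * X (h t)"
      using \<theta> unfolding angle_function_def by blast
    have "vd h t * deriv \<psi> (h t) = of_real r * cis (\<theta> t) * (deriv \<psi> (h t) * X (h t))"
      unfolding r(2) by (simp add: mult_ac)
    then show "\<exists>r>0. vd h t * deriv \<psi> (h t) = of_real r * cis (\<theta> t)" using r(1) dX by auto
  qed
  then have "of_int w = (of_int ?S :: real)" using w by simp
  then show "w = ?S" by (simp only: of_int_eq_iff)
qed

lemma sum_sign_double_points:
  "(\<Sum>d\<in>double_points \<gamma>. double_point_sign G M p \<gamma> d) =
   (\<Sum>d\<in>null_double_points M \<gamma>. double_point_sign G M p \<gamma> d)"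
  by (rule sum.mono_neutral_right[OF finite_double_points null_double_points_subset])
     (auto simp: double_point_sign_def)

end

theorem theorem1:
  fixes G :: geometry
    and M :: "'m::t2_space set"
    and A :: "('m set \<times> ('m \<Rightarrow> complex)) set"
    and p :: "complex \<Rightarrow> 'm"
    and \<gamma> :: "complex \<Rightarrow> 'm"
  assumes "geometric_surface G M A"
    and "geodesically_complete G A"
    and "universal_covering G M A p"
    and "generic_regular_curve M A \<gamma>"
    and "\<not> null_homotopic_curve M \<gamma>"
  shows "curve_winding G p \<gamma> = (\<Sum>d\<in>double_points \<gamma>. double_point_sign G M p \<gamma> d) \<and>
         (\<Sum>d\<in>double_points \<gamma>. double_point_sign G M p \<gamma> d) =
           (\<Sum>d\<in>null_double_points M \<gamma>. double_point_sign G M p \<gamma> d)"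
proof -
  interpret generic_curve G M A p \<gamma>
    using assms by (simp add: generic_curve_def)
  show ?thesis using curve_winding_eq sum_sign_double_points by simp
qed

end
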